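(* Let $H$ be a totally geodesic hyperplane of the hyperbolic space $\mathbb{H}^n$. Let $\Sigma$ be a minimal $k$-dimensional submanifold of $\mathbb{H}^n$ such that, in the compactification of $\mathbb{H}^n$ as the unit ball, the closure of $\Sigma$ does not intersect $H$. Let $d$ be the hyperbolic distance from $\Sigma$ to $H$, let $a$ be any number in $(0,\sinh d]$, and let $A(t)$ be the $k$-volume of the region $\Sigma_t=\{p\in\Sigma:\sinh\operatorname{dist}(p,H)\le t\}$ of $\Sigma$. Then the function $$\frac{A(t)}{Q_{+1}(a,t)},\qquad Q_{+1}(a,t)=\int_a^t (s^2+1)^{\frac k2-1}\,ds+\frac{1}{ka}(a^2+1)^{\frac k2},$$ is increasing in $t$.
   Context: $\mathbb{H}^n$ is the hyperbolic space of constant sectional curvature $-1$. Minimal means vanishing mean curvature. $\operatorname{dist}$ is the hyperbolic distance. "Increasing" is in the weak sense (nondecreasing).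
   Formalization: The minimal submanifold Σ is additionally assumed to be closed as a subset of hyperbolic space (properly embedded, no edge inside); without this the claim fails, e.g. for a small open disc in a totally geodesic k-plane disjoint from H. *)

theory Defs
  imports "HOL-Analysis.Analysis"
begin

section \<open>Smooth maps and submanifolds of Euclidean spaces\<close>

(* Only meant for open U. *)
primrec Ck_on :: "nat \<Rightarrow> ('a::euclidean_space \<Rightarrow> 'b::euclidean_space) \<Rightarrow> 'a set \<Rightarrow> bool" where
  "Ck_on 0 f U \<longleftrightarrow> continuous_on U f"
| "Ck_on (Suc m) f U \<longleftrightarrow> (\<forall>x\<in>U. f differentiable (at x)) \<and>
      (\<forall>v. Ck_on m (\<lambda>x. frechet_derivative f (at x) v) U)"

definition smooth_on :: "('a::euclidean_space \<Rightarrow> 'b::euclidean_space) \<Rightarrow> 'a set \<Rightarrow> bool" where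
  "smooth_on f U \<longleftrightarrow> (\<forall>m. Ck_on m f U)"

(* Embedded m-dimensional submanifold without boundary, by slice charts. *)
definition submanifold :: "nat \<Rightarrow> 'a::euclidean_space set \<Rightarrow> bool" where
  "submanifold m S \<longleftrightarrow>
     (\<forall>p\<in>S. \<exists>W V \<Phi> \<Psi>. \<exists>L :: 'a set.
        open W \<and> p \<in> W \<and> open V \<and> smooth_on \<Phi> W \<and> smooth_on \<Psi> V \<and>
        homeomorphism W V \<Phi> \<Psi> \<and> subspace L \<and> dim L = m \<and> \<Phi> ` (S \<inter> W) = V \<inter> L)"

definition tangent_space :: "'a::euclidean_space set \<Rightarrow> 'a \<Rightarrow> 'a set" where
  "tangent_space S p =
     {v. \<exists>e>0. \<exists>\<gamma>::real \<Rightarrow> 'a. smooth_on \<gamma> {-e<..<e} \<and> \<gamma> ` {-e<..<e} \<subseteq> S \<and> \<gamma> 0 = p \<and>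
           (\<gamma> has_vector_derivative v) (at 0)}"

definition tangent_field_near :: "'a::euclidean_space set \<Rightarrow> 'a \<Rightarrow> ('a \<Rightarrow> 'a) \<Rightarrow> bool" where
  "tangent_field_near S p X \<longleftrightarrow>
     (\<exists>W. open W \<and> p \<in> W \<and> smooth_on X W \<and> (\<forall>q\<in>S \<inter> W. X q \<in> tangent_space S q))"

section \<open>Hyperbolic space: the hyperboloid model\<close>

type_synonym 'n minkowski = "(real ^ 'n) \<times> real"

definition lor :: "'n::finite minkowski \<Rightarrow> 'n minkowski \<Rightarrow> real" where
  "lor p q = fst p \<bullet> fst q - snd p * snd q"

definition hyp :: "'n::finite minkowski set" where
  "hyp = {p. lor p p = - 1 \<and> 0 < snd p}"

definition hdist :: "'n::finite minkowski \<Rightarrow> 'n minkowski \<Rightarrow> real" where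
  "hdist p q = arcosh (- lor p q)"

definition hdist_point_set :: "'n::finite minkowski \<Rightarrow> 'n minkowski set \<Rightarrow> real" where
  "hdist_point_set p B = (INF q\<in>B. hdist p q)"

definition hdist_sets :: "'n::finite minkowski set \<Rightarrow> 'n minkowski set \<Rightarrow> real" where
  "hdist_sets A B = (INF p\<in>A. hdist_point_set p B)"

(* Identification of the hyperboloid with the open unit ball (the Poincare ball), by
   stereographic projection from (0, -1).  The compactification is the closed unit ball. *)
definition to_ball :: "'n::finite minkowski \<Rightarrow> real ^ 'n" where
  "to_ball p = (1 / (1 + snd p)) *\<^sub>R fst p"

section \<open>Extrinsic geometry of submanifolds of hyperbolic space\<close>

(* Lorentz-orthogonal projection onto the tangent space of hyp at p, for p in hyp. *)
definition hyp_proj :: "'n::finite minkowski \<Rightarrow> 'n minkowski \<Rightarrow> 'n minkowski" where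
  "hyp_proj p w = w + lor w p *\<^sub>R p"

(* The Levi-Civita connection of hyp: the tangential part of the flat derivative of X at p
   in the direction u. *)
definition hyp_nabla :: "'n::finite minkowski \<Rightarrow> 'n minkowski \<Rightarrow> ('n minkowski \<Rightarrow> 'n minkowski) \<Rightarrow> 'n minkowski" where
  "hyp_nabla p u X = hyp_proj p (frechet_derivative X (at p) u)"

definition normal_space :: "'n::finite minkowski set \<Rightarrow> 'n minkowski \<Rightarrow> 'n minkowski set" where
  "normal_space S p = {w \<in> tangent_space hyp p. \<forall>v\<in>tangent_space S p. lor w v = 0}"

definition normal_part :: "'n::finite minkowski set \<Rightarrow> 'n minkowski \<Rightarrow> 'n minkowski \<Rightarrow> 'n minkowski" where
  "normal_part S p w = (THE z. z \<in> normal_space S p \<and> w - z \<in> tangent_space S p)"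

(* II(u,v) is the normal part of nabla_u X for any local tangent field X extending v; the
   result does not depend on the extension. *)
definition second_fundamental_form ::
    "'n::finite minkowski set \<Rightarrow> 'n minkowski \<Rightarrow> 'n minkowski \<Rightarrow> 'n minkowski \<Rightarrow> 'n minkowski" where
  "second_fundamental_form S p u v =
     (THE z. \<exists>X. tangent_field_near S p X \<and> X p = v \<and> z = normal_part S p (hyp_nabla p u X))"

definition orthonormal_basis :: "'n::finite minkowski set \<Rightarrow> 'n minkowski set \<Rightarrow> bool" where
  "orthonormal_basis T B \<longleftrightarrow> finite B \<and> B \<subseteq> T \<and> T = span B \<and>
     (\<forall>e\<in>B. \<forall>f\<in>B. lor e f = (if e = f then 1 else 0))"

(* Trace of the second fundamental form; independent of the choice of the basis. *)
definition mean_curvature :: "'n::finite minkowski set \<Rightarrow> 'n minkowski \<Rightarrow> 'n minkowski" where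
  "mean_curvature S p =
     (\<Sum>e\<in>(SOME B. orthonormal_basis (tangent_space S p) B). second_fundamental_form S p e e)"

definition minimal_submanifold :: "nat \<Rightarrow> 'n::finite minkowski set \<Rightarrow> bool" where
  "minimal_submanifold k S \<longleftrightarrow> S \<subseteq> hyp \<and> submanifold k S \<and> (\<forall>p\<in>S. mean_curvature S p = 0)"

definition totally_geodesic :: "'n::finite minkowski set \<Rightarrow> bool" where
  "totally_geodesic S \<longleftrightarrow>
     (\<forall>p\<in>S. \<forall>u\<in>tangent_space S p. \<forall>v\<in>tangent_space S p. second_fundamental_form S p u v = 0)"

(* Closedness in the flat ambient space is the same as closedness in hyp; it makes H complete. *)
definition totally_geodesic_hyperplane :: "'n::finite minkowski set \<Rightarrow> bool" where
  "totally_geodesic_hyperplane H \<longleftrightarrow> H \<subseteq> hyp \<and> submanifold (CARD('n) - 1) H \<and> H \<noteq> {} \<and>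
     connected H \<and> closed H \<and> totally_geodesic H"

section \<open>Riemannian volume of k-dimensional submanifolds\<close>

definition local_param ::
    "'n::finite minkowski set \<Rightarrow> (real ^ 'k) set \<Rightarrow> (real ^ 'k::finite \<Rightarrow> 'n minkowski) \<Rightarrow> bool" where
  "local_param S U r \<longleftrightarrow> open U \<and> smooth_on r U \<and> (\<forall>u\<in>U. inj (frechet_derivative r (at u))) \<and>
     openin (top_of_set S) (r ` U) \<and> (\<exists>s. homeomorphism U (r ` U) r s)"

definition countable_atlas ::
    "'n::finite minkowski set \<Rightarrow> (nat \<Rightarrow> (real ^ 'k) set \<times> (real ^ 'k::finite \<Rightarrow> 'n minkowski)) \<Rightarrow> bool" where
  "countable_atlas S \<A> \<longleftrightarrow> (\<forall>i. local_param S (fst (\<A> i)) (snd (\<A> i))) \<and>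
     S = (\<Union>i. snd (\<A> i) ` fst (\<A> i))"

definition gram :: "(real ^ 'k::finite \<Rightarrow> 'n::finite minkowski) \<Rightarrow> real ^ 'k \<Rightarrow> real ^ 'k ^ 'k" where
  "gram r u = (\<chi> i j. lor (frechet_derivative r (at u) (axis i 1)) (frechet_derivative r (at u) (axis j 1)))"

(* k-volume, k = CARD('k), of a Borel subset E of the submanifold S: cover S by countably many
   parametrized patches, cut E into the pieces lying in the i-th but in no earlier patch, and
   integrate the density sqrt(det g) over each piece.  By the change of variables formula this
   does not depend on the atlas. *)
definition k_volume :: "'k::finite itself \<Rightarrow> 'n::finite minkowski set \<Rightarrow> 'n minkowski set \<Rightarrow> ennreal" where
  "k_volume _ S E =
     (let \<A> = (SOME \<A> :: nat \<Rightarrow> (real ^ 'k) set \<times> (real ^ 'k \<Rightarrow> 'n minkowski). countable_atlas S \<A>);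
          U = (\<lambda>i. fst (\<A> i)); r = (\<lambda>i. snd (\<A> i))
      in \<Sum>i. \<integral>\<^sup>+ u \<in> {u \<in> U i. r i u \<in> E \<and> (\<forall>j<i. r i u \<notin> r j ` U j)}.
                  ennreal (sqrt (det (gram (r i) u))) \<partial>lborel)"

section \<open>The comparison function\<close>

(* The interval integral is oriented, so t < a is allowed. *)
definition Q_plus :: "nat \<Rightarrow> real \<Rightarrow> real \<Rightarrow> real" where
  "Q_plus k a t = (LBINT s=ereal a..ereal t. (s\<^sup>2 + 1) powr (real k / 2 - 1))
                  + 1 / (real k * a) * (a\<^sup>2 + 1) powr (real k / 2)"

end

theory Submission
  imports Defs "HOL-Real_Asymp.Real_Asymp"
begin

text \<open>
  In the hyperboloid model a totally geodesic hyperplane is $\{x=0\}$ for a linear function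
  $x=\langle\cdot,\nu\rangle$ with $\langle\nu,\nu\rangle=1$, and $\sinh\operatorname{dist}(p,H)=|x(p)|$.
  On a minimal $k$-dimensional $\Sigma$ one has $\Delta_\Sigma x=kx$ and $|\nabla_\Sigma x|^2\le 1+x^2$.
  Put $F=Q\,(1+x^2)^{-k/2}$. It solves $(1+x^2)F'+kxF=1$ and has $F'\le 0$ for $x\ge a$, so
  for a nonincreasing cutoff $\zeta(|x|)\ge 0$ the divergence of $\zeta F\nabla x$ is at least $\zeta+\zeta' Q/Q'$.
  Its integral vanishes, and the choice $\zeta=1/\max(Q,Q(t_1))-1/Q(t_2)$ below $t_2$ turns
  $\int(\zeta+\zeta' Q/Q')\le 0$ into $A(t_1)/Q(t_1)\le A(t_2)/Q(t_2)$.

  $\Sigma_t$ need not be compact, since $\Sigma$ may approach the ideal boundary of $H$. The field is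
  therefore also cut off at height $R$ in the hyperboloid. The error has a bounded
  integrand that tends to 0, and it is integrable as soon as $A(t_2)$ is finite.
\<close>

section \<open>Calculus of smooth maps\<close>

text \<open>For a function f of x, div(f(x) grad x) = f'(x) |grad x|^2 + k x f(x) on a minimal
  submanifold. If |grad x|^2 were equal to 1 + x^2, the equation for F would say div(F grad x) = 1;
  since F' <= 0, a smaller |grad x|^2 can only increase the divergence. The additive constant in Q
  makes F'(a) = 0 and is the smallest one with F' <= 0 on [a,\<infinity>). The cutoff is dictated by
  the wish that \<zeta> + \<zeta>' Q/Q' = (\<zeta> Q)'/Q' be piecewise constant, which leaves only
  const + const/Q on each piece. Three obstacles shape the development. Hyperplanes and mean
  curvature are given through curves, local fields and choice operators, and must become chart
  formulas before any analysis. The volume comes from an arbitrarily chosen atlas, while integration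
  by parts happens in slice charts, so a change of variables has to connect the two. Finally
  \<Sigma> may lie on both sides of H, so the radial factor is continued as an odd function of
  x.\<close>

lemma frechet_derivative_eqI:
  "(f has_derivative f') (at x) \<Longrightarrow> frechet_derivative f (at x) = f'"
  by (metis frechet_derivative_at)

text \<open>Congruence on U enters as the assumption \<open>cong\<close>, because this rule is
  itself what proves \<open>Ck_on_cong\<close> by induction; \<open>Ck_on_SucI'\<close> then
  discharges it for open U.\<close>

lemma Ck_on_SucI:
  fixes f :: "'a::euclidean_space \<Rightarrow> 'b::euclidean_space"
  assumes "\<And>x. x \<in> U \<Longrightarrow> (f has_derivative f' x) (at x)"
    and "\<And>v. Ck_on m (\<lambda>x. f' x v) U"
    and cong: "\<And>g h :: 'a \<Rightarrow> 'b. (\<And>x. x \<in> U \<Longrightarrow> g x = h x) \<Longrightarrow> Ck_on m g U \<Longrightarrow> Ck_on m h U"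
  shows "Ck_on (Suc m) f U"
proof -
  have "Ck_on m (\<lambda>x. frechet_derivative f (at x) v) U" for v
    by (rule cong[of "\<lambda>x. f' x v"]) (simp_all add: frechet_derivative_eqI[OF assms(1)] assms(2))
  then show ?thesis using assms(1) by (auto simp: differentiable_def)
qed

lemma Ck_on_cong:
  assumes "open U" "\<And>x. x \<in> U \<Longrightarrow> f x = g x" "Ck_on m f U"
  shows "Ck_on m g U"
  using assms(2,3)
proof (induction m arbitrary: f g)
  case 0
  then show ?case using continuous_on_cong by (metis Ck_on.simps(1))
next
  case (Suc m)
  have d: "(g has_derivative frechet_derivative f (at x)) (at x)" if "x \<in> U" for x
  proof (rule has_derivative_transform_within_open[OF _ assms(1) that])
    show "(f has_derivative frechet_derivative f (at x)) (at x)"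
      using Suc.prems(2) that by (simp add: frechet_derivative_works[symmetric])
  qed (use Suc.prems in auto)
  show ?case
    by (rule Ck_on_SucI[OF d]) (use Suc in auto)
qed

lemma Ck_on_SucI':
  assumes "open U" "\<And>x. x \<in> U \<Longrightarrow> (f has_derivative f' x) (at x)"
    and "\<And>v. Ck_on m (\<lambda>x. f' x v) U"
  shows "Ck_on (Suc m) f U"
  by (rule Ck_on_SucI[OF assms(2,3)]) (use Ck_on_cong[OF assms(1)] in auto)

lemma Ck_on_SucD:
  assumes "Ck_on (Suc m) f U"
  shows "x \<in> U \<Longrightarrow> (f has_derivative frechet_derivative f (at x)) (at x)"
    and "Ck_on m (\<lambda>x. frechet_derivative f (at x) v) U"
  using assms by (auto simp: frechet_derivative_works[symmetric])

lemma Ck_on_mono: "Ck_on (Suc m) f U \<Longrightarrow> Ck_on m f U"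
proof (induction m arbitrary: f)
  case 0
  then show ?case
    by (auto intro!: continuous_at_imp_continuous_on differentiable_imp_continuous_within)
next
  case (Suc m)
  then show ?case by (metis Ck_on.simps(2))
qed

lemma Ck_on_subset: "Ck_on m f U \<Longrightarrow> V \<subseteq> U \<Longrightarrow> Ck_on m f V"
proof (induction m arbitrary: f)
  case 0
  then show ?case by (auto intro: continuous_on_subset)
qed auto

lemma Ck_on_const: "open U \<Longrightarrow> Ck_on m (\<lambda>x. c) U"
proof (induction m arbitrary: c)
  case (Suc m)
  show ?case by (rule Ck_on_SucI'[where f'="\<lambda>_ _. 0"]) (use Suc in auto)
qed auto

lemma Ck_on_bounded_linear:
  assumes "open U" "bounded_linear l"
  shows "Ck_on m l U"
proof (cases m)
  case (Suc m')
  have "Ck_on (Suc m') l U"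
    by (rule Ck_on_SucI'[where f'="\<lambda>_. l"])
       (use assms in \<open>auto intro: Ck_on_const bounded_linear_imp_has_derivative\<close>)
  then show ?thesis using Suc by simp
qed (use assms in \<open>auto intro: linear_continuous_on\<close>)

lemma Ck_on_add:
  assumes "open U" "Ck_on m f U" "Ck_on m g U"
  shows "Ck_on m (\<lambda>x. f x + g x) U"
  using assms(2,3)
proof (induction m arbitrary: f g)
  case 0
  then show ?case by (auto intro: continuous_on_add)
next
  case (Suc m)
  note D = Ck_on_SucD[OF Suc.prems(1)] Ck_on_SucD[OF Suc.prems(2)]
  show ?case
    by (rule Ck_on_SucI'[OF assms(1) has_derivative_add[OF D(1) D(3)]]) (use D Suc in auto)
qed

lemma Ck_on_sum:
  assumes "open U" "\<And>i. i \<in> I \<Longrightarrow> Ck_on m (f i) U"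
  shows "Ck_on m (\<lambda>x. \<Sum>i\<in>I. f i x) U"
  using assms(2)
  by (induction I rule: infinite_finite_induct)
     (use assms(1) in \<open>auto intro!: Ck_on_const Ck_on_add\<close>)

text \<open>One Leibniz rule for scalar multiples, products, inner products and \<open>lor\<close>.
  The undifferentiated factors reappear in the derivative, so their order is lowered with
  \<open>Ck_on_mono\<close> before the induction hypothesis applies.\<close>

lemma Ck_on_bilinear:
  fixes pr :: "'b::euclidean_space \<Rightarrow> 'c::euclidean_space \<Rightarrow> 'd::euclidean_space"
  assumes "open U" "bounded_bilinear pr" "Ck_on m f U" "Ck_on m g U"
  shows "Ck_on m (\<lambda>x. pr (f x) (g x)) U"
  using assms(3,4)
proof (induction m arbitrary: f g)
  case 0
  then show ?case using bounded_bilinear.continuous_on[OF assms(2)] by auto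
next
  case (Suc m)
  note D = Ck_on_SucD[OF Suc.prems(1)] Ck_on_SucD[OF Suc.prems(2)]
  show ?case
    by (rule Ck_on_SucI'[OF assms(1) bounded_bilinear.FDERIV[OF assms(2) D(1) D(3)]])
       (auto intro!: Ck_on_add[OF assms(1)] Suc.IH D(2,4) Ck_on_mono[OF Suc.prems(1)] Ck_on_mono[OF Suc.prems(2)]
             simp del: Ck_on.simps)
qed

lemma Ck_on_scaleR:
  assumes "open U" "Ck_on m c U" "Ck_on m f U"
  shows "Ck_on m (\<lambda>x. c x *\<^sub>R f x) U"
  by (rule Ck_on_bilinear[OF assms(1) bounded_bilinear_scaleR assms(2,3)])

lemma Ck_on_linear_comp:
  assumes "open U" "bounded_linear l" "Ck_on m f U"
  shows "Ck_on m (\<lambda>x. l (f x)) U"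
  using assms(3)
proof (induction m arbitrary: f)
  case 0
  then show ?case using assms(2)
    by (auto intro: bounded_linear.continuous_on)
next
  case (Suc m)
  note D = Ck_on_SucD[OF Suc.prems(1)]
  show ?case
    by (rule Ck_on_SucI'[OF assms(1) bounded_linear.has_derivative[OF assms(2) D(1)]])
       (use D Suc in auto)
qed

lemma linear_Basis_expansion:
  fixes l :: "'a::euclidean_space \<Rightarrow> 'b::real_vector"
  assumes "linear l"
  shows "l v = (\<Sum>b\<in>Basis. (v \<bullet> b) *\<^sub>R l b)"
proof -
  have "l v = l (\<Sum>b\<in>Basis. (v \<bullet> b) *\<^sub>R b)" by (simp add: euclidean_representation)
  also have "\<dots> = (\<Sum>b\<in>Basis. (v \<bullet> b) *\<^sub>R l b)"
    using assms by (simp add: linear_sum linear_scale)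
  finally show ?thesis .
qed

lemma Ck_on_compose:
  assumes "open U" "open V" "\<And>x. x \<in> U \<Longrightarrow> f x \<in> V" "Ck_on m g V" "Ck_on m f U"
  shows "Ck_on m (\<lambda>x. g (f x)) U"
  using assms(4,5)
proof (induction m arbitrary: g)
  case 0
  then show ?case using assms(3) by (auto intro: continuous_on_compose2)
next
  case (Suc m)
  note D = Ck_on_SucD[OF Suc.prems(1)] Ck_on_SucD[OF Suc.prems(2)]
  \<comment> \<open>\<open>Ck_on\<close> controls derivatives in fixed directions, whereas the chain
    rule applies the derivative of g to the moving vector f'(x)v. Expanding that vector in
    \<open>Basis\<close> leaves products and compositions covered by the induction
    hypothesis.\<close>
  have d: "((\<lambda>x. g (f x)) has_derivative
      (\<lambda>v. \<Sum>b\<in>Basis. (frechet_derivative f (at x) v \<bullet> b) *\<^sub>R frechet_derivative g (at (f x)) b)) (at x)"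
    if "x \<in> U" for x
  proof -
    have "((\<lambda>x. g (f x)) has_derivative (\<lambda>v. frechet_derivative g (at (f x)) (frechet_derivative f (at x) v))) (at x)"
      using has_derivative_compose[OF D(3)[OF that] D(1)[OF assms(3)[OF that]]] by simp
    moreover have "linear (frechet_derivative g (at (f x)))"
      using D(1)[OF assms(3)[OF that]] has_derivative_linear by blast
    ultimately show ?thesis by (simp add: linear_Basis_expansion[symmetric])
  qed
  show ?case
  proof (rule Ck_on_SucI'[OF assms(1) d])
    show "Ck_on m (\<lambda>x. \<Sum>b\<in>Basis. (frechet_derivative f (at x) v \<bullet> b) *\<^sub>R frechet_derivative g (at (f x)) b) U" for v
      by (intro Ck_on_sum Ck_on_scaleR assms(1) Suc.IH D Ck_on_mono[OF Suc.prems(2)]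
           Ck_on_linear_comp[OF assms(1) bounded_linear_inner_left])
  qed
qed

lemma smooth_on_cong: "open U \<Longrightarrow> (\<And>x. x \<in> U \<Longrightarrow> f x = g x) \<Longrightarrow> smooth_on f U \<Longrightarrow> smooth_on g U"
  unfolding smooth_on_def using Ck_on_cong by blast

lemma smooth_on_subset: "smooth_on f U \<Longrightarrow> V \<subseteq> U \<Longrightarrow> smooth_on f V"
  unfolding smooth_on_def using Ck_on_subset by blast

lemma smooth_on_compose:
  "open U \<Longrightarrow> open V \<Longrightarrow> (\<And>x. x \<in> U \<Longrightarrow> f x \<in> V) \<Longrightarrow> smooth_on g V \<Longrightarrow> smooth_on f U
    \<Longrightarrow> smooth_on (\<lambda>x. g (f x)) U"
  unfolding smooth_on_def using Ck_on_compose by blast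

lemma smooth_on_bounded_linear: "open U \<Longrightarrow> bounded_linear l \<Longrightarrow> smooth_on l U"
  unfolding smooth_on_def using Ck_on_bounded_linear by blast

lemma smooth_on_linear:
  fixes l :: "'a::euclidean_space \<Rightarrow> 'b::euclidean_space"
  shows "open U \<Longrightarrow> linear l \<Longrightarrow> smooth_on l U"
  by (simp add: smooth_on_bounded_linear linear_conv_bounded_linear)

lemma smooth_on_affine: "open U \<Longrightarrow> smooth_on (\<lambda>t::real. a + t *\<^sub>R b) U"
  unfolding smooth_on_def
  by (intro allI Ck_on_add Ck_on_const Ck_on_bounded_linear bounded_linear_scaleR_left)

lemma smooth_on_has_derivative:
  "smooth_on f U \<Longrightarrow> x \<in> U \<Longrightarrow> (f has_derivative frechet_derivative f (at x)) (at x)"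
  unfolding smooth_on_def using Ck_on_SucD(1) by blast

lemma smooth_on_continuous: "smooth_on f U \<Longrightarrow> continuous_on U f"
  unfolding smooth_on_def using Ck_on.simps(1) by blast

lemma smooth_on_deriv: "smooth_on f U \<Longrightarrow> smooth_on (\<lambda>x. frechet_derivative f (at x) v) U"
  unfolding smooth_on_def using Ck_on_SucD(2) by blast

lemma smooth_on_linear_deriv: "smooth_on f U \<Longrightarrow> x \<in> U \<Longrightarrow> linear (frechet_derivative f (at x))"
  using has_derivative_linear smooth_on_has_derivative by blast

section \<open>Derivatives along lines and the symmetry of second derivatives\<close>

lemma has_derivative_along_line:
  assumes "(f has_derivative f') (at (y::'a::real_normed_vector))"
  shows "((\<lambda>t. f (y + t *\<^sub>R b)) has_vector_derivative f' b) (at (0::real))"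
proof -
  have a: "((\<lambda>t. y + t *\<^sub>R b) has_derivative (\<lambda>t. t *\<^sub>R b)) (at (0::real))"
    by (auto intro!: derivative_eq_intros)
  have "((\<lambda>t. f (y + t *\<^sub>R b)) has_derivative (\<lambda>t. f' (t *\<^sub>R b))) (at 0)"
    using has_derivative_compose[OF a, of f f'] assms by simp
  moreover have "f' (t *\<^sub>R b) = t *\<^sub>R f' b" for t
    using assms has_derivative_linear linear_scale by metis
  ultimately show ?thesis by (simp add: has_vector_derivative_def)
qed

text \<open>The increment in direction w is regarded as a function g of the displacement along v.
  The mean value theorem replaces its change by a difference of first derivatives in direction v,
  and differentiability of y -> f'(y)v at x evaluates that difference.\<close>

lemma second_difference_limit:
  fixes f :: "'a::real_normed_vector \<Rightarrow> real"
  assumes "r > 0" and f': "\<And>y. y \<in> ball x r \<Longrightarrow> (f has_derivative f' y) (at y)"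
    and D: "((\<lambda>y. f' y v) has_derivative D) (at x)"
  shows "((\<lambda>t. (f (x + t *\<^sub>R v + t *\<^sub>R w) - f (x + t *\<^sub>R v) - f (x + t *\<^sub>R w) + f x) / t\<^sup>2) \<longlongrightarrow> D w) (at_right 0)"
proof (rule tendstoI)
  fix e :: real assume "e > 0"
  define c where "c = norm v + norm w + 1"
  have "c > 0" unfolding c_def by (smt (verit) norm_ge_zero)
  \<comment> \<open>Two error terms, each at most e' * (t * c), add up to t * (e / 2); after
    division by t this stays strictly below e.\<close>
  define e' where "e' = e / (4 * c)"
  have "e' > 0" using \<open>e > 0\<close> \<open>c > 0\<close> by (simp add: e'_def)
  obtain d where "d > 0" and d: "\<And>y. norm (y - x) < d \<Longrightarrow> norm (f' y v - f' x v - D (y - x)) \<le> e' * norm (y - x)"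
    using D \<open>e' > 0\<close> unfolding has_derivative_at_alt by blast
  have lin: "linear D" using D has_derivative_linear by blast
  show "\<forall>\<^sub>F t in at_right 0. dist ((f (x + t *\<^sub>R v + t *\<^sub>R w) - f (x + t *\<^sub>R v) - f (x + t *\<^sub>R w) + f x) / t\<^sup>2) (D w) < e"
    unfolding eventually_at_right_field
  proof (intro exI[of _ "min d r / c"] conjI allI impI)
    show "0 < min d r / c" using \<open>d > 0\<close> \<open>r > 0\<close> \<open>c > 0\<close> by simp
    fix t :: real assume t: "0 < t" "t < min d r / c"
    then have tc: "t * c < d" "t * c < r" using \<open>c > 0\<close> by (simp_all add: field_simps)
    have nrm: "norm (s *\<^sub>R v + u *\<^sub>R w) \<le> t * c" if "0 \<le> s" "s \<le> t" "0 \<le> u" "u \<le> t" for s u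
    proof -
      have "norm (s *\<^sub>R v + u *\<^sub>R w) \<le> s * norm v + u * norm w"
        using norm_triangle_ineq[of "s *\<^sub>R v" "u *\<^sub>R w"] that by simp
      also have "\<dots> \<le> t * norm v + t * norm w"
        using that by (intro add_mono mult_right_mono) auto
      also have "\<dots> \<le> t * c" using t by (simp add: c_def algebra_simps)
      finally show ?thesis .
    qed
    have inb: "x + s *\<^sub>R v + u *\<^sub>R w \<in> ball x r" if "0 \<le> s" "s \<le> t" "0 \<le> u" "u \<le> t" for s u
    proof -
      have "dist x (x + s *\<^sub>R v + u *\<^sub>R w) = norm (s *\<^sub>R v + u *\<^sub>R w)"
        by (metis add.assoc add_diff_cancel_left' dist_commute dist_norm)
      then show ?thesis using nrm[OF that] tc by simp
    qed
    define g where "g s = f (x + s *\<^sub>R v + t *\<^sub>R w) - f (x + s *\<^sub>R v + 0 *\<^sub>R w)" for s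
    have g': "(g has_real_derivative f' (x + s *\<^sub>R v + t *\<^sub>R w) v - f' (x + s *\<^sub>R v + 0 *\<^sub>R w) v) (at s)"
      if "0 \<le> s" "s \<le> t" for s
    proof -
      have 1: "((\<lambda>s. f (x + s *\<^sub>R v + u *\<^sub>R w)) has_derivative (\<lambda>h. f' (x + s *\<^sub>R v + u *\<^sub>R w) (h *\<^sub>R v))) (at s)"
        if "0 \<le> u" "u \<le> t" for u
      proof -
        have a: "((\<lambda>s. x + s *\<^sub>R v + u *\<^sub>R w) has_derivative (\<lambda>h. h *\<^sub>R v)) (at s)"
          by (auto intro!: derivative_eq_intros)
        show ?thesis
          using has_derivative_compose[OF a, of f] f'[OF inb[OF \<open>0 \<le> s\<close> \<open>s \<le> t\<close> that]] by simp
      qed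
      have 2: "f' (x + s *\<^sub>R v + u *\<^sub>R w) (h *\<^sub>R v) = h * f' (x + s *\<^sub>R v + u *\<^sub>R w) v"
        if "0 \<le> u" "u \<le> t" for u h
        using f'[OF inb[OF \<open>0 \<le> s\<close> \<open>s \<le> t\<close> that]] has_derivative_linear linear_scale
        by (metis real_scaleR_def)
      show ?thesis unfolding g_def has_field_derivative_def
        by (rule has_derivative_eq_rhs[OF has_derivative_diff[OF 1[of t] 1[of 0]]])
           (use t 2[of t] 2[of 0] in \<open>auto simp: algebra_simps\<close>)
    qed
    obtain \<xi> where \<xi>: "0 < \<xi>" "\<xi> < t" "g t - g 0 = (t - 0) * (f' (x + \<xi> *\<^sub>R v + t *\<^sub>R w) v - f' (x + \<xi> *\<^sub>R v + 0 *\<^sub>R w) v)"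
      using MVT2[OF \<open>0 < t\<close> g'] by blast
    let ?a = "x + \<xi> *\<^sub>R v + t *\<^sub>R w" and ?b = "x + \<xi> *\<^sub>R v + 0 *\<^sub>R w"
    have na: "norm (?a - x) \<le> t * c" using nrm[of \<xi> t] \<xi> by (simp add: add.assoc)
    have nb: "norm (?b - x) \<le> t * c" using nrm[of \<xi> 0] \<xi> by simp
    have "norm (f' ?a v - f' x v - D (?a - x)) \<le> e' * (t * c)"
      using d[of ?a] na tc mult_left_mono[OF na, of e'] \<open>e' > 0\<close> by linarith
    moreover have "norm (f' ?b v - f' x v - D (?b - x)) \<le> e' * (t * c)"
      using d[of ?b] nb tc mult_left_mono[OF nb, of e'] \<open>e' > 0\<close> by linarith
    moreover have "D (?a - x) - D (?b - x) = t * D w"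
      using lin by (simp add: linear_add linear_scale)
    ultimately have "\<bar>f' ?a v - f' ?b v - t * D w\<bar> \<le> 2 * (e' * (t * c))"
      unfolding real_norm_def by linarith
    also have "2 * (e' * (t * c)) = t * (e / 2)" using \<open>c > 0\<close> by (simp add: e'_def)
    finally have "\<bar>(f' ?a v - f' ?b v) / t - D w\<bar> \<le> e / 2"
      using t by (simp add: field_simps abs_le_iff)
    moreover have "(f (x + t *\<^sub>R v + t *\<^sub>R w) - f (x + t *\<^sub>R v) - f (x + t *\<^sub>R w) + f x) / t\<^sup>2 = (f' ?a v - f' ?b v) / t"
    proof -
      have "f (x + t *\<^sub>R v + t *\<^sub>R w) - f (x + t *\<^sub>R v) - f (x + t *\<^sub>R w) + f x = g t - g 0"
        by (simp add: g_def)
      then show ?thesis using \<xi>(3) t by (simp add: power2_eq_square)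
    qed
    ultimately show "dist ((f (x + t *\<^sub>R v + t *\<^sub>R w) - f (x + t *\<^sub>R v) - f (x + t *\<^sub>R w) + f x) / t\<^sup>2) (D w) < e"
      using \<open>e > 0\<close> by (simp add: dist_real_def)
  qed
qed

text \<open>The second difference quotient is symmetric in v and w, so both mixed derivatives are
  its limit from the right.\<close>

lemma second_derivative_symmetric_real:
  fixes f :: "'a::real_normed_vector \<Rightarrow> real"
  assumes "open U" "x \<in> U" "\<And>y. y \<in> U \<Longrightarrow> (f has_derivative f' y) (at y)"
    and D: "((\<lambda>y. f' y v) has_derivative D) (at x)"
    and E: "((\<lambda>y. f' y w) has_derivative E) (at x)"
  shows "D w = E v"
proof -
  obtain r where r: "r > 0" "ball x r \<subseteq> U" using assms(1,2) openE by blast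
  have "((\<lambda>t. (f (x + t *\<^sub>R v + t *\<^sub>R w) - f (x + t *\<^sub>R v) - f (x + t *\<^sub>R w) + f x) / t\<^sup>2) \<longlongrightarrow> D w) (at_right 0)"
    by (rule second_difference_limit[of r x f f' v D w, OF r(1) _ D]) (use assms(3) r in auto)
  moreover have "((\<lambda>t. (f (x + t *\<^sub>R w + t *\<^sub>R v) - f (x + t *\<^sub>R w) - f (x + t *\<^sub>R v) + f x) / t\<^sup>2) \<longlongrightarrow> E v) (at_right 0)"
    by (rule second_difference_limit[of r x f f' w E v, OF r(1) _ E]) (use assms(3) r in auto)
  then have "((\<lambda>t. (f (x + t *\<^sub>R v + t *\<^sub>R w) - f (x + t *\<^sub>R v) - f (x + t *\<^sub>R w) + f x) / t\<^sup>2) \<longlongrightarrow> E v) (at_right 0)"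
    by (simp add: algebra_simps)
  ultimately show ?thesis by (rule tendsto_unique[OF trivial_limit_at_right_real])
qed

lemma second_derivative_symmetric:
  fixes f :: "'a::real_normed_vector \<Rightarrow> 'b::euclidean_space"
  assumes "open U" "x \<in> U" "\<And>y. y \<in> U \<Longrightarrow> (f has_derivative f' y) (at y)"
    and D: "((\<lambda>y. f' y v) has_derivative D) (at x)"
    and E: "((\<lambda>y. f' y w) has_derivative E) (at x)"
  shows "D w = E v"
proof (rule euclidean_eqI)
  fix b :: 'b
  show "D w \<bullet> b = E v \<bullet> b"
    by (rule second_derivative_symmetric_real[OF assms(1,2), of "\<lambda>y. f y \<bullet> b" "\<lambda>y h. f' y h \<bullet> b" v "\<lambda>h. D h \<bullet> b" w "\<lambda>h. E h \<bullet> b"])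
       (auto intro!: has_derivative_inner_left assms)
qed

section \<open>Determinants: Jacobi's formula and positivity\<close>

lemma det_replace_row:
  fixes A :: "real^'k^'k"
  shows "det (\<chi> a. if a = i then r else row a A) =
    (\<Sum>p | p permutes UNIV. of_int (sign p) * (r $ p i * (\<Prod>a\<in>UNIV - {i}. A $ a $ p a)))"
proof -
  have "(\<Prod>a\<in>UNIV. (\<chi> a. if a = i then r else row a A) $ a $ p a) =
     r $ p i * (\<Prod>a\<in>UNIV - {i}. A $ a $ p a)" for p
    by (subst prod.remove[of _ i]) (auto simp: row_def intro!: prod.cong)
  then show ?thesis unfolding det_def by simp
qed

text \<open>Jacobi's formula, with the inverse supplied as B. By the product rule the derivative is
  a sum of determinants in which one row is replaced by its derivative. That row is a combination of
  the rows of A x with coefficients read off from D and B, and only the coefficient of the replaced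
  row survives.\<close>

lemma has_derivative_det:
  fixes A :: "'a::real_normed_vector \<Rightarrow> real^'k^'k"
  assumes D: "\<And>i j. ((\<lambda>x. A x $ i $ j) has_derivative D i j) (at x)"
    and B: "B ** A x = mat 1"
  shows "((\<lambda>x. det (A x)) has_derivative (\<lambda>h. det (A x) * (\<Sum>i\<in>UNIV. \<Sum>j\<in>UNIV. D i j h * B $ j $ i))) (at x)"
proof -
  have "((\<lambda>x. det (A x)) has_derivative
     (\<lambda>h. \<Sum>p | p permutes UNIV. of_int (sign p) * (\<Sum>i\<in>UNIV. D i (p i) h * (\<Prod>a\<in>UNIV - {i}. A x $ a $ p a)))) (at x)"
    unfolding det_def by (intro has_derivative_sum has_derivative_mult_right has_derivative_prod D)
  moreover have "(\<Sum>p | p permutes (UNIV :: 'k set). of_int (sign p) * (\<Sum>i\<in>UNIV. D i (p i) h * (\<Prod>a\<in>UNIV - {i}. A x $ a $ p a)))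
    = det (A x) * (\<Sum>i\<in>UNIV. \<Sum>j\<in>UNIV. D i j h * B $ j $ i)" for h
  proof -
    have row: "(\<chi> b. D i b h) = (\<Sum>l\<in>UNIV. (\<chi> l. \<Sum>j\<in>UNIV. D i j h * B $ j $ l) $ l *s row l (A x))" for i
    proof (rule vec_eq_iff[THEN iffD2], rule allI)
      fix b
      have "(\<Sum>l\<in>UNIV. (\<Sum>j\<in>UNIV. D i j h * B $ j $ l) * A x $ l $ b) =
         (\<Sum>j\<in>UNIV. D i j h * (\<Sum>l\<in>UNIV. B $ j $ l * A x $ l $ b))"
        unfolding sum_distrib_left sum_distrib_right mult.assoc by (rule sum.swap)
      also have "\<dots> = (\<Sum>j\<in>UNIV. D i j h * (B ** A x) $ j $ b)"
        by (simp add: matrix_matrix_mult_def)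
      also have "\<dots> = D i b h" unfolding B mat_def by (simp add: if_distrib[of "\<lambda>u. _ * u"] cong: if_cong)
      finally show "(\<chi> b. D i b h) $ b = (\<Sum>l\<in>UNIV. (\<chi> l. \<Sum>j\<in>UNIV. D i j h * B $ j $ l) $ l *s row l (A x)) $ b"
        by (simp add: row_def)
    qed
    have "(\<Sum>p | p permutes (UNIV :: 'k set). of_int (sign p) * (\<Sum>i\<in>UNIV. D i (p i) h * (\<Prod>a\<in>UNIV - {i}. A x $ a $ p a)))
      = (\<Sum>i\<in>UNIV. \<Sum>p | p permutes (UNIV :: 'k set). of_int (sign p) * ((\<chi> b. D i b h) $ p i * (\<Prod>a\<in>UNIV - {i}. A x $ a $ p a)))"
      unfolding sum_distrib_left by (subst sum.swap) simp
    also have "\<dots> = (\<Sum>i\<in>UNIV. det (\<chi> a. if a = i then (\<chi> b. D i b h) else row a (A x)))"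
      by (simp only: det_replace_row)
    also have "\<dots> = (\<Sum>i\<in>UNIV. (\<Sum>j\<in>UNIV. D i j h * B $ j $ i) * det (A x))"
      by (subst row, subst cramer_lemma_transpose) simp
    finally show ?thesis by (simp add: sum_distrib_left sum_distrib_right mult.commute)
  qed
  ultimately show ?thesis by simp
qed

lemma det_posdef_nonzero:
  fixes A :: "real^'k^'k"
  assumes "\<And>x. x \<noteq> 0 \<Longrightarrow> 0 < x \<bullet> (A *v x)"
  shows "det A \<noteq> 0"
proof -
  have "inj ((*v) A)"
  proof (rule injI)
    fix x y assume "A *v x = A *v y"
    then have "(x - y) \<bullet> (A *v (x - y)) = 0" by (simp add: matrix_vector_mult_diff_distrib)
    then show "x = y" using assms[of "x - y"] by force
  qed
  then show ?thesis using det_nz_iff_inj[of "(*v) A"] by (simp add: matrix_of_matrix_vector_mul)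
qed

text \<open>A positive definite matrix is joined to the identity by a segment of positive definite
  matrices, on which the determinant does not vanish.\<close>

lemma det_posdef_pos:
  fixes A :: "real^'k^'k"
  assumes "\<And>x. x \<noteq> 0 \<Longrightarrow> 0 < x \<bullet> (A *v x)"
  shows "0 < det A"
proof (rule ccontr)
  assume "\<not> 0 < det A"
  define B where "B s = (1 - s) *\<^sub>R mat 1 + s *\<^sub>R A" for s :: real
  have "continuous_on {0..1} (\<lambda>s. det (B s))"
    unfolding det_def B_def by (intro continuous_intros)
  moreover have "det (B 0) = 1" "det (B 1) = det A" by (simp_all add: B_def)
  ultimately obtain s where s: "0 \<le> s" "s \<le> 1" "det (B s) = 0"
    using IVT2'[of "\<lambda>s. det (B s)" 1 0 0] \<open>\<not> 0 < det A\<close> by auto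
  have "0 < x \<bullet> (B s *v x)" if "x \<noteq> 0" for x
  proof -
    have "x \<bullet> (B s *v x) = (1 - s) * (x \<bullet> x) + s * (x \<bullet> (A *v x))"
      unfolding B_def matrix_vector_mult_add_rdistrib scaleR_matrix_vector_assoc[symmetric] matrix_vector_mul_lid
      by (simp only: inner_add_right inner_scaleR_right)
    moreover have "0 \<le> (1 - s) * (x \<bullet> x)" "0 \<le> s * (x \<bullet> (A *v x))" "0 < (1 - s) * (x \<bullet> x) \<or> 0 < s * (x \<bullet> (A *v x))"
      using s assms[OF that] that by (auto simp: zero_less_mult_iff)
    ultimately show ?thesis by linarith
  qed
  then show False using det_posdef_nonzero[of "B s"] s by blast
qed

section \<open>Integrals of derivatives of compactly supported functions\<close>

lemma lborel_integral_translate: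
  fixes f :: "'a::euclidean_space \<Rightarrow> real"
  assumes "f \<in> borel_measurable borel"
  shows "(\<integral>x. f (x + c) \<partial>lborel) = (\<integral>x. f x \<partial>lborel)"
proof -
  have "(\<integral>x. f x \<partial>lborel) = (\<integral>x. f x \<partial>(distr lborel borel ((+) c)))"
    by (simp add: lborel_distr_plus)
  also have "\<dots> = (\<integral>x. f (c + x) \<partial>lborel)"
    using assms by (intro integral_distr) auto
  finally show ?thesis by (simp add: add.commute)
qed

text \<open>Difference quotients of the integrand integrate to 0 by translation invariance.\<close>

lemma integral_derivative_zero:
  fixes f :: "'a::euclidean_space \<Rightarrow> real"
  assumes f': "\<And>x. (f has_derivative f' x) (at x)"
    and cont: "continuous_on UNIV (\<lambda>x. f' x v)"
    and K: "bounded K" "\<And>x. x \<notin> K \<Longrightarrow> f x = 0"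
  shows "(\<integral>x. f' x v \<partial>lborel) = 0"
proof -
  obtain r where r: "r > 0" "\<And>x. x \<in> K \<Longrightarrow> norm x < r"
    using K(1) bounded_pos_less by blast
  have f0: "f' x v = 0" if "r < norm x" for x
  proof -
    have "open {y::'a. r < norm y}" by (intro open_Collect_less continuous_intros)
    then have "(f has_derivative (\<lambda>_. 0)) (at x)"
    proof (rule has_derivative_transform_within_open[OF has_derivative_const[of 0]])
      show "0 = f y" if "y \<in> {y. r < norm y}" for y using K(2)[of y] r(2)[of y] that by fastforce
    qed (use that in simp)
    then have "(\<lambda>_. 0) = f' x" using f' by (rule has_derivative_unique)
    then show ?thesis by (metis)
  qed
  have "compact ((\<lambda>x. f' x v) ` cball 0 r)"
    by (intro compact_continuous_image continuous_on_subset[OF cont]) auto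
  then obtain C where C: "\<And>x. x \<in> cball 0 r \<Longrightarrow> \<bar>f' x v\<bar> \<le> C"
    using compact_imp_bounded bounded_iff by (metis image_eqI real_norm_def)
  have "0 \<le> C" using C[of 0] r by force
  have bound: "\<bar>f' x v\<bar> \<le> C" for x using C[of x] f0[of x] \<open>0 \<le> C\<close> by (cases "norm x \<le> r") auto
  have diff: "\<bar>f (x + s *\<^sub>R v) - f x\<bar> \<le> C * s" if "0 \<le> s" for x s
  proof (cases "s = 0")
    case False
    have *: "((\<lambda>u. f (x + u *\<^sub>R v)) has_real_derivative f' (x + u *\<^sub>R v) v) (at u)" for u
    proof -
      have a: "((\<lambda>u. x + u *\<^sub>R v) has_derivative (\<lambda>h. h *\<^sub>R v)) (at u)"
        by (auto intro!: derivative_eq_intros)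
      have l: "linear (f' (x + u *\<^sub>R v))" using f' has_derivative_linear by blast
      show ?thesis unfolding has_field_derivative_def
        by (rule has_derivative_eq_rhs[OF has_derivative_compose[OF a f']])
           (auto simp: linear_scale[OF l])
    qed
    have "0 < s" using False that by simp
    then obtain z where "f (x + s *\<^sub>R v) - f (x + 0 *\<^sub>R v) = (s - 0) * f' (x + z *\<^sub>R v) v"
      using MVT2[of 0 s "\<lambda>u. f (x + u *\<^sub>R v)", OF _ *] by blast
    then show ?thesis using mult_left_mono[OF bound[of "x + z *\<^sub>R v"] that] that
      by (simp add: abs_mult mult.commute)
  qed auto
  define D where "D n x = (f (x + (1 / Suc n) *\<^sub>R v) - f x) * Suc n" for n x
  have fcont: "continuous_on UNIV f"
    using f' by (auto intro!: continuous_at_imp_continuous_on has_derivative_continuous)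
  then have fm: "f \<in> borel_measurable borel" by (rule borel_measurable_continuous_onI)
  have Dm: "D n \<in> borel_measurable lborel" for n
    unfolding D_def using fcont
    by (auto intro!: borel_measurable_continuous_onI continuous_intros continuous_on_compose2[OF fcont])
  have fint: "integrable lborel f"
  proof -
    have "compact (f ` cball 0 r)"
      by (intro compact_continuous_image continuous_on_subset[OF fcont]) auto
    then obtain B where B: "\<And>x. x \<in> cball 0 r \<Longrightarrow> \<bar>f x\<bar> \<le> B"
      using compact_imp_bounded bounded_iff by (metis image_eqI real_norm_def)
    have "integrable lborel (\<lambda>x::'a. B * indicator (cball 0 r) x)"
      using emeasure_bounded_finite[OF bounded_cball[of "0::'a"]]
    by (intro integrable_mult_right integrable_real_indicator) (auto simp: infinity_ennreal_def)
    then show ?thesis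
    proof (rule Bochner_Integration.integrable_bound)
      show "AE x in lborel. norm (f x) \<le> norm (B * indicator (cball 0 r) x)"
      proof (rule AE_I2)
        fix x show "norm (f x) \<le> norm (B * indicator (cball 0 r) x)"
        proof (cases "x \<in> cball 0 r")
          case False then show ?thesis using r K(2)[of x] by force
        qed (use B[of x] in auto)
      qed
    qed (use fm in simp)
  qed
  have D0: "(\<integral>x. D n x \<partial>lborel) = 0" for n
  proof -
    have int: "integrable lborel (\<lambda>x. f (x + c))" for c
    proof -
      have "integrable (distr lborel borel ((+) c)) f" using fint by (simp add: lborel_distr_plus)
      then have "integrable lborel (\<lambda>x. f (c + x))"
        using integrable_distr_eq[of "(+) c" lborel borel f] fm by simp
      then show ?thesis by (simp add: add.commute)
    qed
    show ?thesis
      unfolding D_def using int fint lborel_integral_translate[OF fm] by simp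
  qed
  \<comment> \<open>The step 1/(n+1) is at most 1, so the difference quotients vanish outside the
    ball of radius r + |v|; inside they are bounded by C through the mean value theorem.\<close>
  define w where "w x = C * indicator (cball 0 (r + norm v)) x" for x :: 'a
  have wint: "integrable lborel w"
    unfolding w_def
    using emeasure_bounded_finite[OF bounded_cball[of "0::'a"]]
    by (intro integrable_mult_right integrable_real_indicator) (auto simp: infinity_ennreal_def)
  have "(\<lambda>n. \<integral>x. D n x \<partial>lborel) \<longlonglongrightarrow> (\<integral>x. f' x v \<partial>lborel)"
  proof (rule integral_dominated_convergence[where w=w])
    show "(\<lambda>x. f' x v) \<in> borel_measurable lborel"
      using borel_measurable_continuous_onI[OF cont] by simp
    show "AE x in lborel. (\<lambda>n. D n x) \<longlonglongrightarrow> f' x v"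
    proof (rule AE_I2)
      fix x
      have "((\<lambda>t. x + t *\<^sub>R v) has_derivative (\<lambda>h. h *\<^sub>R v)) (at 0)"
        by (auto intro!: derivative_eq_intros)
      from has_derivative_compose[OF this, of f "f' x"] f'[of x]
      have "((\<lambda>t. f (x + t *\<^sub>R v)) has_derivative (\<lambda>h. f' x (h *\<^sub>R v))) (at 0)" by simp
      moreover have l: "linear (f' x)" using f' has_derivative_linear by blast
      ultimately have "((\<lambda>t. f (x + t *\<^sub>R v)) has_real_derivative f' x v) (at 0)"
        by (simp add: has_field_derivative_def linear_scale[OF l] mult_commute_abs)
      then have lim: "((\<lambda>h. (f (x + h *\<^sub>R v) - f x) / h) \<longlongrightarrow> f' x v) (at 0)"
        by (simp add: has_field_derivative_def has_derivative_at DERIV_def flip: has_field_derivative_def)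
      have "filterlim (\<lambda>n. 1 / real (Suc n)) (at 0) sequentially"
        using LIMSEQ_inverse_real_of_nat by (auto simp: filterlim_at inverse_eq_divide)
      from filterlim_compose[OF lim this]
      show "(\<lambda>n. D n x) \<longlonglongrightarrow> f' x v" by (simp add: D_def)
    qed
    show "AE x in lborel. norm (D n x) \<le> w x" for n
    proof (rule AE_I2)
      fix x
      show "norm (D n x) \<le> w x"
      proof (cases "x \<in> cball 0 (r + norm v)")
        case True
        have "norm (D n x) = \<bar>f (x + (1 / Suc n) *\<^sub>R v) - f x\<bar> * Suc n" by (simp add: D_def abs_mult)
        also have "\<dots> \<le> C * (1 / Suc n) * Suc n" by (intro mult_right_mono diff) auto
        finally show ?thesis using True by (simp add: w_def)
      next
        case False
        then have n: "r + norm v < norm x" by simp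
        then have "x \<notin> K" using r(2)[of x] by (smt (verit) norm_ge_zero)
        moreover have "norm ((1 / Suc n) *\<^sub>R v) \<le> norm v"
          by (simp add: divide_le_eq mult_left_le_one_le field_simps)
        then have "r < norm (x + (1 / Suc n) *\<^sub>R v)"
          using n norm_triangle_ineq2[of x "- ((1 / Suc n) *\<^sub>R v)"] by simp
        then have "x + (1 / Suc n) *\<^sub>R v \<notin> K" using r(2) by force
        ultimately show ?thesis using False K(2) by (simp add: D_def w_def)
      qed
    qed
  qed (use Dm wint in auto)
  then show ?thesis using D0 by (simp add: LIMSEQ_const_iff)
qed

section \<open>Change of variables over an arbitrary finite index type\<close>

text \<open>The library's change of variables theorem needs a well-ordered index type; it is transported
  along a bijection from the following copy of an initial segment of the natural numbers.\<close>

typedef ('k::finite) idx = "{..<CARD('k)}"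
  by (rule exI[of _ 0]) simp

instantiation idx :: (finite) linorder
begin

definition less_eq_idx :: "'a idx \<Rightarrow> 'a idx \<Rightarrow> bool" where
  "less_eq_idx x y \<longleftrightarrow> Rep_idx x \<le> Rep_idx y"

definition less_idx :: "'a idx \<Rightarrow> 'a idx \<Rightarrow> bool" where
  "less_idx x y \<longleftrightarrow> Rep_idx x < Rep_idx y"

instance
  by standard (auto simp: less_eq_idx_def less_idx_def Rep_idx_inject)

end

lemma card_idx: "CARD('k idx) = CARD('k::finite)" and finite_idx: "finite (UNIV :: 'k idx set)"
proof -
  have "bij_betw Rep_idx (UNIV :: 'k idx set) {..<CARD('k)}"
    by (metis Rep_idx_inject bij_betw_def injI type_definition.Rep_range type_definition_idx)
  then show "CARD('k idx) = CARD('k)" "finite (UNIV :: 'k idx set)"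
    using bij_betw_same_card bij_betw_finite by fastforce+
qed

instance idx :: (finite) finite
  by standard (rule finite_idx)

instance idx :: (finite) wellorder
proof
  fix P :: "'a idx \<Rightarrow> bool" and a
  assume *: "\<And>x. (\<And>y. y < x \<Longrightarrow> P y) \<Longrightarrow> P x"
  show "P a"
    by (induction "Rep_idx a" arbitrary: a rule: less_induct) (metis * less_idx_def)
qed

section \<open>Determinants and Lebesgue measure under a relabelling of coordinates\<close>

lemma swapidseq_conj:
  assumes "swapidseq n q" "bij (b :: 'a \<Rightarrow> 'b)"
  shows "swapidseq n (b \<circ> q \<circ> inv b)"
  using assms(1)
proof (induction rule: swapidseq.induct)
  case id
  have "b \<circ> id \<circ> inv b = id" using assms(2) by (simp add: fun_eq_iff bij_is_surj surj_f_inv_f)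
  then show ?case by (metis swapidseq.id)
next
  case (comp_Suc n p a c)
  have "b \<circ> (Transposition.transpose a c \<circ> p) \<circ> inv b = Transposition.transpose (b a) (b c) \<circ> (b \<circ> p \<circ> inv b)"
    using assms(2) by (auto simp: fun_eq_iff Transposition.transpose_def dest: bij_is_inj injD)
  moreover have "b a \<noteq> b c" using comp_Suc assms(2) by (metis bij_is_inj injD)
  ultimately show ?case using swapidseq.comp_Suc[OF comp_Suc.IH] by metis
qed

lemma sign_conj:
  assumes "permutation q" "bij b"
  shows "sign (b \<circ> q \<circ> inv b) = sign q"
proof -
  obtain n where "swapidseq n q" using assms(1) permutation_def by blast
  then have "evenperm (b \<circ> q \<circ> inv b) = evenperm q"
    using evenperm_unique swapidseq_conj[OF _ assms(2)] by metis
  then show ?thesis by (simp add: sign_def)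
qed

text \<open>Conjugation by b is a bijection between the permutations of the two index types. It
  turns transpositions into transpositions, hence preserves signs, and the two Leibniz sums agree
  term by term.\<close>

lemma det_reindex:
  fixes A :: "real^'l::finite^'l" and b :: "'k::finite \<Rightarrow> 'l"
  assumes b: "bij b"
  shows "det (\<chi> i j. A $ b i $ b j) = det A"
proof -
  have inv1: "b (inv b x) = x" "inv b (b y) = y" for x y
    using b by (simp_all add: bij_is_inj bij_is_surj surj_f_inv_f)
  have bi: "bij (inv b)" using b by (rule bij_imp_bij_inv)
  have "(\<Sum>q | q permutes (UNIV :: 'k set). of_int (sign q) * (\<Prod>i\<in>UNIV. A $ b i $ b (q i))) =
    (\<Sum>p | p permutes (UNIV :: 'l set). of_int (sign p) * (\<Prod>i\<in>UNIV. A $ i $ p i))"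
  proof (rule sum.reindex_bij_witness[where i="\<lambda>p. inv b \<circ> p \<circ> b" and j="\<lambda>q. b \<circ> q \<circ> inv b"])
    fix q assume q: "q \<in> {q. q permutes (UNIV :: 'k set)}"
    show "inv b \<circ> (b \<circ> q \<circ> inv b) \<circ> b = q" by (simp add: fun_eq_iff inv1)
    have "bij q" using q permutes_bij by auto
    then have "bij (b \<circ> q \<circ> inv b)" using b bi by (intro bij_comp)
    then show "b \<circ> q \<circ> inv b \<in> {p. p permutes UNIV}" by (auto intro!: bij_imp_permutes)
    have "permutation q" using q unfolding permutation_permutes by (intro exI[of _ UNIV]) auto
    then have s: "sign (b \<circ> q \<circ> inv b) = sign q" by (rule sign_conj[OF _ b])
    have "(\<Prod>i\<in>UNIV. A $ i $ (b \<circ> q \<circ> inv b) i) = (\<Prod>i\<in>UNIV. A $ b i $ b (q i))"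
      by (rule prod.reindex_bij_witness[where i=b and j="inv b"]) (auto simp: inv1)
    then show "of_int (sign (b \<circ> q \<circ> inv b)) * (\<Prod>i\<in>UNIV. A $ i $ (b \<circ> q \<circ> inv b) i) = of_int (sign q) * (\<Prod>i\<in>UNIV. A $ b i $ b (q i))"
      using s by simp
  next
    fix p assume p: "p \<in> {q. q permutes (UNIV :: 'l set)}"
    show "b \<circ> (inv b \<circ> p \<circ> b) \<circ> inv b = p" by (simp add: fun_eq_iff inv1)
    have "bij p" using p permutes_bij by auto
    then have "bij (inv b \<circ> p \<circ> b)" using b bi by (intro bij_comp)
    then show "inv b \<circ> p \<circ> b \<in> {p. p permutes UNIV}" by (auto intro!: bij_imp_permutes)
  qed
  then show ?thesis by (simp add: det_def)
qed

definition reindex :: "('k::finite \<Rightarrow> 'l::finite) \<Rightarrow> real^'l \<Rightarrow> real^'k" where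
  "reindex b y = (\<chi> i. y $ b i)"

lemma linear_reindex: "linear (reindex b)"
  by (rule linearI) (auto simp: reindex_def vec_eq_iff)

lemma reindex_inverse: "bij b \<Longrightarrow> reindex b (reindex (inv b) x) = x"
  "bij b \<Longrightarrow> reindex (inv b) (reindex b y) = y"
  by (auto simp: reindex_def vec_eq_iff bij_is_inj bij_is_surj surj_f_inv_f)

lemma reindex_measurable [measurable]: "reindex b \<in> borel_measurable borel"
  by (intro borel_measurable_continuous_onI linear_continuous_on)
     (simp add: linear_reindex linear_conv_bounded_linear[symmetric])

text \<open>Lebesgue measure is determined by its values on boxes, and relabelling coordinates turns
  a box into one with the same side lengths in another order.\<close>

lemma lborel_distr_reindex:
  fixes b :: "'k::finite \<Rightarrow> 'l::finite"
  assumes b: "bij b"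
  shows "distr lborel borel (reindex b) = lborel"
proof (rule lborel_eqI[symmetric])
  have bi: "b (inv b x) = x" "inv b (b y) = y" for x y
    using b by (simp_all add: bij_is_inj bij_is_surj surj_f_inv_f)
  fix l u :: "real^'k" assume lu: "\<And>i. i \<in> Basis \<Longrightarrow> l \<bullet> i \<le> u \<bullet> i"
  have prodB: "(\<Prod>e\<in>Basis. (v::real^'m::finite) \<bullet> e) = (\<Prod>i\<in>UNIV. v $ i)" for v
  proof -
    have B: "Basis = (\<lambda>i. axis i 1 :: real^'m) ` UNIV" by (auto simp: Basis_vec_def)
    have "inj (\<lambda>i. axis i 1 :: real^'m)" by (auto simp: inj_def axis_eq_axis)
    then show ?thesis unfolding B by (subst prod.reindex) (simp_all add: inner_axis o_def)
  qed
  have le: "l $ i \<le> u $ i" for i using lu[of "axis i 1"] by (simp add: inner_axis)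
  have "emeasure (distr lborel borel (reindex b)) (box l u) = emeasure lborel (reindex b -` box l u)"
    by (subst emeasure_distr) auto
  also have "reindex b -` box l u = box (reindex (inv b) l) (reindex (inv b) u)"
  proof -
    have "(\<forall>i. l $ i < x $ b i \<and> x $ b i < u $ i) = (\<forall>i. l $ inv b i < x $ i \<and> x $ i < u $ inv b i)" for x :: "real^'l"
      by (metis bi)
    then show ?thesis by (auto simp: mem_box_cart reindex_def)
  qed
  also have "emeasure lborel \<dots> = (\<Prod>e\<in>Basis. (reindex (inv b) u - reindex (inv b) l) \<bullet> e)"
  proof (rule emeasure_lborel_box)
    fix e :: "real^'l" assume "e \<in> Basis"
    then obtain i where "e = axis i 1" by (auto simp: Basis_vec_def)
    then show "reindex (inv b) l \<bullet> e \<le> reindex (inv b) u \<bullet> e" using le by (simp add: reindex_def inner_axis)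
  qed
  also have "(\<Prod>e\<in>Basis. (reindex (inv b) u - reindex (inv b) l) \<bullet> e) = (\<Prod>i\<in>UNIV. (u - l) $ inv b i)"
    by (subst prodB) (simp add: reindex_def)
  also have "\<dots> = (\<Prod>i\<in>UNIV. (u - l) $ i)"
    by (rule prod.reindex_bij_witness[where i=b and j="inv b"]) (auto simp: bi)
  also have "\<dots> = (\<Prod>e\<in>Basis. (u - l) \<bullet> e)" by (rule prodB[symmetric])
  finally show "emeasure (distr lborel borel (reindex b)) (box l u) = (\<Prod>e\<in>Basis. (u - l) \<bullet> e)" .
qed simp

lemma nn_integral_reindex:
  assumes "bij b" "f \<in> borel_measurable borel"
  shows "(\<integral>\<^sup>+ x. f (reindex b x) \<partial>lborel) = (\<integral>\<^sup>+ x. f x \<partial>lborel)"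
proof -
  have "(\<integral>\<^sup>+ x. f x \<partial>lborel) = (\<integral>\<^sup>+ x. f x \<partial>(distr lborel borel (reindex b)))"
    by (simp only: lborel_distr_reindex[OF assms(1)])
  also have "\<dots> = (\<integral>\<^sup>+ x. f (reindex b x) \<partial>lborel)"
    using assms(2) by (intro nn_integral_distr) auto
  finally show ?thesis by simp
qed

section \<open>Change of variables for nonnegative integrals\<close>

lemma nn_integral_real_cases:
  fixes h :: "'a::euclidean_space \<Rightarrow> real"
  assumes m: "(\<lambda>x. indicator S x * h x) \<in> borel_measurable borel" and nn: "\<And>x. x \<in> S \<Longrightarrow> 0 \<le> h x"
  shows "(\<integral>\<^sup>+ x. ennreal (indicator S x * h x) \<partial>lborel) =
     (if h absolutely_integrable_on S then ennreal (integral S h) else \<infinity>)"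
proof (cases "h absolutely_integrable_on S")
  case True
  then have *: "integrable lebesgue (\<lambda>x. indicator S x * h x)"
    by (simp add: set_integrable_def)
  have "(\<integral>\<^sup>+ x. ennreal (indicator S x * h x) \<partial>lebesgue) = ennreal (LINT x|lebesgue. indicator S x * h x)"
    by (rule nn_integral_eq_integral[OF *]) (use nn in \<open>auto simp: indicator_def\<close>)
  moreover have "(LINT x|lebesgue. indicator S x * h x) = integral S h"
    using set_lebesgue_integral_eq_integral(2)[OF True] by (simp add: set_lebesgue_integral_def)
  ultimately show ?thesis using True by (simp add: nn_integral_completion)
next
  \<comment> \<open>A finite integral of this nonnegative measurable function would make it
    integrable over \<open>lborel\<close>, hence over the completion \<open>lebesgue\<close>,
    contrary to the case.\<close>
  case False
  have "(\<integral>\<^sup>+ x. ennreal (indicator S x * h x) \<partial>lborel) = \<infinity>"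
  proof (rule ccontr)
    assume "(\<integral>\<^sup>+ x. ennreal (indicator S x * h x) \<partial>lborel) \<noteq> \<infinity>"
    then have "integrable lborel (\<lambda>x. indicator S x * h x)"
      using m nn by (intro integrableI_nonneg) (auto simp: indicator_def top.not_eq_extremum)
    then have "integrable lebesgue (\<lambda>x. indicator S x * h x)"
      using m by (subst integrable_completion) auto
    then show False using False by (simp add: set_integrable_def)
  qed
  then show ?thesis using False by simp
qed

lemma nn_integral_change_of_variables_wellorder:
  fixes g :: "real^'m::{finite,wellorder} \<Rightarrow> real^'m::_" and f :: "real^'m::_ \<Rightarrow> real"
  assumes S: "S \<in> sets borel" "\<And>x. x \<in> S \<Longrightarrow> (g has_derivative g' x) (at x within S)" "inj_on g S"
    and f: "(\<lambda>y. indicator (g ` S) y * f y) \<in> borel_measurable borel" "\<And>y. 0 \<le> f y"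
    and m: "(\<lambda>x. indicator S x * (\<bar>det (matrix (g' x))\<bar> * f (g x))) \<in> borel_measurable borel"
  shows "(\<integral>\<^sup>+ x. ennreal (indicator S x * (\<bar>det (matrix (g' x))\<bar> * f (g x))) \<partial>lborel) =
         (\<integral>\<^sup>+ y. ennreal (indicator (g ` S) y * f y) \<partial>lborel)"
proof -
  let ?h = "\<lambda>x. \<bar>det (matrix (g' x))\<bar> * f (g x)"
  have "S \<in> sets lebesgue" using S(1) by simp
  \<comment> \<open>The theorem quoted is about vector-valued integrands, so f is taken as a map
    into \<open>real^1\<close>.\<close>
  note cv = has_absolute_integral_change_of_variables[OF this S(2,3), of "\<lambda>y. vec (f y) :: real^1"]
  have *: "(?h absolutely_integrable_on S \<and> integral S ?h = b) = (f absolutely_integrable_on (g ` S) \<and> integral (g ` S) f = b)" for b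
    using cv[of "vec b"] unfolding absolutely_integrable_on_1_iff integral_on_1_eq by simp
  \<comment> \<open>The equivalence holds for every value b. Taking b to be one integral and then
    the other yields both the equivalence of integrability and the equality of the
    integrals.\<close>
  then have "?h absolutely_integrable_on S \<longleftrightarrow> f absolutely_integrable_on (g ` S)"
    "?h absolutely_integrable_on S \<Longrightarrow> integral S ?h = integral (g ` S) f"
    using *[of "integral S ?h"] *[of "integral (g ` S) f"] by auto
  then show ?thesis
    by (subst (1 2) nn_integral_real_cases) (use f m in auto)
qed

text \<open>The map g is conjugated by the relabelling between 'k and \<open>'k idx\<close>.
  Relabelling preserves Lebesgue measure, and by \<open>det_reindex\<close> the Jacobian determinant
  of the conjugate is unchanged, so the well-ordered case applies.\<close>

lemma nn_integral_change_of_variables: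
  fixes g :: "real^'k::finite \<Rightarrow> real^'k" and f :: "real^'k \<Rightarrow> real"
  assumes S: "S \<in> sets borel" and der: "\<And>x. x \<in> S \<Longrightarrow> (g has_derivative g' x) (at x within S)" and inj: "inj_on g S"
    and f: "(\<lambda>y. indicator (g ` S) y * f y) \<in> borel_measurable borel" "\<And>y. 0 \<le> f y"
    and m: "(\<lambda>x. indicator S x * (\<bar>det (matrix (g' x))\<bar> * f (g x))) \<in> borel_measurable borel"
  shows "(\<integral>\<^sup>+ x. ennreal (indicator S x * (\<bar>det (matrix (g' x))\<bar> * f (g x))) \<partial>lborel) =
         (\<integral>\<^sup>+ y. ennreal (indicator (g ` S) y * f y) \<partial>lborel)"
proof -
  have "CARD('k) = CARD('k idx)" by (simp add: card_idx)
  then obtain b :: "'k \<Rightarrow> 'k idx" where b: "bij b"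
    using finite_same_card_bij[of "UNIV :: 'k set" "UNIV :: 'k idx set"] by auto
  have bi: "bij (inv b)" using b by (rule bij_imp_bij_inv)
  have bb: "b (inv b x) = x" "inv b (b y) = y" for x y
    using b by (simp_all add: bij_is_inj bij_is_surj surj_f_inv_f)
  let ?P = "reindex b" and ?R = "reindex (inv b)"
  have PR: "?P (?R x) = x" "?R (?P y) = y" for x y using reindex_inverse[OF b] by auto
  define T where "T = ?P -` S"
  define h where "h = (\<lambda>y. ?R (g (?P y)))"
  define h' where "h' = (\<lambda>y v. ?R (g' (?P y) (?P v)))"
  have bl: "bounded_linear ?P" "bounded_linear ?R"
    using linear_reindex linear_conv_bounded_linear by blast+
  have hT: "h ` T = ?P -` (g ` S)"
  proof (intro set_eqI iffI)
    fix x assume "x \<in> ?P -` (g ` S)"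
    then obtain s where s: "s \<in> S" "?P x = g s" by auto
    then have "x = h (?R s)" "?R s \<in> T" by (simp_all add: h_def T_def PR flip: s(2))
    then show "x \<in> h ` T" by blast
  qed (auto simp: h_def T_def PR)
  have dT: "(h has_derivative h' y) (at y within T)" if "y \<in> T" for y
  proof -
    have Py: "?P y \<in> S" using that by (simp add: T_def)
    have a: "(?P has_derivative ?P) (at y within T)" by (rule bounded_linear_imp_has_derivative[OF bl(1)])
    have "(g has_derivative g' (?P y)) (at (?P y) within ?P ` T)"
      by (rule has_derivative_subset[OF der[OF Py]]) (auto simp: T_def)
    from diff_chain_within[OF a this]
    have "((\<lambda>y. g (?P y)) has_derivative (\<lambda>v. g' (?P y) (?P v))) (at y within T)" by (simp add: o_def)
    then show ?thesis unfolding h_def h'_def by (rule bounded_linear.has_derivative[OF bl(2)])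
  qed
  have det': "det (matrix (h' y)) = det (matrix (g' (?P y)))" if "y \<in> T" for y
  proof -
    have ax: "?P (axis (b j) 1) = axis j 1" for j
      using b by (auto simp: reindex_def vec_eq_iff axis_def dest: bij_is_inj injD)
    have "det (\<chi> i j. matrix (h' y) $ b i $ b j) = det (matrix (h' y))" by (rule det_reindex[OF b])
    moreover have "(\<chi> i j. matrix (h' y) $ b i $ b j) = matrix (g' (?P y))"
      by (simp add: vec_eq_iff matrix_def h'_def ax) (simp add: reindex_def bb)
    ultimately show ?thesis by simp
  qed
  have "(\<integral>\<^sup>+ x. ennreal (indicator S x * (\<bar>det (matrix (g' x))\<bar> * f (g x))) \<partial>lborel)
    = (\<integral>\<^sup>+ y. ennreal (indicator S (?P y) * (\<bar>det (matrix (g' (?P y)))\<bar> * f (g (?P y)))) \<partial>lborel)"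
    by (rule nn_integral_reindex[OF b, symmetric]) (use m in measurable)
  also have eq1: "(\<lambda>y. indicator S (?P y) * (\<bar>det (matrix (g' (?P y)))\<bar> * f (g (?P y)))) =
     (\<lambda>y. indicator T y * (\<bar>det (matrix (h' y))\<bar> * f (?P (h y))))"
    using det' by (auto simp: fun_eq_iff T_def h_def PR indicator_def)
  have "(\<integral>\<^sup>+ y. ennreal (indicator S (?P y) * (\<bar>det (matrix (g' (?P y)))\<bar> * f (g (?P y)))) \<partial>lborel)
    = (\<integral>\<^sup>+ y. ennreal (indicator T y * (\<bar>det (matrix (h' y))\<bar> * f (?P (h y)))) \<partial>lborel)"
    using eq1 by (simp add: fun_eq_iff)
  also have "\<dots> = (\<integral>\<^sup>+ y. ennreal (indicator (h ` T) y * f (?P y)) \<partial>lborel)"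
  proof (rule nn_integral_change_of_variables_wellorder[OF _ dT])
    show "T \<in> sets borel" unfolding T_def using measurable_sets_borel[OF reindex_measurable[of b] S] by simp
    show "inj_on h T"
      unfolding h_def T_def by (rule inj_onI) (metis PR inj inj_onD vimageD)
    have "(\<lambda>y. indicator (g ` S) (?P y) * f (?P y)) \<in> borel_measurable borel"
      using measurable_compose[OF reindex_measurable f(1)] .
    then show "(\<lambda>y. indicator (h ` T) y * f (?P y)) \<in> borel_measurable borel"
      unfolding hT by (simp add: indicator_def)
    have "(\<lambda>y. indicator S (?P y) * (\<bar>det (matrix (g' (?P y)))\<bar> * f (g (?P y)))) \<in> borel_measurable borel"
      using measurable_compose[OF reindex_measurable m] .
    then show "(\<lambda>x. indicator T x * (\<bar>det (matrix (h' x))\<bar> * f (?P (h x)))) \<in> borel_measurable borel"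
      unfolding eq1 .
  qed (use f in auto)
  also have "\<dots> = (\<integral>\<^sup>+ y. ennreal (indicator (g ` S) (?P y) * f (?P y)) \<partial>lborel)"
    unfolding hT by (simp add: indicator_def)
  also have "\<dots> = (\<integral>\<^sup>+ y. ennreal (indicator (g ` S) y * f y) \<partial>lborel)"
    by (rule nn_integral_reindex[OF b]) (use f(1) in measurable)
  finally show ?thesis .
qed

section \<open>Lorentzian linear algebra\<close>

lemma bounded_bilinear_lor: "bounded_bilinear (lor :: 'n::finite minkowski \<Rightarrow> _)"
proof
  show "\<exists>K. \<forall>a b :: 'n minkowski. norm (lor a b) \<le> norm a * norm b * K"
  proof (intro exI[of _ 2] allI)
    fix a b :: "'n minkowski"
    have "\<bar>lor a b\<bar> \<le> \<bar>fst a \<bullet> fst b\<bar> + \<bar>snd a * snd b\<bar>" unfolding lor_def by linarith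
    also have "\<dots> \<le> norm (fst a) * norm (fst b) + norm (snd a) * norm (snd b)"
      by (intro add_mono Cauchy_Schwarz_ineq2) (simp add: abs_mult)
    also have "\<dots> \<le> norm a * norm b + norm a * norm b"
      by (intro add_mono mult_mono norm_fst_le[of "fst a" "snd a", simplified] norm_fst_le[of "fst b" "snd b", simplified]
           norm_snd_le[of "snd a" "fst a", unfolded prod.collapse] norm_snd_le[of "snd b" "fst b", unfolded prod.collapse] norm_ge_zero)
    finally show "norm (lor a b) \<le> norm a * norm b * 2" by simp
  qed
qed (auto simp: lor_def algebra_simps inner_add_left inner_add_right)

interpretation lor: bounded_bilinear "lor :: 'n::finite minkowski \<Rightarrow> _"
  by (rule bounded_bilinear_lor)

lemma lor_commute: "lor p q = lor q p"
  by (simp add: lor_def inner_commute mult.commute)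

lemmas lor_simps = lor.add_left lor.add_right lor.scaleR_left lor.scaleR_right
  lor.diff_left lor.diff_right lor.minus_left lor.minus_right lor.zero_left lor.zero_right

lemma lor_eq_inner: "lor p q = p \<bullet> (fst q, - snd q)"
  by (simp add: lor_def inner_prod_def)

lemma lor_left_span:
  assumes "v \<in> span B" "\<And>e. e \<in> B \<Longrightarrow> lor e w = 0"
  shows "lor v w = 0"
  using assms by (induction rule: span_induct_alt) (auto simp: lor_simps)

lemma hypD: "p \<in> hyp \<Longrightarrow> lor p p = -1" "p \<in> hyp \<Longrightarrow> 0 < snd p"
  by (auto simp: hyp_def)

lemma hyp_norm_fst: "p \<in> hyp \<Longrightarrow> (norm (fst p))\<^sup>2 = (snd p)\<^sup>2 - 1"
  unfolding power2_norm_eq_inner by (simp add: hyp_def lor_def power2_eq_square)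

lemma hyp_snd_ge_1: assumes "p \<in> hyp" shows "1 \<le> snd p"
proof -
  have "1 \<le> (snd p)\<^sup>2" using hyp_norm_fst[OF assms] zero_le_power2[of "norm (fst p)"] by linarith
  then have "1\<^sup>2 \<le> (snd p)\<^sup>2" by simp
  then show ?thesis by (rule power2_le_imp_le) (use hypD(2)[OF assms] in simp)
qed

text \<open>Vectors orthogonal to a timelike vector are spacelike: orthogonality says that snd v *
  snd p is the inner product of the space parts, and Cauchy-Schwarz with |fst p|^2 = (snd p)^2 - 1
  makes the time part of v strictly smaller than its space part.\<close>

lemma lor_pos_on_perp:
  assumes "p \<in> hyp" "lor v p = 0" "v \<noteq> 0"
  shows "0 < lor v v"
proof -
  have s: "1 \<le> snd p" by (rule hyp_snd_ge_1[OF assms(1)])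
  have e: "fst v \<bullet> fst p = snd v * snd p" using assms(2) by (simp add: lor_def)
  have "fst v \<noteq> 0"
  proof
    assume "fst v = 0"
    then have "snd v = 0" using e s by auto
    then show False using \<open>fst v = 0\<close> assms(3) by (simp add: prod_eq_iff)
  qed
  then have n: "0 < (norm (fst v))\<^sup>2" by simp
  have "(snd v * snd p)\<^sup>2 \<le> (norm (fst v) * norm (fst p))\<^sup>2"
    unfolding e[symmetric] using Cauchy_Schwarz_ineq2[of "fst v" "fst p"]
    by (metis abs_ge_zero power2_abs power_mono)
  also have "\<dots> = (norm (fst v))\<^sup>2 * ((snd p)\<^sup>2 - 1)"
    by (simp add: power_mult_distrib hyp_norm_fst[OF assms(1)])
  also have "\<dots> < (norm (fst v))\<^sup>2 * (snd p)\<^sup>2" using n by (simp add: algebra_simps)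
  finally have "(snd v)\<^sup>2 < (norm (fst v))\<^sup>2"
    using s by (simp add: power_mult_distrib)
  then show ?thesis unfolding power2_norm_eq_inner by (simp add: lor_def power2_eq_square)
qed

lemma lor_nonneg_on_perp: "p \<in> hyp \<Longrightarrow> lor v p = 0 \<Longrightarrow> 0 \<le> lor v v"
  using lor_pos_on_perp[of p v] by (cases "v = 0") (simp_all add: lor_simps less_imp_le)

text \<open>Since \<open>lor\<close> is nonnegative on the complement of p, the usual argument
  works: the vector <w,w>v - <v,w>w has square <w,w> times the defect of the inequality.\<close>

lemma lor_cauchy_schwarz_on_perp:
  assumes "p \<in> hyp" "lor v p = 0" "lor w p = 0"
  shows "(lor v w)\<^sup>2 \<le> lor v v * lor w w"
proof (cases "w = 0")
  case False
  then have w: "0 < lor w w" using assms lor_pos_on_perp by blast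
  let ?u = "lor w w *\<^sub>R v - lor v w *\<^sub>R w"
  have "0 \<le> lor ?u ?u" by (rule lor_nonneg_on_perp[OF assms(1)]) (use assms in \<open>simp add: lor_simps\<close>)
  also have "lor ?u ?u = lor w w * (lor v v * lor w w - (lor v w)\<^sup>2)"
    by (simp add: lor_simps lor_commute[of w v] algebra_simps power2_eq_square)
  finally show ?thesis using w by (simp add: zero_le_mult_iff)
qed (auto simp: lor_simps)

text \<open>With s and t the heights, |fst p|^2 |fst q|^2 = (s^2-1)(t^2-1) = (st-1)^2 - (s-t)^2, so
  the inner product of the space parts is at most st - 1.\<close>

lemma lor_reverse_cauchy_schwarz:
  assumes "p \<in> hyp" "q \<in> hyp"
  shows "lor p q \<le> - 1"
proof -
  let ?s = "snd p" and ?t = "snd q"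
  have st: "1 \<le> ?s" "1 \<le> ?t" by (simp_all only: hyp_snd_ge_1 assms)
  then have st1: "1 \<le> ?s * ?t" using mult_mono[of 1 ?s 1 ?t] by simp
  have "(norm (fst p) * norm (fst q))\<^sup>2 = (?s\<^sup>2 - 1) * (?t\<^sup>2 - 1)"
    by (simp add: power_mult_distrib hyp_norm_fst assms)
  also have "\<dots> = (?s * ?t - 1)\<^sup>2 - (?s - ?t)\<^sup>2" by (simp add: power2_eq_square algebra_simps)
  also have "\<dots> \<le> (?s * ?t - 1)\<^sup>2" by simp
  finally have "norm (fst p) * norm (fst q) \<le> ?s * ?t - 1" by (rule power2_le_imp_le) (use st1 in simp)
  then show ?thesis unfolding lor_def using norm_cauchy_schwarz[of "fst p" "fst q"] by linarith
qed

section \<open>Positive definite subspaces, orthonormal bases and projections\<close>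

definition lor_positive :: "'n::finite minkowski set \<Rightarrow> bool" where
  "lor_positive T \<longleftrightarrow> subspace T \<and> (\<forall>v\<in>T. v \<noteq> 0 \<longrightarrow> 0 < lor v v)"

lemma lor_orthonormal_independent:
  assumes "finite B" "\<forall>e\<in>B. \<forall>f\<in>B. lor e f = (if e = f then 1 else 0)"
  shows "independent B"
proof (rule independent_if_scalars_zero[OF assms(1)])
  fix f x assume f: "(\<Sum>x\<in>B. f x *\<^sub>R x) = 0" and x: "x \<in> B"
  have "0 = lor (\<Sum>y\<in>B. f y *\<^sub>R y) x" by (simp add: f lor_simps)
  also have "\<dots> = (\<Sum>y\<in>B. f y * lor y x)" by (simp add: lor.sum_left lor_simps)
  also have "\<dots> = (\<Sum>y\<in>B. if y = x then f y else 0)" using assms x by (intro sum.cong) auto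
  also have "\<dots> = f x" using assms x by simp
  finally show "f x = 0" by simp
qed

lemma orthonormal_basis_sum_lor:
  assumes "orthonormal_basis T B" "f \<in> B"
  shows "lor (\<Sum>e\<in>B. c e *\<^sub>R e) f = c f"
proof -
  have "lor (\<Sum>e\<in>B. c e *\<^sub>R e) f = (\<Sum>e\<in>B. c e * lor e f)" by (simp add: lor.sum_left lor_simps)
  also have "\<dots> = (\<Sum>e\<in>B. if e = f then c e else 0)"
    using assms by (intro sum.cong) (auto simp: orthonormal_basis_def)
  also have "\<dots> = c f" using assms by (simp add: orthonormal_basis_def)
  finally show ?thesis .
qed

text \<open>Orthonormal sets are independent, so one of maximal cardinality exists. A vector of T
  outside its span would enlarge it after subtracting its projection and normalizing; positivity on
  T is what permits the normalization.\<close>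

lemma orthonormal_basis_exists:
  assumes T: "lor_positive (T :: 'n::finite minkowski set)"
  shows "\<exists>B. orthonormal_basis T B"
proof -
  define P where "P B \<longleftrightarrow> finite B \<and> B \<subseteq> T \<and> (\<forall>e\<in>B. \<forall>f\<in>B. lor e f = (if e = f then 1 else 0))" for B
  have "P {}" by (simp add: P_def)
  moreover have "\<forall>B. P B \<longrightarrow> card B < Suc (DIM('n minkowski))"
    using lor_orthonormal_independent independent_bound unfolding P_def by (metis less_Suc_eq_le)
  ultimately obtain B where B: "P B" "\<And>C. P C \<Longrightarrow> card C \<le> card B"
    using ex_has_greatest_nat[of P "{}" card "Suc (DIM('n minkowski))"] by (metis less_imp_le_nat)
  have sT: "subspace T" using T by (simp add: lor_positive_def)
  have spB: "span B \<subseteq> T" using B(1) sT by (simp add: P_def span_minimal)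
  have ob: "orthonormal_basis (span B) B" using B(1) by (auto simp: P_def orthonormal_basis_def span_superset)
  have "T \<subseteq> span B"
  proof (rule ccontr)
    assume "\<not> T \<subseteq> span B"
    then obtain v where v: "v \<in> T" "v \<notin> span B" by blast
    define w where "w = v - (\<Sum>e\<in>B. lor v e *\<^sub>R e)"
    have s: "(\<Sum>e\<in>B. lor v e *\<^sub>R e) \<in> span B" by (intro span_sum span_scale span_base)
    have wT: "w \<in> T" unfolding w_def using v s spB sT by (auto intro: subspace_diff)
    have "w \<noteq> 0" using v s by (auto simp: w_def)
    then have pos: "0 < lor w w" using T wT by (simp add: lor_positive_def)
    have wB: "lor w f = 0" if "f \<in> B" for f
      using orthonormal_basis_sum_lor[OF ob that] by (simp add: w_def lor_simps)
    define u where "u = (1 / sqrt (lor w w)) *\<^sub>R w"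
    have uu: "lor u u = 1" using pos by (simp add: u_def lor_simps field_simps)
    have uB: "lor u f = 0" "lor f u = 0" if "f \<in> B" for f
      using wB[OF that] lor_commute[of f] by (simp_all add: u_def lor_simps)
    have "u \<notin> B" using uB uu by fastforce
    moreover have "P (insert u B)"
      using B(1) uu uB \<open>u \<notin> B\<close> wT sT unfolding P_def by (auto simp: u_def subspace_scale)
    ultimately show False using B(2)[of "insert u B"] B(1) by (simp add: P_def)
  qed
  then show ?thesis using ob spB by (metis subset_antisym)
qed

lemma orthonormal_basis_some:
  "lor_positive T \<Longrightarrow> orthonormal_basis T (SOME B. orthonormal_basis T B)"
  using orthonormal_basis_exists by (metis someI_ex)

lemma orthonormal_basis_expansion:
  assumes "lor_positive T" "orthonormal_basis T B" "v \<in> T"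
  shows "v = (\<Sum>e\<in>B. lor v e *\<^sub>R e)"
proof -
  define w where "w = v - (\<Sum>e\<in>B. lor v e *\<^sub>R e)"
  have T: "subspace T" "B \<subseteq> T" "T = span B" using assms by (auto simp: lor_positive_def orthonormal_basis_def)
  then have wT: "w \<in> T" unfolding w_def using assms(3)
    by (intro subspace_diff subspace_sum subspace_scale) auto
  have "lor f w = 0" if "f \<in> B" for f
    using orthonormal_basis_sum_lor[OF assms(2) that] by (simp add: w_def lor_simps lor_commute[of f])
  then have "lor w w = 0" using lor_left_span wT T(3) by metis
  then have "w = 0" using assms(1) wT by (auto simp: lor_positive_def)
  then show ?thesis by (simp add: w_def)
qed

lemma orthonormal_basis_card:
  assumes "orthonormal_basis T B" shows "card B = dim T"
proof -
  have "independent B" "T = span B" using assms lor_orthonormal_independent by (auto simp: orthonormal_basis_def)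
  then show ?thesis by (simp add: dim_span dim_eq_card_independent)
qed

text \<open>The basis is an arbitrary choice, but \<open>lor_proj_unique\<close> characterizes the
  result by membership and orthogonality alone.\<close>

definition lor_proj :: "'n::finite minkowski set \<Rightarrow> 'n minkowski \<Rightarrow> 'n minkowski" where
  "lor_proj T w = (\<Sum>e\<in>(SOME B. orthonormal_basis T B). lor w e *\<^sub>R e)"

lemma
  assumes "lor_positive T"
  shows lor_proj_in: "lor_proj T w \<in> T"
    and lor_proj_perp: "v \<in> T \<Longrightarrow> lor (w - lor_proj T w) v = 0"
proof -
  define B where "B = (SOME B. orthonormal_basis T B)"
  have B: "orthonormal_basis T B" unfolding B_def by (rule orthonormal_basis_some[OF assms])
  then show "lor_proj T w \<in> T" unfolding lor_proj_def B_def[symmetric]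
    using assms by (intro subspace_sum subspace_scale) (auto simp: lor_positive_def orthonormal_basis_def)
  assume "v \<in> T"
  then have "v \<in> span B" using B by (simp add: orthonormal_basis_def)
  moreover have "lor e (w - lor_proj T w) = 0" if "e \<in> B" for e
    unfolding lor_proj_def B_def[symmetric]
    using orthonormal_basis_sum_lor[OF B that, of "lor w"] by (simp add: lor_simps lor_commute[of e])
  ultimately show "lor (w - lor_proj T w) v = 0" using lor_left_span lor_commute by metis
qed

lemma lor_positive_orthogonal_zero:
  assumes "lor_positive T" "t \<in> T" "\<And>v. v \<in> T \<Longrightarrow> lor t v = 0" shows "t = 0"
  using assms unfolding lor_positive_def by (metis less_irrefl)

lemma lor_proj_unique:
  assumes "lor_positive T" "t \<in> T" "\<And>v. v \<in> T \<Longrightarrow> lor (w - t) v = 0"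
  shows "lor_proj T w = t"
proof -
  have "lor_proj T w - t = 0"
  proof (rule lor_positive_orthogonal_zero[OF assms(1)])
    show "lor_proj T w - t \<in> T" using assms(1,2) lor_proj_in[OF assms(1), of w] unfolding lor_positive_def by (blast intro: subspace_diff)
    fix v assume "v \<in> T"
    then have "lor (w - lor_proj T w) v = 0" "lor (w - t) v = 0" using lor_proj_perp[OF assms(1)] assms(3) by blast+
    then show "lor (lor_proj T w - t) v = 0" by (simp add: lor_simps)
  qed
  then show ?thesis by simp
qed

lemma lor_positive_perp_subset:
  assumes "p \<in> hyp" "subspace T" "\<And>v. v \<in> T \<Longrightarrow> lor v p = 0"
  shows "lor_positive T"
  using assms lor_pos_on_perp unfolding lor_positive_def by blast

section \<open>Geodesics and tangent spaces of the hyperboloid\<close>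

lemma Ck_on_cosh_sinh:
  "Ck_on m (\<lambda>t::real. cosh (a * t) *\<^sub>R A + sinh (a * t) *\<^sub>R (B :: 'a::euclidean_space)) UNIV"
proof (induction m arbitrary: A B)
  case 0
  then show ?case by (auto intro!: continuous_intros)
next
  case (Suc m)
  show ?case
  \<comment> \<open>Differentiation exchanges the coefficients A and B up to scalars, so the
    induction has to run over both of them.\<close>
  proof (rule Ck_on_SucI'[where f'="\<lambda>t s. (s * a) *\<^sub>R (sinh (a * t) *\<^sub>R A + cosh (a * t) *\<^sub>R B)"])
    show "((\<lambda>t. cosh (a * t) *\<^sub>R A + sinh (a * t) *\<^sub>R B) has_derivative
          (\<lambda>s. (s * a) *\<^sub>R (sinh (a * t) *\<^sub>R A + cosh (a * t) *\<^sub>R B))) (at t)" for t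
      by (auto intro!: derivative_eq_intros simp: algebra_simps)
    show "Ck_on m (\<lambda>t. (v * a) *\<^sub>R (sinh (a * t) *\<^sub>R A + cosh (a * t) *\<^sub>R B)) UNIV" for v
      using Suc[of "(v * a) *\<^sub>R B" "(v * a) *\<^sub>R A"] by (simp add: algebra_simps)
  qed auto
qed

text \<open>On the lower sheet -q would belong to \<open>hyp\<close>, and the reverse Cauchy-Schwarz
  inequality would force <q,p> >= 1.\<close>

lemma hyp_futureI:
  assumes "p \<in> hyp" "lor q q = -1" "lor q p < 0"
  shows "q \<in> hyp"
proof -
  have "0 < snd q"
  proof (rule ccontr)
    assume neg: "\<not> 0 < snd q"
    have "(norm (fst q))\<^sup>2 = (snd q)\<^sup>2 - 1"
      using assms(2) unfolding power2_norm_eq_inner by (simp add: lor_def power2_eq_square)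
    then have "snd q \<noteq> 0" using zero_le_power2[of "norm (fst q)"] by (intro notI) simp
    then have "- q \<in> hyp" using assms(2) neg by (simp add: hyp_def lor_simps)
    then have "lor (- q) p \<le> -1" using assms(1) by (rule lor_reverse_cauchy_schwarz)
    then show False using assms(3) by (simp add: lor_simps)
  qed
  then show ?thesis using assms(2) by (simp add: hyp_def)
qed

text \<open>Differentiating <\<gamma>,\<gamma>> = -1 gives orthogonality to p; conversely the
  geodesic cosh(at) p + sinh(at) u stays in \<open>hyp\<close> and has velocity a u = w at
  0.\<close>

lemma tangent_space_hyp:
  assumes "p \<in> hyp"
  shows "tangent_space hyp p = {w. lor w p = 0}"
proof (intro set_eqI iffI)
  fix w assume "w \<in> tangent_space hyp p"
  then obtain e and \<gamma> :: "real \<Rightarrow> 'a minkowski" where e: "e > 0" "\<gamma> ` {-e<..<e} \<subseteq> hyp" "\<gamma> 0 = p"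
    and d: "(\<gamma> has_vector_derivative w) (at 0)"
    by (auto simp: tangent_space_def)
  have "((\<lambda>t. lor (\<gamma> t) (\<gamma> t)) has_derivative (\<lambda>h. lor (\<gamma> 0) (h *\<^sub>R w) + lor (h *\<^sub>R w) (\<gamma> 0))) (at 0)"
    using d unfolding has_vector_derivative_def by (intro lor.FDERIV)
  moreover have "((\<lambda>t. lor (\<gamma> t) (\<gamma> t)) has_derivative (\<lambda>h. 0)) (at 0)"
  proof (rule has_derivative_transform_within_open[OF has_derivative_const])
    show "- 1 = lor (\<gamma> t) (\<gamma> t)" if "t \<in> {-e<..<e}" for t
      using hypD(1)[of "\<gamma> t"] e(2) that by (simp add: image_subset_iff)
  qed (use e in auto)
  ultimately have "(\<lambda>h. lor (\<gamma> 0) (h *\<^sub>R w) + lor (h *\<^sub>R w) (\<gamma> 0)) = (\<lambda>h. 0)" by (rule has_derivative_unique)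
  then have "lor p (1 *\<^sub>R w) + lor (1 *\<^sub>R w) p = 0" unfolding e(3) by meson
  then show "w \<in> {w. lor w p = 0}" using lor_commute[of p w] by simp
next
  fix w assume "w \<in> {w. lor w p = 0}"
  then have w: "lor w p = 0" "lor p w = 0" by (simp_all add: lor_commute)
  \<comment> \<open>For w = 0 this gives a = 0 and u = 0, and the curve below is constant at
    p.\<close>
  define a where "a = sqrt (lor w w)"
  define u where "u = (1 / a) *\<^sub>R w"
  have a: "a *\<^sub>R u = w" "a > 0 \<Longrightarrow> lor u u = 1" "lor u p = 0" "lor p u = 0" "a = 0 \<Longrightarrow> u = 0" "a \<ge> 0"
    using lor_pos_on_perp[OF assms w(1)] lor_nonneg_on_perp[OF assms w(1)] w
    by (cases "w = 0"; auto simp: a_def u_def lor_simps)+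
  define \<gamma> where "\<gamma> t = cosh (a * t) *\<^sub>R p + sinh (a * t) *\<^sub>R u" for t
  have "smooth_on \<gamma> UNIV" unfolding smooth_on_def \<gamma>_def using Ck_on_cosh_sinh by blast
  then have "smooth_on \<gamma> {-1<..<1}" using smooth_on_subset by blast
  moreover have "\<gamma> 0 = p" by (simp add: \<gamma>_def)
  moreover have "(\<gamma> has_vector_derivative w) (at 0)"
    unfolding \<gamma>_def by (auto intro!: derivative_eq_intros simp: a(1)[symmetric])
  moreover have "\<gamma> t \<in> hyp" for t
  proof -
    have l: "lor (\<gamma> t) (\<gamma> t) = -1"
    proof (cases "a = 0")
      case False
      then show ?thesis using a hypD(1)[OF assms] cosh_square_eq[of "a * t"]
        by (simp add: \<gamma>_def lor_simps power2_eq_square algebra_simps)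
    qed (use a hypD(1)[OF assms] in \<open>simp add: \<gamma>_def lor_simps\<close>)
    have lp: "lor (\<gamma> t) p = - cosh (a * t)"
      using a hypD(1)[OF assms] by (simp add: \<gamma>_def lor_simps)
    show ?thesis by (rule hyp_futureI[OF assms l]) (use lp cosh_real_pos[of "a * t"] in simp)
  qed
  ultimately show "w \<in> tangent_space hyp p"
    unfolding tangent_space_def by (intro CollectI exI[of _ "1::real"] exI[of _ \<gamma>]) auto
qed

section \<open>Slice charts and the second fundamental form\<close>

text \<open>Every functional from the orthogonal complement of L vanishes along the curve, hence on
  its velocity; L is its own double complement.\<close>

lemma has_vector_derivative_in_subspace:
  fixes c :: "real \<Rightarrow> 'a::euclidean_space"
  assumes "subspace L" "(c has_vector_derivative v) (at 0)" "0 < d" "\<And>t. \<bar>t\<bar> < d \<Longrightarrow> c t \<in> L"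
  shows "v \<in> L"
proof -
  have "v \<bullet> w = 0" if w: "w \<in> L\<^sup>\<bottom>" for w
  proof -
    have "((\<lambda>t. c t \<bullet> w) has_vector_derivative v \<bullet> w) (at 0)"
      by (rule bounded_linear.has_vector_derivative[OF bounded_linear_inner_left assms(2)])
    moreover have "((\<lambda>t. c t \<bullet> w) has_vector_derivative 0) (at 0)"
    proof (rule has_vector_derivative_transform_within_open[OF has_vector_derivative_const])
      show "0 = c t \<bullet> w" if "t \<in> {-d<..<d}" for t
        using assms(4)[of t] w that by (fastforce simp: orthogonal_comp_def orthogonal_def abs_less_iff inner_commute[of w])
    qed (use assms(3) in auto)
    ultimately show ?thesis by (rule vector_derivative_unique_at)
  qed
  then have "v \<in> L\<^sup>\<bottom>\<^sup>\<bottom>" by (simp add: orthogonal_comp_def orthogonal_def inner_commute)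
  then show ?thesis using assms(1) orthogonal_comp_self by blast
qed

section \<open>Derivatives in moving directions and second derivatives\<close>

lemma smooth_on_frechet_apply:
  fixes f :: "'a::euclidean_space \<Rightarrow> 'b::euclidean_space" and X :: "'a \<Rightarrow> 'a"
  assumes "open U" "smooth_on f U" "smooth_on X U"
  shows "smooth_on (\<lambda>q. frechet_derivative f (at q) (X q)) U"
proof (rule smooth_on_cong[OF assms(1)])
  show "(\<Sum>j\<in>Basis. (X q \<bullet> j) *\<^sub>R frechet_derivative f (at q) j) = frechet_derivative f (at q) (X q)" if "q \<in> U" for q
    by (rule linear_Basis_expansion[OF smooth_on_linear_deriv[OF assms(2) that], symmetric])
  show "smooth_on (\<lambda>q. \<Sum>j\<in>Basis. (X q \<bullet> j) *\<^sub>R frechet_derivative f (at q) j) U"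
    using smooth_on_deriv[OF assms(2)] assms(3) unfolding smooth_on_def
    by (intro allI Ck_on_sum Ck_on_scaleR Ck_on_linear_comp[OF assms(1) bounded_linear_inner_left] assms(1)) auto
qed

text \<open>The inner differentiation is in direction c, the outer one in direction b; that the
  order does not matter for smooth maps is \<open>deriv2_symmetric\<close>.\<close>

definition deriv2 :: "('c::euclidean_space \<Rightarrow> 'a::euclidean_space) \<Rightarrow> 'c \<Rightarrow> 'c \<Rightarrow> 'c \<Rightarrow> 'a" where
  "deriv2 f x b c = frechet_derivative (\<lambda>y. frechet_derivative f (at y) c) (at x) b"

lemma has_derivative_deriv2:
  "smooth_on f U \<Longrightarrow> x \<in> U \<Longrightarrow> ((\<lambda>y. frechet_derivative f (at y) c) has_derivative (\<lambda>b. deriv2 f x b c)) (at x)"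
  unfolding deriv2_def by (rule smooth_on_has_derivative[OF smooth_on_deriv])

lemma deriv2_Basis_expansion:
  assumes "open U" "smooth_on f U" "x \<in> U"
  shows "deriv2 f x b c = (\<Sum>i\<in>Basis. (c \<bullet> i) *\<^sub>R deriv2 f x b i)"
proof -
  have "((\<lambda>y. \<Sum>i\<in>Basis. (c \<bullet> i) *\<^sub>R frechet_derivative f (at y) i) has_derivative
        (\<lambda>b. \<Sum>i\<in>Basis. (c \<bullet> i) *\<^sub>R deriv2 f x b i)) (at x)"
    by (intro has_derivative_sum has_derivative_scaleR_right has_derivative_deriv2[OF assms(2,3)])
  then have "((\<lambda>y. frechet_derivative f (at y) c) has_derivative (\<lambda>b. \<Sum>i\<in>Basis. (c \<bullet> i) *\<^sub>R deriv2 f x b i)) (at x)"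
    by (rule has_derivative_transform_within_open[OF _ assms(1,3)])
       (simp add: linear_Basis_expansion[OF smooth_on_linear_deriv[OF assms(2)], symmetric])
  from has_derivative_unique[OF has_derivative_deriv2[OF assms(2,3)] this]
  show ?thesis by meson
qed

lemma linear_deriv2_right:
  assumes "open U" "smooth_on f U" "x \<in> U" shows "linear (deriv2 f x b)"
proof -
  have eq: "deriv2 f x b = (\<lambda>c. \<Sum>i\<in>Basis. (c \<bullet> i) *\<^sub>R deriv2 f x b i)"
    by (rule ext) (rule deriv2_Basis_expansion[OF assms])
  show ?thesis
    by (subst eq, rule linearI) (simp_all add: inner_add_left scaleR_add_left sum.distrib scaleR_sum_right)
qed

lemma linear_deriv2_left:
  assumes "smooth_on f U" "x \<in> U" shows "linear (\<lambda>b. deriv2 f x b c)"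
  using has_derivative_deriv2[OF assms] has_derivative_linear by blast

lemma deriv2_symmetric:
  assumes "open U" "smooth_on f U" "x \<in> U"
  shows "deriv2 f x b c = deriv2 f x c b"
  by (rule second_derivative_symmetric[OF assms(1,3) smooth_on_has_derivative[OF assms(2)]
        has_derivative_deriv2[OF assms(2,3)] has_derivative_deriv2[OF assms(2,3)]])

text \<open>Product rule along the line x + t b: the moving base point contributes the second
  derivative, the moving argument contributes Df(c').\<close>

lemma has_vector_derivative_frechet_apply:
  fixes f :: "'c::euclidean_space \<Rightarrow> 'a::euclidean_space"
  assumes "open U" "smooth_on f U" "x \<in> U" and c: "(c has_vector_derivative c') (at 0)"
  shows "((\<lambda>t. frechet_derivative f (at (x + t *\<^sub>R b)) (c t)) has_vector_derivative
           deriv2 f x b (c 0) + frechet_derivative f (at x) c') (at 0)"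
proof -
  let ?D = "\<lambda>x. frechet_derivative f (at x)"
  have ci: "((\<lambda>t. c t \<bullet> i) has_vector_derivative c' \<bullet> i) (at 0)" for i
    by (rule bounded_linear.has_vector_derivative[OF bounded_linear_inner_left c])
  have "((\<lambda>t. \<Sum>i\<in>Basis. (c t \<bullet> i) *\<^sub>R ?D (x + t *\<^sub>R b) i) has_vector_derivative
      (\<Sum>i\<in>Basis. (c 0 \<bullet> i) *\<^sub>R deriv2 f x b i + (c' \<bullet> i) *\<^sub>R ?D (x + 0 *\<^sub>R b) i)) (at 0)"
    by (intro has_vector_derivative_sum has_vector_derivative_scaleR
          has_derivative_along_line[OF has_derivative_deriv2[OF assms(2,3)]])
       (use ci in \<open>simp add: has_real_derivative_iff_has_vector_derivative\<close>)
  moreover have "(\<Sum>i\<in>Basis. (c 0 \<bullet> i) *\<^sub>R deriv2 f x b i + (c' \<bullet> i) *\<^sub>R ?D (x + 0 *\<^sub>R b) i)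
     = deriv2 f x b (c 0) + ?D x c'"
    by (simp add: sum.distrib linear_Basis_expansion[OF linear_deriv2_right[OF assms(1-3)], symmetric]
         linear_Basis_expansion[OF smooth_on_linear_deriv[OF assms(2,3)], symmetric])
  ultimately have *: "((\<lambda>t. \<Sum>i\<in>Basis. (c t \<bullet> i) *\<^sub>R ?D (x + t *\<^sub>R b) i) has_vector_derivative
     deriv2 f x b (c 0) + ?D x c') (at 0)" by simp
  have "open ((\<lambda>t. x + t *\<^sub>R b) -` U)"
    by (intro open_vimage assms(1) continuous_intros)
  then show ?thesis
    by (rule has_vector_derivative_transform_within_open[OF *])
       (use assms(3) linear_Basis_expansion[OF smooth_on_linear_deriv[OF assms(2)], symmetric] in auto)
qed

text \<open>The chart space 'c is separate from the ambient type, so the same locale serves slice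
  charts with a linear subspace L and parametrizations over all of \<open>real^'k\<close>.\<close>

locale slice_chart =
  fixes S :: "'a::euclidean_space set" and W :: "'a set" and V :: "'c::euclidean_space set"
    and \<Phi> :: "'a \<Rightarrow> 'c" and \<Psi> :: "'c \<Rightarrow> 'a" and L :: "'c set"
  assumes open_W: "open W" and open_V: "open V" and smooth_\<Phi>: "smooth_on \<Phi> W" and smooth_\<Psi>: "smooth_on \<Psi> V"
    and subspace_L: "subspace L" and image_\<Phi>: "\<Phi> ` (S \<inter> W) = V \<inter> L"
    and \<Psi>_\<Phi>: "q \<in> S \<Longrightarrow> q \<in> W \<Longrightarrow> \<Psi> (\<Phi> q) = q"
begin

abbreviation D\<Psi> where "D\<Psi> x \<equiv> frechet_derivative \<Psi> (at x)"
abbreviation D\<Phi> where "D\<Phi> q \<equiv> frechet_derivative \<Phi> (at q)"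

lemma \<Phi>_in: "q \<in> S \<Longrightarrow> q \<in> W \<Longrightarrow> \<Phi> q \<in> V" "q \<in> S \<Longrightarrow> q \<in> W \<Longrightarrow> \<Phi> q \<in> L"
  using image_\<Phi> by blast+

lemma \<Psi>_in: assumes "x \<in> V" "x \<in> L" shows "\<Psi> x \<in> S" "\<Psi> x \<in> W" "\<Phi> (\<Psi> x) = x"
proof -
  have "x \<in> \<Phi> ` (S \<inter> W)" using assms image_\<Phi> by blast
  then obtain q where "q \<in> S" "q \<in> W" "x = \<Phi> q" by blast
  then show "\<Psi> x \<in> S" "\<Psi> x \<in> W" "\<Phi> (\<Psi> x) = x" using \<Psi>_\<Phi> by auto
qed

lemma line_in_V:
  assumes "x \<in> V"
  obtains e where "0 < e" "\<And>t. \<bar>t\<bar> < e \<Longrightarrow> x + t *\<^sub>R b \<in> V"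
proof -
  have "open ((\<lambda>t. x + t *\<^sub>R b) -` V)" by (intro open_vimage open_V continuous_intros)
  moreover have "0 \<in> (\<lambda>t. x + t *\<^sub>R b) -` V" using assms by simp
  ultimately obtain e where "0 < e" "ball 0 e \<subseteq> (\<lambda>t. x + t *\<^sub>R b) -` V" by (rule openE)
  then show ?thesis using that by (auto simp: subset_iff)
qed

lemma line_in_L: "x \<in> L \<Longrightarrow> b \<in> L \<Longrightarrow> x + t *\<^sub>R b \<in> L"
  using subspace_L by (simp add: subspace_add subspace_scale)

lemma \<Psi>_line: "x \<in> V \<Longrightarrow> ((\<lambda>t. \<Psi> (x + t *\<^sub>R b)) has_vector_derivative D\<Psi> x b) (at 0)"
  by (rule has_derivative_along_line[OF smooth_on_has_derivative[OF smooth_\<Psi>]])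

lemma has_vector_derivative_\<Psi>_comp:
  assumes "x \<in> V" "(f has_derivative f') (at (\<Psi> x))"
  shows "((\<lambda>t. f (\<Psi> (x + t *\<^sub>R b))) has_vector_derivative f' (D\<Psi> x b)) (at 0)"
  using has_derivative_along_line[OF has_derivative_compose[OF smooth_on_has_derivative[OF smooth_\<Psi> assms(1)] assms(2)]] .

text \<open>The identity \<Phi>(\<Psi>(x)) = x is available on the slice V \<inter> L only, so it is
  differentiated along lines x + t b that stay in L.\<close>

lemma D\<Phi>_D\<Psi>:
  assumes x: "x \<in> V" "x \<in> L" and "b \<in> L"
  shows "D\<Phi> (\<Psi> x) (D\<Psi> x b) = b"
proof -
  obtain e where e: "0 < e" "\<And>t. \<bar>t\<bar> < e \<Longrightarrow> x + t *\<^sub>R b \<in> V" using line_in_V[OF x(1)] by blast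
  have "((\<lambda>t. \<Phi> (\<Psi> (x + t *\<^sub>R b))) has_vector_derivative D\<Phi> (\<Psi> x) (D\<Psi> x b)) (at 0)"
    by (rule has_vector_derivative_\<Psi>_comp[OF x(1) smooth_on_has_derivative[OF smooth_\<Phi> \<Psi>_in(2)[OF x]]])
  moreover have "((\<lambda>t. \<Phi> (\<Psi> (x + t *\<^sub>R b))) has_vector_derivative b) (at 0)"
  proof (rule has_vector_derivative_transform_within_open[of "\<lambda>t. x + t *\<^sub>R b" _ _ "{-e<..<e}"])
    show "((\<lambda>t. x + t *\<^sub>R b) has_vector_derivative b) (at 0)"
      by (auto intro!: derivative_eq_intros)
    show "x + t *\<^sub>R b = \<Phi> (\<Psi> (x + t *\<^sub>R b))" if "t \<in> {-e<..<e}" for t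
      using \<Psi>_in(3)[OF e(2) line_in_L[OF x(2) assms(3)]] that by (simp add: abs_less_iff)
  qed (use e in auto)
  ultimately show ?thesis by (rule vector_derivative_unique_at)
qed

text \<open>A curve in S is carried by \<Phi> into the slice, so its velocity there lies in L and
  returns through D\<Psi>. Conversely \<Psi> carries a segment in L to a curve in S.\<close>

lemma tangent_space_eq:
  assumes x: "x \<in> V" "x \<in> L"
  shows "tangent_space S (\<Psi> x) = D\<Psi> x ` L"
proof (intro subset_antisym subsetI)
  fix v assume "v \<in> tangent_space S (\<Psi> x)"
  then obtain e and \<gamma> :: "real \<Rightarrow> 'a" where e: "e > 0" "smooth_on \<gamma> {-e<..<e}" "\<gamma> ` {-e<..<e} \<subseteq> S" "\<gamma> 0 = \<Psi> x"
    and d: "(\<gamma> has_vector_derivative v) (at 0)"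
    by (auto simp: tangent_space_def)
  have "open ({-e<..<e} \<inter> \<gamma> -` W)"
    using smooth_on_continuous[OF e(2)] open_W by (intro continuous_open_preimage) auto
  moreover have "0 \<in> {-e<..<e} \<inter> \<gamma> -` W" using e \<Psi>_in(2)[OF x] by simp
  ultimately obtain r where r: "0 < r" "ball 0 r \<subseteq> {-e<..<e} \<inter> \<gamma> -` W" by (rule openE)
  then have \<gamma>: "\<gamma> t \<in> S" "\<gamma> t \<in> W" if "\<bar>t\<bar> < r" for t
    using that e(3) by (auto simp: subset_iff image_subset_iff)
  have \<Phi>': "(\<Phi> has_derivative D\<Phi> (\<Psi> x)) (at (\<gamma> 0))"
    using smooth_on_has_derivative[OF smooth_\<Phi> \<Psi>_in(2)[OF x]] e(4) by simp
  have c: "((\<lambda>t. \<Phi> (\<gamma> t)) has_vector_derivative D\<Phi> (\<Psi> x) v) (at 0)"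
    using vector_derivative_diff_chain_within[OF d, of \<Phi> "D\<Phi> (\<Psi> x)"] \<Phi>'
    by (simp add: o_def has_derivative_at_withinI)
  have cL: "D\<Phi> (\<Psi> x) v \<in> L"
    by (rule has_vector_derivative_in_subspace[OF subspace_L c r(1)]) (use \<gamma> \<Phi>_in in auto)
  have \<Psi>': "(\<Psi> has_derivative D\<Psi> x) (at (\<Phi> (\<gamma> 0)))"
    using smooth_on_has_derivative[OF smooth_\<Psi> x(1)] e(4) \<Psi>_in(3)[OF x] by simp
  have "((\<lambda>t. \<Psi> (\<Phi> (\<gamma> t))) has_vector_derivative D\<Psi> x (D\<Phi> (\<Psi> x) v)) (at 0)"
    using vector_derivative_diff_chain_within[OF c, of \<Psi> "D\<Psi> x"] \<Psi>'
    by (simp add: o_def has_derivative_at_withinI)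
  moreover have "((\<lambda>t. \<Psi> (\<Phi> (\<gamma> t))) has_vector_derivative v) (at 0)"
    by (rule has_vector_derivative_transform_within_open[OF d, of "{-r<..<r}"])
       (use r \<gamma> \<Psi>_\<Phi> in \<open>auto simp: abs_less_iff\<close>)
  ultimately have "v = D\<Psi> x (D\<Phi> (\<Psi> x) v)" using vector_derivative_unique_at by blast
  then show "v \<in> D\<Psi> x ` L" using cL by blast
next
  fix v assume "v \<in> D\<Psi> x ` L"
  then obtain b where b: "b \<in> L" "v = D\<Psi> x b" by blast
  obtain e where e: "0 < e" "\<And>t. \<bar>t\<bar> < e \<Longrightarrow> x + t *\<^sub>R b \<in> V" using line_in_V[OF x(1)] by blast
  have "smooth_on (\<lambda>t. \<Psi> (x + t *\<^sub>R b)) {-e<..<e}"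
    by (rule smooth_on_compose[OF _ open_V _ smooth_\<Psi> smooth_on_affine]) (use e in auto)
  moreover have "(\<lambda>t. \<Psi> (x + t *\<^sub>R b)) ` {-e<..<e} \<subseteq> S"
    using \<Psi>_in(1)[OF e(2) line_in_L[OF x(2) b(1)]] by (auto simp: abs_less_iff)
  moreover have "((\<lambda>t. \<Psi> (x + t *\<^sub>R b)) has_vector_derivative v) (at 0)"
    unfolding b(2) by (rule \<Psi>_line[OF x(1)])
  ultimately show "v \<in> tangent_space S (\<Psi> x)"
    unfolding tangent_space_def using e(1) by force
qed

lemma linear_D\<Psi>: "x \<in> V \<Longrightarrow> linear (D\<Psi> x)"
  by (rule smooth_on_linear_deriv[OF smooth_\<Psi>])

lemma linear_D\<Phi>: "q \<in> W \<Longrightarrow> linear (D\<Phi> q)"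
  by (rule smooth_on_linear_deriv[OF smooth_\<Phi>])

lemma subspace_tangent_space: "x \<in> V \<Longrightarrow> x \<in> L \<Longrightarrow> subspace (tangent_space S (\<Psi> x))"
  by (simp add: tangent_space_eq linear_D\<Psi> linear_subspace_image subspace_L)

lemma dim_tangent_space:
  assumes "x \<in> V" "x \<in> L" shows "dim (tangent_space S (\<Psi> x)) = dim L"
  unfolding tangent_space_eq[OF assms]
proof (rule dim_image_eq[OF linear_D\<Psi>[OF assms(1)]])
  show "inj_on (D\<Psi> x) (span L)"
    using D\<Phi>_D\<Psi>[OF assms] subspace_L by (metis inj_onI span_eq_iff)
qed

lemma D\<Phi>_tangent:
  assumes "x \<in> V" "x \<in> L" "v \<in> tangent_space S (\<Psi> x)"
  shows "D\<Phi> (\<Psi> x) v \<in> L" "D\<Psi> x (D\<Phi> (\<Psi> x) v) = v"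
  using assms D\<Phi>_D\<Psi>[OF assms(1,2)] by (auto simp: tangent_space_eq)

text \<open>Coordinate fields with constant coefficients take any prescribed tangent value at \<Psi>
  x, so they provide the extension demanded by \<open>second_fundamental_form\<close>.\<close>

lemma tangent_field_D\<Psi>:
  assumes x: "x \<in> V" "x \<in> L" and "c \<in> L"
  shows "tangent_field_near S (\<Psi> x) (\<lambda>q. D\<Psi> (\<Phi> q) c)"
  unfolding tangent_field_near_def
proof (intro exI conjI ballI)
  let ?W = "W \<inter> \<Phi> -` V"
  show o: "open ?W" by (rule continuous_open_preimage[OF smooth_on_continuous[OF smooth_\<Phi>] open_W open_V])
  show "\<Psi> x \<in> ?W" using \<Psi>_in[OF x] x by simp
  show "smooth_on (\<lambda>q. D\<Psi> (\<Phi> q) c) ?W"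
    by (rule smooth_on_compose[OF o open_V _ smooth_on_deriv[OF smooth_\<Psi>] smooth_on_subset[OF smooth_\<Phi>]]) auto
  fix q assume q: "q \<in> S \<inter> ?W"
  then show "D\<Psi> (\<Phi> q) c \<in> tangent_space S q"
    using tangent_space_eq[of "\<Phi> q"] \<Phi>_in[of q] \<Psi>_\<Phi>[of q] \<open>c \<in> L\<close> by auto
qed

text \<open>In the chart X is D\<Psi> applied to the coefficient C = D\<Phi>(X), which stays in L
  along the slice. The product rule yields a second derivative of \<Psi> plus D\<Psi> of a vector of
  L. Modulo the tangent space the derivative of X thus depends only on the value of X at the point,
  which is why the second fundamental form is well defined.\<close>

lemma frechet_derivative_tangent_field:
  assumes x: "x \<in> V" "x \<in> L" and "b \<in> L" and X: "tangent_field_near S (\<Psi> x) X"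
  shows "frechet_derivative X (at (\<Psi> x)) (D\<Psi> x b) - deriv2 \<Psi> x b (D\<Phi> (\<Psi> x) (X (\<Psi> x))) \<in> tangent_space S (\<Psi> x)"
proof -
  obtain W' where W': "open W'" "\<Psi> x \<in> W'" "smooth_on X W'" "\<And>q. q \<in> S \<Longrightarrow> q \<in> W' \<Longrightarrow> X q \<in> tangent_space S q"
    using X unfolding tangent_field_near_def by blast
  define U where "U = W \<inter> W'"
  have U: "open U" "\<Psi> x \<in> U" "smooth_on X U" "smooth_on \<Phi> U"
    using W' open_W \<Psi>_in(2)[OF x] smooth_\<Phi> by (auto simp: U_def intro: smooth_on_subset)
  define C where "C q = D\<Phi> q (X q)" for q
  have "smooth_on C U" unfolding C_def by (rule smooth_on_frechet_apply[OF U(1,4,3)])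
  then have C': "(C has_derivative frechet_derivative C (at (\<Psi> x))) (at (\<Psi> x))"
    using smooth_on_has_derivative U(2) by blast
  define c where "c t = C (\<Psi> (x + t *\<^sub>R b))" for t
  define c' where "c' = frechet_derivative C (at (\<Psi> x)) (D\<Psi> x b)"
  have c': "(c has_vector_derivative c') (at 0)"
    unfolding c_def c'_def by (rule has_vector_derivative_\<Psi>_comp[OF x(1) C'])
  have "open (V \<inter> \<Psi> -` U)"
    by (rule continuous_open_preimage[OF smooth_on_continuous[OF smooth_\<Psi>] open_V U(1)])
  then have "open ((\<lambda>t. x + t *\<^sub>R b) -` (V \<inter> \<Psi> -` U))"
    by (intro open_vimage continuous_intros)
  moreover have "0 \<in> (\<lambda>t. x + t *\<^sub>R b) -` (V \<inter> \<Psi> -` U)" using x U by simp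
  ultimately obtain r where r: "0 < r" "ball 0 r \<subseteq> (\<lambda>t. x + t *\<^sub>R b) -` (V \<inter> \<Psi> -` U)" by (rule openE)
  have y: "x + t *\<^sub>R b \<in> V" "\<Psi> (x + t *\<^sub>R b) \<in> W'" "x + t *\<^sub>R b \<in> L" if "\<bar>t\<bar> < r" for t
    using r(2) that line_in_L[OF x(2) \<open>b \<in> L\<close>] by (auto simp: subset_iff U_def)
  have Xt: "X (\<Psi> (x + t *\<^sub>R b)) \<in> tangent_space S (\<Psi> (x + t *\<^sub>R b))" if "\<bar>t\<bar> < r" for t
    using W'(4) y[OF that] \<Psi>_in(1) by blast
  have c'L: "c' \<in> L"
    by (rule has_vector_derivative_in_subspace[OF subspace_L c' r(1)])
       (use D\<Phi>_tangent(1) y Xt in \<open>auto simp: c_def C_def\<close>)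
  have "((\<lambda>t. X (\<Psi> (x + t *\<^sub>R b))) has_vector_derivative frechet_derivative X (at (\<Psi> x)) (D\<Psi> x b)) (at 0)"
    by (rule has_vector_derivative_\<Psi>_comp[OF x(1) smooth_on_has_derivative[OF W'(3,2)]])
  moreover have "((\<lambda>t. X (\<Psi> (x + t *\<^sub>R b))) has_vector_derivative deriv2 \<Psi> x b (c 0) + D\<Psi> x c') (at 0)"
  proof (rule has_vector_derivative_transform_within_open[OF
        has_vector_derivative_frechet_apply[OF open_V smooth_\<Psi> x(1) c'], of "{-r<..<r}"])
    show "D\<Psi> (x + t *\<^sub>R b) (c t) = X (\<Psi> (x + t *\<^sub>R b))" if "t \<in> {-r<..<r}" for t
      using D\<Phi>_tangent(2) y Xt that by (auto simp: c_def C_def abs_less_iff)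
  qed (use r in auto)
  ultimately have "frechet_derivative X (at (\<Psi> x)) (D\<Psi> x b) = deriv2 \<Psi> x b (c 0) + D\<Psi> x c'"
    by (rule vector_derivative_unique_at)
  then show ?thesis using c'L by (simp add: c_def C_def tangent_space_eq[OF x])
qed

end

section \<open>Extrinsic geometry in charts of submanifolds of the hyperboloid\<close>

lemma tangent_space_mono: "S \<subseteq> S' \<Longrightarrow> tangent_space S p \<subseteq> tangent_space S' p"
  unfolding tangent_space_def by fast

lemma hyp_proj_perp: "p \<in> hyp \<Longrightarrow> lor (hyp_proj p w) p = 0"
  by (simp add: hyp_proj_def lor_simps hypD(1))

locale hyp_chart = slice_chart S W V \<Phi> \<Psi> L
  for S :: "'n::finite minkowski set" and W and V :: "'c::euclidean_space set" and \<Phi> \<Psi> L +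
  assumes S_hyp: "S \<subseteq> hyp"
begin

lemma \<Psi>_hyp: "x \<in> V \<Longrightarrow> x \<in> L \<Longrightarrow> \<Psi> x \<in> hyp"
  using \<Psi>_in S_hyp by blast

lemma tangent_perp:
  assumes "x \<in> V" "x \<in> L" "v \<in> tangent_space S (\<Psi> x)" shows "lor v (\<Psi> x) = 0"
  using tangent_space_mono[OF S_hyp] tangent_space_hyp[OF \<Psi>_hyp[OF assms(1,2)]] assms(3) by blast

lemma lor_positive_tangent: "x \<in> V \<Longrightarrow> x \<in> L \<Longrightarrow> lor_positive (tangent_space S (\<Psi> x))"
  by (rule lor_positive_perp_subset[OF \<Psi>_hyp subspace_tangent_space tangent_perp])

text \<open>Here the definite description in \<open>normal_part\<close> is resolved: w minus its
  Lorentz projection is the only admissible vector.\<close>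

lemma normal_part:
  assumes x: "x \<in> V" "x \<in> L" and w: "lor w (\<Psi> x) = 0"
  shows "w - normal_part S (\<Psi> x) w \<in> tangent_space S (\<Psi> x)"
proof -
  let ?T = "tangent_space S (\<Psi> x)" and ?p = "\<Psi> x"
  note T = lor_positive_tangent[OF x]
  have sT: "subspace ?T" by (rule subspace_tangent_space[OF x])
  let ?z = "w - lor_proj ?T w"
  have "normal_part S ?p w = ?z"
    unfolding normal_part_def
  proof (rule the_equality)
    have "lor ?z ?p = 0" using w tangent_perp[OF x lor_proj_in[OF T]] by (simp add: lor_simps)
    then show "?z \<in> normal_space S ?p \<and> w - ?z \<in> ?T"
      using lor_proj_perp[OF T] lor_proj_in[OF T] by (simp add: normal_space_def tangent_space_hyp[OF \<Psi>_hyp[OF x]])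
    fix z assume z: "z \<in> normal_space S ?p \<and> w - z \<in> ?T"
    have "lor_proj ?T w = w - z"
      by (rule lor_proj_unique[OF T]) (use z in \<open>auto simp: normal_space_def\<close>)
    then show "z = ?z" by simp
  qed
  then show ?thesis using lor_proj_in[OF T] by simp
qed

lemma normal_part_cong:
  assumes x: "x \<in> V" "x \<in> L" and w: "w - w' \<in> tangent_space S (\<Psi> x)"
  shows "normal_part S (\<Psi> x) w = normal_part S (\<Psi> x) w'"
proof -
  have sT: "subspace (tangent_space S (\<Psi> x))" by (rule subspace_tangent_space[OF x])
  have "w - z \<in> tangent_space S (\<Psi> x) \<longleftrightarrow> w' - z \<in> tangent_space S (\<Psi> x)" for z
    using subspace_add[OF sT w, of "w' - z"] subspace_diff[OF sT _ w, of "w - z"] by auto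
  then show ?thesis unfolding normal_part_def by simp
qed

text \<open>By \<open>frechet_derivative_tangent_field\<close> all extensions of D\<Psi> x c have
  the same normal part of the derivative, and a coordinate field shows that an extension exists;
  together this resolves the definite description.\<close>

lemma second_fundamental_form_eq:
  assumes x: "x \<in> V" "x \<in> L" and "b \<in> L" "c \<in> L"
  shows "second_fundamental_form S (\<Psi> x) (D\<Psi> x b) (D\<Psi> x c) = normal_part S (\<Psi> x) (hyp_proj (\<Psi> x) (deriv2 \<Psi> x b c))"
proof -
  let ?p = "\<Psi> x"
  have *: "normal_part S ?p (hyp_nabla ?p (D\<Psi> x b) X) = normal_part S ?p (hyp_proj ?p (deriv2 \<Psi> x b c))"
    if X: "tangent_field_near S ?p X" "X ?p = D\<Psi> x c" for X
  proof (rule normal_part_cong[OF x])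
    let ?t = "frechet_derivative X (at ?p) (D\<Psi> x b) - deriv2 \<Psi> x b c"
    have t: "?t \<in> tangent_space S ?p"
      using frechet_derivative_tangent_field[OF x assms(3) X(1)] X(2) D\<Phi>_D\<Psi>[OF x assms(4)] by simp
    have "hyp_nabla ?p (D\<Psi> x b) X - hyp_proj ?p (deriv2 \<Psi> x b c) = ?t + lor ?t ?p *\<^sub>R ?p"
      by (simp add: hyp_nabla_def hyp_proj_def lor_simps algebra_simps)
    then show "hyp_nabla ?p (D\<Psi> x b) X - hyp_proj ?p (deriv2 \<Psi> x b c) \<in> tangent_space S ?p"
      using t tangent_perp[OF x t] by simp
  qed
  have "D\<Psi> (\<Phi> ?p) c = D\<Psi> x c" using \<Psi>_in(3)[OF x] by simp
  then have ex: "\<exists>X. tangent_field_near S ?p X \<and> X ?p = D\<Psi> x c"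
    using tangent_field_D\<Psi>[OF x assms(4)] by (intro exI[of _ "\<lambda>q. D\<Psi> (\<Phi> q) c"]) simp
  show ?thesis
    unfolding second_fundamental_form_def
  proof (rule the_equality)
    show "\<exists>X. tangent_field_near S ?p X \<and> X ?p = D\<Psi> x c \<and>
        normal_part S ?p (hyp_proj ?p (deriv2 \<Psi> x b c)) = normal_part S ?p (hyp_nabla ?p (D\<Psi> x b) X)"
      using ex * by metis
  qed (use * in metis)
qed

text \<open>Obtained by differentiating <D\<Psi> c, \<Psi>> = 0 in direction b. It identifies the
  component along the position vector that \<open>hyp_proj\<close> removes.\<close>

lemma lor_deriv2:
  assumes x: "x \<in> V" "x \<in> L" and "b \<in> L" "c \<in> L"
  shows "lor (deriv2 \<Psi> x b c) (\<Psi> x) = - lor (D\<Psi> x b) (D\<Psi> x c)"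
proof -
  obtain e where e: "0 < e" "\<And>t. \<bar>t\<bar> < e \<Longrightarrow> x + t *\<^sub>R b \<in> V" using line_in_V[OF x(1)] by blast
  have "((\<lambda>t. lor (D\<Psi> (x + t *\<^sub>R b) c) (\<Psi> (x + t *\<^sub>R b))) has_vector_derivative
     lor (D\<Psi> (x + 0 *\<^sub>R b) c) (D\<Psi> x b) + lor (deriv2 \<Psi> x b c) (\<Psi> (x + 0 *\<^sub>R b))) (at 0)"
    by (intro lor.has_vector_derivative \<Psi>_line[OF x(1)]
         has_derivative_along_line[OF has_derivative_deriv2[OF smooth_\<Psi> x(1)]])
  moreover have "((\<lambda>t. lor (D\<Psi> (x + t *\<^sub>R b) c) (\<Psi> (x + t *\<^sub>R b))) has_vector_derivative 0) (at 0)"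
  proof (rule has_vector_derivative_transform_within_open[OF has_vector_derivative_const, of "{-e<..<e}"])
    show "0 = lor (D\<Psi> (x + t *\<^sub>R b) c) (\<Psi> (x + t *\<^sub>R b))" if "t \<in> {-e<..<e}" for t
    proof -
      have y: "x + t *\<^sub>R b \<in> V" "x + t *\<^sub>R b \<in> L"
        using e(2)[of t] that line_in_L[OF x(2) assms(3)] by (auto simp: abs_less_iff)
      have "D\<Psi> (x + t *\<^sub>R b) c \<in> tangent_space S (\<Psi> (x + t *\<^sub>R b))"
        using tangent_space_eq[OF y] assms(4) by blast
      then show ?thesis using tangent_perp[OF y] by simp
    qed
  qed (use e in auto)
  ultimately have "lor (D\<Psi> (x + 0 *\<^sub>R b) c) (D\<Psi> x b) + lor (deriv2 \<Psi> x b c) (\<Psi> (x + 0 *\<^sub>R b)) = 0"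
    by (rule vector_derivative_unique_at)
  then show ?thesis by (simp add: lor_commute)
qed

text \<open>The Gauss formula with vanishing second fundamental form. Second derivatives of \<Psi>
  are then combinations of first derivatives and of \<Psi> itself, so these form a closed linear
  first order system.\<close>

lemma totally_geodesic_deriv2:
  assumes "totally_geodesic S" and x: "x \<in> V" "x \<in> L" and "b \<in> L" "c \<in> L"
  shows "deriv2 \<Psi> x b c - lor (D\<Psi> x b) (D\<Psi> x c) *\<^sub>R \<Psi> x \<in> tangent_space S (\<Psi> x)"
proof -
  have "second_fundamental_form S (\<Psi> x) (D\<Psi> x b) (D\<Psi> x c) = 0"
    using assms(1,4,5) \<Psi>_in(1)[OF x] tangent_space_eq[OF x] unfolding totally_geodesic_def by blast
  then show ?thesis
    using normal_part[OF x hyp_proj_perp[OF \<Psi>_hyp[OF x]], of "deriv2 \<Psi> x b c"]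
      second_fundamental_form_eq[OF x assms(4,5)] lor_deriv2[OF x assms(4,5)]
    by (simp add: hyp_proj_def)
qed

text \<open>For a unit vector e, \<open>hyp_proj\<close> subtracts exactly one copy of \<Psi> x, and
  the basis has dim L elements. A vanishing sum of normal parts leaves a sum of tangential
  parts.\<close>

lemma mean_curvature_zero_deriv2:
  assumes x: "x \<in> V" "x \<in> L" and mc: "mean_curvature S (\<Psi> x) = 0"
  defines "B \<equiv> (SOME B. orthonormal_basis (tangent_space S (\<Psi> x)) B)"
  shows "(\<Sum>e\<in>B. deriv2 \<Psi> x (D\<Phi> (\<Psi> x) e) (D\<Phi> (\<Psi> x) e)) - real (dim L) *\<^sub>R \<Psi> x \<in> tangent_space S (\<Psi> x)"
proof -
  let ?p = "\<Psi> x" and ?T = "tangent_space S (\<Psi> x)"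
  note T = lor_positive_tangent[OF x]
  have B: "orthonormal_basis ?T B" unfolding B_def by (rule orthonormal_basis_some[OF T])
  define w where "w e = hyp_proj ?p (deriv2 \<Psi> x (D\<Phi> ?p e) (D\<Phi> ?p e))" for e
  have e: "e \<in> ?T" "lor e e = 1" if "e \<in> B" for e using B that by (auto simp: orthonormal_basis_def)
  have w: "w e = deriv2 \<Psi> x (D\<Phi> ?p e) (D\<Phi> ?p e) - ?p" if "e \<in> B" for e
    using lor_deriv2[OF x D\<Phi>_tangent(1)[OF x e(1)[OF that]] D\<Phi>_tangent(1)[OF x e(1)[OF that]]]
      D\<Phi>_tangent(2)[OF x e(1)[OF that]] e(2)[OF that] by (simp add: w_def hyp_proj_def)
  have II: "second_fundamental_form S ?p e e = normal_part S ?p (w e)" if "e \<in> B" for e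
    using second_fundamental_form_eq[OF x D\<Phi>_tangent(1)[OF x e(1)[OF that]] D\<Phi>_tangent(1)[OF x e(1)[OF that]]]
      D\<Phi>_tangent(2)[OF x e(1)[OF that]] by (simp add: w_def)
  have "(\<Sum>e\<in>B. normal_part S ?p (w e)) = 0"
    using mc II unfolding mean_curvature_def B_def[symmetric] by simp
  then have "(\<Sum>e\<in>B. w e) = (\<Sum>e\<in>B. w e - normal_part S ?p (w e))" by (simp add: sum_subtractf)
  also have "\<dots> \<in> ?T"
    unfolding w_def by (intro subspace_sum[OF subspace_tangent_space[OF x]] normal_part[OF x] hyp_proj_perp \<Psi>_hyp x)
  also have "(\<Sum>e\<in>B. w e) = (\<Sum>e\<in>B. deriv2 \<Psi> x (D\<Phi> ?p e) (D\<Phi> ?p e)) - real (card B) *\<^sub>R ?p"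
    by (simp add: w sum_subtractf scaleR_conv_of_real sum_constant_scaleR)
  finally show ?thesis
    using orthonormal_basis_card[OF B] dim_tangent_space[OF x] by simp
qed

end

section \<open>Charts at every point of a submanifold\<close>

lemma submanifold_slice_chart:
  fixes S :: "'a::euclidean_space set"
  assumes "submanifold m S" "p \<in> S"
  obtains W and V :: "'a set" and \<Phi> \<Psi> L where "p \<in> W" "slice_chart S W V \<Phi> \<Psi> L" "dim L = m"
  using bspec[OF assms(1)[unfolded submanifold_def] assms(2)]
  apply (elim exE conjE)
  subgoal for W V \<Phi> \<Psi> L
    by (rule that[of W V \<Phi> \<Psi> L]) (auto simp: slice_chart_def homeomorphism_apply1)
  done

text \<open>The subspace L of a slice chart is identified with \<open>real^'k\<close> by linear maps
  f and g, so that L becomes UNIV and Lebesgue measure is available on the coordinates.\<close>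

lemma submanifold_parametrization:
  fixes S :: "'a::euclidean_space set"
  assumes "submanifold CARD('k::finite) S" "p \<in> S"
  obtains W V \<Phi> \<Psi> where "p \<in> W" "slice_chart S W V \<Phi> \<Psi> (UNIV :: (real^'k) set)"
proof -
  obtain W V \<Phi> \<Psi> L where c: "p \<in> W" "slice_chart S W V \<Phi> \<Psi> (L :: 'a set)" "dim L = CARD('k)"
    using submanifold_slice_chart[OF assms] .
  interpret slice_chart S W V \<Phi> \<Psi> L by (rule c(2))
  obtain f :: "real^'k \<Rightarrow> 'a" and g where fg: "linear f" "linear g" "f ` UNIV = L" "g ` L = UNIV"
      "\<And>x. g (f x) = x" "\<And>y. y \<in> L \<Longrightarrow> f (g y) = y"
    using isometries_subspaces[OF subspace_UNIV subspace_L, where ?'a = "real^'k"] c(3)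
    by (auto simp: dim_UNIV) metis
  have cf: "continuous_on UNIV f" using fg(1) by (simp add: linear_continuous_on linear_conv_bounded_linear)
  have "slice_chart S W (f -` V) (\<lambda>q. g (\<Phi> q)) (\<lambda>u. \<Psi> (f u)) UNIV"
  proof
    show o: "open (f -` V)" by (rule open_vimage[OF open_V cf])
    show "smooth_on (\<lambda>q. g (\<Phi> q)) W"
      by (rule smooth_on_compose[OF open_W open_UNIV _ smooth_on_linear[OF open_UNIV fg(2)] smooth_\<Phi>]) simp
    show "smooth_on (\<lambda>u. \<Psi> (f u)) (f -` V)"
      by (rule smooth_on_compose[OF o open_V _ smooth_\<Psi> smooth_on_linear[OF o fg(1)]]) simp
    show "(\<lambda>q. g (\<Phi> q)) ` (S \<inter> W) = f -` V \<inter> UNIV"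
    proof -
      have "(\<lambda>q. g (\<Phi> q)) ` (S \<inter> W) = g ` (V \<inter> L)" using image_\<Phi> by (metis image_image)
      also have "\<dots> = f -` V" using fg by (auto simp: image_iff) (metis Int_iff rangeI)
      finally show ?thesis by simp
    qed
    show "\<Psi> (f (g (\<Phi> q))) = q" if "q \<in> S" "q \<in> W" for q
      using fg(6) \<Phi>_in(2)[OF that] \<Psi>_\<Phi>[OF that] by simp
  qed (use open_W in auto)
  then show ?thesis using that c(1) by blast
qed

section \<open>Totally geodesic hyperplanes\<close>

lemma mvt_segment:
  fixes F :: "'a::real_normed_vector \<Rightarrow> real"
  assumes F: "\<And>s. 0 \<le> s \<Longrightarrow> s \<le> 1 \<Longrightarrow> (F has_derivative F' (x + s *\<^sub>R b)) (at (x + s *\<^sub>R b))"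
  obtains s where "0 < s" "s < 1" "F (x + b) - F x = F' (x + s *\<^sub>R b) b"
proof -
  have *: "((\<lambda>u. F (x + u *\<^sub>R b)) has_real_derivative F' (x + u *\<^sub>R b) b) (at u)" if "0 \<le> u" "u \<le> 1" for u
  proof -
    have a: "((\<lambda>u. x + u *\<^sub>R b) has_derivative (\<lambda>h. h *\<^sub>R b)) (at u)"
      by (auto intro!: derivative_eq_intros)
    have l: "linear (F' (x + u *\<^sub>R b))" using F[OF that] has_derivative_linear by blast
    show ?thesis unfolding has_field_derivative_def
      by (rule has_derivative_eq_rhs[OF has_derivative_compose[OF a F[OF that]]])
         (auto simp: linear_scale[OF l])
  qed
  obtain s where "0 < s" "s < 1" "F (x + 1 *\<^sub>R b) - F (x + 0 *\<^sub>R b) = (1 - 0) * F' (x + s *\<^sub>R b) b"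
    using MVT2[of 0 1 "\<lambda>u. F (x + u *\<^sub>R b)", OF _ *] by auto
  then show ?thesis using that by simp
qed

lemma orthonormal_expansion:
  fixes B :: "'a::euclidean_space set"
  assumes "pairwise orthogonal B" "\<And>e. e \<in> B \<Longrightarrow> norm e = 1" "finite B" "c \<in> span B"
  shows "(\<Sum>e\<in>B. (c \<bullet> e) *\<^sub>R e) = c"
proof -
  define w where "w = c - (\<Sum>e\<in>B. (c \<bullet> e) *\<^sub>R e)"
  have wB: "w \<in> span B" unfolding w_def using assms(4)
    by (intro span_diff span_sum span_scale) (auto intro: span_base)
  have "w \<bullet> f = 0" if "f \<in> B" for f
  proof -
    have "(\<Sum>e\<in>B. (c \<bullet> e) *\<^sub>R e) \<bullet> f = (\<Sum>e\<in>B. (c \<bullet> e) * (e \<bullet> f))" by (simp add: inner_sum_left)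
    also have "\<dots> = (\<Sum>e\<in>B. if e = f then c \<bullet> e else 0)"
      using assms(1,2) that
      by (intro sum.cong) (auto simp: pairwise_def orthogonal_def norm_eq_1)
    also have "\<dots> = c \<bullet> f" using assms(3) that by simp
    finally show ?thesis by (simp add: w_def inner_diff_left)
  qed
  then have "orthogonal w w" using wB by (intro orthogonal_to_span[of w B w]) (auto simp: orthogonal_def)
  then show ?thesis by (simp add: orthogonal_self w_def)
qed

section \<open>Contact of a totally geodesic submanifold with a linear hyperplane\<close>

context hyp_chart
begin

text \<open>First order contact with the hyperplane orthogonal to \<nu>. Including the tangent space
  makes the condition a full set of zero initial values for the linear system of
  \<open>totally_geodesic_deriv2\<close>.\<close>

definition flat_at :: "'n minkowski \<Rightarrow> 'c \<Rightarrow> bool" where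
  "flat_at \<nu> x \<longleftrightarrow> lor (\<Psi> x) \<nu> = 0 \<and> (\<forall>b\<in>L. lor (D\<Psi> x b) \<nu> = 0)"

lemma continuous_D\<Psi>: "continuous_on V (\<lambda>x. D\<Psi> x b)"
  by (rule smooth_on_continuous[OF smooth_on_deriv[OF smooth_\<Psi>]])

lemma continuous_deriv2: "continuous_on V (\<lambda>x. deriv2 \<Psi> x b c)"
  unfolding deriv2_def by (rule smooth_on_continuous[OF smooth_on_deriv[OF smooth_on_deriv[OF smooth_\<Psi>]]])

lemma continuous_\<Psi>: "continuous_on V \<Psi>"
  by (rule smooth_on_continuous[OF smooth_\<Psi>])

lemma continuous_D\<Phi>_apply:
  assumes "K \<subseteq> V \<inter> L" "continuous_on K X"
  shows "continuous_on K (\<lambda>x. D\<Phi> (\<Psi> x) (X x))"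
proof -
  have KW: "\<Psi> x \<in> W" if "x \<in> K" for x using assms(1) \<Psi>_in(2) that by blast
  have "continuous_on K (\<lambda>x. \<Sum>j\<in>Basis. (X x \<bullet> j) *\<^sub>R D\<Phi> (\<Psi> x) j)"
    using assms KW by (intro continuous_intros continuous_on_compose2[OF smooth_on_continuous[OF smooth_on_deriv[OF smooth_\<Phi>]]]
       continuous_on_subset[OF continuous_\<Psi>]) auto
  then show ?thesis
    by (rule continuous_on_eq) (rule linear_Basis_expansion[OF linear_D\<Phi>[OF KW], symmetric])
qed

text \<open>The functions $\langle\Psi,\nu\rangle$ and $\langle D\Psi\,e,\nu\rangle$ satisfy a homogeneous
  linear first order system, so their size on a small ball around a common zero is at most half of itself.\<close>

lemma flat_at_nearby:
  assumes tg: "totally_geodesic S" and x0: "x0 \<in> V" "x0 \<in> L" and flat: "flat_at \<nu> x0"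
  shows "\<exists>\<rho>>0. \<forall>z. z \<in> L \<longrightarrow> dist x0 z < \<rho> \<longrightarrow> z \<in> V \<and> flat_at \<nu> z"
proof -
  obtain B where B: "B \<subseteq> L" "pairwise orthogonal B" "\<And>e. e \<in> B \<Longrightarrow> norm e = 1" "independent B" "span B = L"
    using orthonormal_basis_subspace[OF subspace_L] by metis
  have fB: "finite B" using B(4) independent_imp_finite by blast
  have expand: "(\<Sum>e\<in>B. (c \<bullet> e) *\<^sub>R e) = c" if "c \<in> L" for c
    by (rule orthonormal_expansion[OF B(2,3) fB]) (use that B(5) in auto)
  have le_norm: "\<bar>c \<bullet> e\<bar> \<le> norm c" if "e \<in> B" for c e
    using Cauchy_Schwarz_ineq2[of c e] B(3)[OF that] by simp
  define f where "f z = lor (\<Psi> z) \<nu>" for z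
  define F where "F z e = lor (D\<Psi> z e) \<nu>" for z e
  define m where "m z = \<bar>f z\<bar> + (\<Sum>e\<in>B. \<bar>F z e\<bar>)" for z
  define g where "g z b c = lor (D\<Psi> z b) (D\<Psi> z c)" for z b c
  \<comment> \<open>The coordinates in L of the tangential part of the second derivative, in effect
    the Christoffel symbols. Together with g they are the coefficients of the linear system for f
    and F.\<close>
  define G where "G z b c = D\<Phi> (\<Psi> z) (deriv2 \<Psi> z b c - g z b c *\<^sub>R \<Psi> z)" for z b c
  obtain r where r: "0 < r" "cball x0 r \<subseteq> V" using open_V x0(1) open_contains_cball by blast
  define K where "K = cball x0 r \<inter> L"
  have K: "compact K" "K \<subseteq> V \<inter> L" using r closed_subspace[OF subspace_L] by (auto simp: K_def compact_Int_closed)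
  have linF: "linear (F z)" if "z \<in> V" for z
    unfolding F_def by (intro linearI) (simp_all add: linear_add[OF linear_D\<Psi>[OF that]] linear_scale[OF linear_D\<Psi>[OF that]] lor_simps)
  have F_le: "\<bar>F z c\<bar> \<le> norm c * m z" if "z \<in> V" "c \<in> L" for z c
  proof -
    have "F z c = F z (\<Sum>e\<in>B. (c \<bullet> e) *\<^sub>R e)" using expand[OF that(2)] by simp
    also have "\<dots> = (\<Sum>e\<in>B. (c \<bullet> e) * F z e)"
      by (simp add: linear_sum[OF linF[OF that(1)]] linear_scale[OF linF[OF that(1)]])
    finally have "\<bar>F z c\<bar> \<le> (\<Sum>e\<in>B. \<bar>c \<bullet> e\<bar> * \<bar>F z e\<bar>)" by (simp add: sum_abs[THEN order_trans] abs_mult)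
    also have "\<dots> \<le> (\<Sum>e\<in>B. norm c * \<bar>F z e\<bar>)" by (intro sum_mono mult_right_mono le_norm) auto
    also have "\<dots> \<le> norm c * m z" by (simp add: m_def sum_distrib_left[symmetric] mult_left_mono)
    finally show ?thesis .
  qed
  have eqn: "lor (deriv2 \<Psi> z b c) \<nu> = F z (G z b c) + g z b c * f z" and G_L: "G z b c \<in> L"
    if "z \<in> V" "z \<in> L" "b \<in> L" "c \<in> L" for z b c
  proof -
    note t = totally_geodesic_deriv2[OF tg that]
    show "G z b c \<in> L" using D\<Phi>_tangent(1)[OF that(1,2) t] by (simp add: G_def g_def)
    have "D\<Psi> z (G z b c) = deriv2 \<Psi> z b c - g z b c *\<^sub>R \<Psi> z"
      using D\<Phi>_tangent(2)[OF that(1,2) t] by (simp add: G_def g_def)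
    then show "lor (deriv2 \<Psi> z b c) \<nu> = F z (G z b c) + g z b c * f z"
      by (simp add: F_def f_def lor_simps)
  qed
  define k where "k z = (\<Sum>b\<in>B. \<Sum>c\<in>B. norm (G z b c) + \<bar>g z b c\<bar>)" for z
  have contg: "continuous_on K (\<lambda>z. g z b c)" for b c
    unfolding g_def using K(2) by (intro lor.continuous_on continuous_on_subset[OF continuous_D\<Psi>]) auto
  have contG: "continuous_on K (\<lambda>z. G z b c)" for b c
    unfolding G_def using K(2)
    by (intro continuous_D\<Phi>_apply continuous_intros contg continuous_on_subset[OF continuous_deriv2] continuous_on_subset[OF continuous_\<Psi>]) auto
  have "continuous_on K k" unfolding k_def by (intro continuous_intros contg contG)
  then have "compact (k ` K)" using K(1) by (rule compact_continuous_image)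
  then obtain C where C: "\<And>z. z \<in> K \<Longrightarrow> \<bar>k z\<bar> \<le> C"
    using compact_imp_bounded bounded_iff by (metis image_eqI real_norm_def)
  have "x0 \<in> K" using x0 r by (simp add: K_def)
  then have "0 \<le> C" using C[of x0] by force
  \<comment> \<open>With C bounding the coefficients, the mean value theorem over a distance \<rho>
    costs a factor of at most \<rho> * (1 + card B * C), and the radius makes this at most
    1/2.\<close>
  define \<rho> where "\<rho> = min r (1 / (2 * (1 + card B * C)))"
  have pos: "0 < 1 + card B * C" using \<open>0 \<le> C\<close> by (simp add: add_pos_nonneg)
  have \<rho>: "0 < \<rho>" "\<rho> \<le> r" "\<rho> * (1 + card B * C) \<le> 1 / 2"
  proof -
    show "0 < \<rho>" "\<rho> \<le> r" using r pos by (auto simp: \<rho>_def)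
    have "\<rho> * (1 + card B * C) \<le> 1 / (2 * (1 + card B * C)) * (1 + card B * C)"
      by (rule mult_right_mono) (use pos in \<open>auto simp: \<rho>_def\<close>)
    also have "\<dots> = 1 / 2" using pos by (simp add: field_simps)
    finally show "\<rho> * (1 + card B * C) \<le> 1 / 2" .
  qed
  define K' where "K' = cball x0 \<rho> \<inter> L"
  have K': "compact K'" "K' \<subseteq> K" using closed_subspace[OF subspace_L] \<rho> by (auto simp: K'_def K_def compact_Int_closed)
  have "x0 \<in> K'" using x0 \<rho>(1) by (simp add: K'_def)
  then have K'ne: "K' \<noteq> {}" by blast
  have "continuous_on K' m"
    unfolding m_def f_def F_def using K' K(2)
    by (intro continuous_intros lor.continuous_on continuous_on_subset[OF continuous_D\<Psi>] continuous_on_subset[OF continuous_\<Psi>]) auto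
  \<comment> \<open>At a maximum point z of m the estimate reads m z <= m z / 2, so m vanishes on
    the whole of K'.\<close>
  then obtain z where z: "z \<in> K'" "\<And>y. y \<in> K' \<Longrightarrow> m y \<le> m z"
    using continuous_attains_sup[OF K'(1) K'ne] by blast
  define b where "b = z - x0"
  have bL: "b \<in> L" using z(1) x0 subspace_L by (auto simp: b_def K'_def subspace_diff)
  have nb: "norm b \<le> \<rho>" using z(1) by (simp add: b_def K'_def dist_norm norm_minus_commute)
  have seg: "x0 + s *\<^sub>R b \<in> K'" if "0 \<le> s" "s \<le> 1" for s
  proof -
    have "norm (s *\<^sub>R b) \<le> \<rho>" using mult_mono[OF that(2) nb] that nb by simp
    then have "x0 + s *\<^sub>R b \<in> cball x0 \<rho>" by (simp add: dist_norm)
    then show ?thesis using line_in_L[OF x0(2) bL] by (simp add: K'_def)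
  qed
  have segV: "x0 + s *\<^sub>R b \<in> V" "x0 + s *\<^sub>R b \<in> L" if "0 \<le> s" "s \<le> 1" for s
    using seg[OF that] K' K(2) by auto
  have mz: "0 \<le> m z" by (simp add: m_def sum_nonneg)
  have f1: "\<bar>f z\<bar> \<le> \<rho> * m z"
  proof -
    have "(f has_derivative (\<lambda>h. F (x0 + s *\<^sub>R b) h)) (at (x0 + s *\<^sub>R b))" if "0 \<le> s" "s \<le> 1" for s
      unfolding f_def F_def
      by (rule bounded_linear.has_derivative[OF lor.bounded_linear_left smooth_on_has_derivative[OF smooth_\<Psi> segV(1)[OF that]]])
    then obtain s where s: "0 < s" "s < 1" "f (x0 + b) - f x0 = F (x0 + s *\<^sub>R b) b"
      using mvt_segment[of f F x0 b] by metis
    have "\<bar>f z\<bar> = \<bar>F (x0 + s *\<^sub>R b) b\<bar>" using s(3) flat by (simp add: b_def flat_at_def f_def)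
    also have "\<dots> \<le> norm b * m (x0 + s *\<^sub>R b)" using F_le segV s bL by simp
    also have "\<dots> \<le> \<rho> * m z" using z(2)[OF seg, of s] s nb mz \<rho>(1) by (intro mult_mono) (auto simp: m_def sum_nonneg)
    finally show ?thesis .
  qed
  have F1: "\<bar>F z e\<bar> \<le> \<rho> * C * m z" if e: "e \<in> B" for e
  proof -
    have "((\<lambda>y. F y e) has_derivative (\<lambda>h. lor (deriv2 \<Psi> (x0 + s *\<^sub>R b) h e) \<nu>)) (at (x0 + s *\<^sub>R b))" if "0 \<le> s" "s \<le> 1" for s
      unfolding F_def
      by (rule bounded_linear.has_derivative[OF lor.bounded_linear_left has_derivative_deriv2[OF smooth_\<Psi> segV(1)[OF that]]])
    then obtain s where s: "0 < s" "s < 1" "F (x0 + b) e - F x0 e = lor (deriv2 \<Psi> (x0 + s *\<^sub>R b) b e) \<nu>"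
      using mvt_segment[of "\<lambda>y. F y e" "\<lambda>y h. lor (deriv2 \<Psi> y h e) \<nu>" x0 b] by metis
    define y where "y = x0 + s *\<^sub>R b"
    have y: "y \<in> V" "y \<in> L" "y \<in> K'" using segV[of s] seg[of s] s by (auto simp: y_def)
    have eL: "e \<in> L" using B(1) e by blast
    have "lor (deriv2 \<Psi> y b e) \<nu> = lor (deriv2 \<Psi> y (\<Sum>c\<in>B. (b \<bullet> c) *\<^sub>R c) e) \<nu>" using expand[OF bL] by simp
    also have "\<dots> = (\<Sum>c\<in>B. (b \<bullet> c) * lor (deriv2 \<Psi> y c e) \<nu>)"
      by (simp add: linear_sum[OF linear_deriv2_left[OF smooth_\<Psi> y(1)]] linear_scale[OF linear_deriv2_left[OF smooth_\<Psi> y(1)]]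
           lor.sum_left lor_simps)
    finally have "\<bar>F z e\<bar> \<le> (\<Sum>c\<in>B. \<bar>b \<bullet> c\<bar> * \<bar>lor (deriv2 \<Psi> y c e) \<nu>\<bar>)"
      using s(3) flat eL sum_abs[of "\<lambda>c. (b \<bullet> c) * lor (deriv2 \<Psi> y c e) \<nu>" B] by (simp add: y_def b_def flat_at_def F_def abs_mult)
    also have "\<dots> \<le> (\<Sum>c\<in>B. \<rho> * ((norm (G y c e) + \<bar>g y c e\<bar>) * m z))"
    proof (intro sum_mono mult_mono)
      fix c assume c: "c \<in> B"
      then have cL: "c \<in> L" using B(1) by blast
      show "\<bar>b \<bullet> c\<bar> \<le> \<rho>" using le_norm[OF c, of b] nb by linarith
      have "\<bar>lor (deriv2 \<Psi> y c e) \<nu>\<bar> \<le> \<bar>F y (G y c e)\<bar> + \<bar>g y c e\<bar> * \<bar>f y\<bar>"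
        unfolding eqn[OF y(1,2) cL eL] abs_mult[symmetric] by (rule abs_triangle_ineq)
      also have "\<dots> \<le> norm (G y c e) * m y + \<bar>g y c e\<bar> * m y"
        by (intro add_mono F_le y G_L cL eL mult_left_mono) (auto simp: m_def sum_nonneg)
      also have "\<dots> \<le> (norm (G y c e) + \<bar>g y c e\<bar>) * m z"
        using z(2)[OF y(3)] by (simp add: distrib_right add_mono mult_left_mono)
      finally show "\<bar>lor (deriv2 \<Psi> y c e) \<nu>\<bar> \<le> (norm (G y c e) + \<bar>g y c e\<bar>) * m z" .
    qed (use \<rho> in auto)
    also have "\<dots> = \<rho> * (\<Sum>c\<in>B. norm (G y c e) + \<bar>g y c e\<bar>) * m z"
      by (simp add: sum_distrib_left sum_distrib_right mult.assoc)
    also have "\<dots> \<le> \<rho> * C * m z"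
    proof (intro mult_right_mono mult_left_mono mz)
      have "(\<Sum>c\<in>B. norm (G y c e) + \<bar>g y c e\<bar>) \<le> (\<Sum>c\<in>B. \<Sum>c'\<in>B. norm (G y c c') + \<bar>g y c c'\<bar>)"
        using e fB by (intro sum_mono member_le_sum) auto
      also have "\<dots> \<le> C" using C[of y] y K' by (force simp: k_def)
      finally show "(\<Sum>c\<in>B. norm (G y c e) + \<bar>g y c e\<bar>) \<le> C" .
    qed (use \<rho> in auto)
    finally show ?thesis .
  qed
  have "m z = \<bar>f z\<bar> + (\<Sum>e\<in>B. \<bar>F z e\<bar>)" by (simp add: m_def)
  also have "\<dots> \<le> \<rho> * m z + (\<Sum>e\<in>B. \<rho> * C * m z)" by (intro add_mono f1 sum_mono F1)
  also have "\<dots> = (\<rho> * (1 + card B * C)) * m z" by (simp add: algebra_simps)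
  also have "\<dots> \<le> 1 / 2 * m z" by (intro mult_right_mono \<rho> mz)
  finally have "m z = 0" using mz by simp
  have "y \<in> V \<and> flat_at \<nu> y" if y: "y \<in> L" "dist x0 y < \<rho>" for y
  proof -
    have yK: "y \<in> K'" using y by (simp add: K'_def)
    then have yV: "y \<in> V" using K' K by auto
    have "m y = 0" using z(2)[OF yK] \<open>m z = 0\<close> by (simp add: m_def sum_nonneg add_nonneg_nonneg antisym)
    then have "\<bar>f y\<bar> = 0" by (simp add: m_def add_nonneg_eq_0_iff sum_nonneg)
    moreover have "F y c = 0" if "c \<in> L" for c using F_le[OF yV that] \<open>m y = 0\<close> by simp
    ultimately show ?thesis using yV by (simp add: flat_at_def f_def F_def)
  qed
  then show ?thesis using \<rho>(1) by blast
qed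

lemma not_flat_at_nearby:
  assumes x0: "x0 \<in> V" and "\<not> flat_at \<nu> x0"
  shows "\<exists>\<rho>>0. \<forall>z. dist x0 z < \<rho> \<longrightarrow> z \<in> V \<and> \<not> flat_at \<nu> z"
proof -
  obtain h where h: "continuous_on V h" "h x0 \<noteq> (0::real)" "\<And>z. h z \<noteq> 0 \<Longrightarrow> \<not> flat_at \<nu> z"
  proof (cases "lor (\<Psi> x0) \<nu> = 0")
    case False
    show ?thesis
      by (rule that[of "\<lambda>z. lor (\<Psi> z) \<nu>"])
         (use False in \<open>auto simp: flat_at_def intro!: lor.continuous_on continuous_\<Psi>\<close>)
  next
    case True
    then obtain b where "b \<in> L" "lor (D\<Psi> x0 b) \<nu> \<noteq> 0" using assms(2) by (auto simp: flat_at_def)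
    then show ?thesis
      by (intro that[of "\<lambda>z. lor (D\<Psi> z b) \<nu>"]) (auto simp: flat_at_def intro!: lor.continuous_on continuous_D\<Psi>)
  qed
  have "open (V \<inter> h -` (- {0}))" by (rule continuous_open_preimage[OF h(1) open_V]) auto
  moreover have "x0 \<in> V \<inter> h -` (- {0})" using x0 h by simp
  ultimately obtain \<rho> where "0 < \<rho>" "ball x0 \<rho> \<subseteq> V \<inter> h -` (- {0})" by (rule openE)
  then show ?thesis using h(3) by (intro exI[of _ \<rho>]) (auto simp: subset_iff)
qed

lemma flat_at_iff:
  assumes "x \<in> V" "x \<in> L"
  shows "flat_at \<nu> x \<longleftrightarrow> lor (\<Psi> x) \<nu> = 0 \<and> (\<forall>v\<in>tangent_space S (\<Psi> x). lor v \<nu> = 0)"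
  by (simp add: flat_at_def tangent_space_eq[OF assms])

lemma openin_chart_ball:
  assumes "x0 \<in> V" "x0 \<in> L" "0 < \<rho>"
  obtains Z where "openin (top_of_set S) Z" "\<Psi> x0 \<in> Z" "\<And>q. q \<in> Z \<Longrightarrow> q \<in> S \<and> q \<in> W \<and> dist x0 (\<Phi> q) < \<rho>"
proof (rule that)
  have "open (W \<inter> \<Phi> -` ball x0 \<rho>)"
    by (rule continuous_open_preimage[OF smooth_on_continuous[OF smooth_\<Phi>] open_W open_ball])
  then show "openin (top_of_set S) (S \<inter> (W \<inter> \<Phi> -` ball x0 \<rho>))" by (simp add: openin_open_Int)
  show "\<Psi> x0 \<in> S \<inter> (W \<inter> \<Phi> -` ball x0 \<rho>)" using \<Psi>_in[OF assms(1,2)] assms(3) by simp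
qed auto

end

section \<open>Hyperplanes as zero sets of linear functions, and the distance to them\<close>

lemma submanifold_hyp_chart:
  fixes S :: "'n::finite minkowski set"
  assumes "submanifold m S" "S \<subseteq> hyp" "p \<in> S"
  obtains W and V :: "'n minkowski set" and \<Phi> \<Psi> L where "p \<in> W" "hyp_chart S W V \<Phi> \<Psi> L" "dim L = m"
proof (rule submanifold_slice_chart[OF assms(1,3)])
  fix W and V :: "'n minkowski set" and \<Phi> \<Psi> L
  assume "p \<in> W" "slice_chart S W V \<Phi> \<Psi> L" "dim L = m"
  then show ?thesis using assms(2) by (intro that[of W V \<Phi> \<Psi> L] hyp_chart.intro hyp_chart_axioms.intro)
qed

text \<open>A unit vector \<nu> orthogonal to one point p of H and to its tangent space is fixed.
  The points of H with first order contact with the complement of \<nu> form an open set by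
  \<open>flat_at_nearby\<close>, the remaining points form an open set by continuity, and H is
  connected.\<close>

lemma totally_geodesic_in_hyperplane:
  fixes H :: "'n::finite minkowski set"
  assumes H: "totally_geodesic_hyperplane H"
  obtains \<nu> where "lor \<nu> \<nu> = 1" "\<And>p. p \<in> H \<Longrightarrow> lor p \<nu> = 0"
proof -
  have H': "H \<subseteq> hyp" "submanifold (CARD('n) - 1) H" "H \<noteq> {}" "connected H" "closed H" "totally_geodesic H"
    using H by (auto simp: totally_geodesic_hyperplane_def)
  obtain p where p: "p \<in> H" using H'(3) by blast
  obtain W0 V0 \<Phi>0 \<Psi>0 L0 where c0: "p \<in> W0" "hyp_chart H W0 V0 \<Phi>0 \<Psi>0 (L0 :: 'n minkowski set)" "dim L0 = CARD('n) - 1"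
    using submanifold_hyp_chart[OF H'(2,1) p] .
  interpret c0: hyp_chart H W0 V0 \<Phi>0 \<Psi>0 L0 by (rule c0(2))
  have "dim (tangent_space H p) = CARD('n) - 1"
    using c0.dim_tangent_space[OF c0.\<Phi>_in[OF p c0(1)]] c0.\<Psi>_\<Phi>[OF p c0(1)] c0(3) by simp
  \<comment> \<open>The dimension is at most CARD('n), one less than that of Minkowski space, so a
    nonzero normal vector is left.\<close>
  then have "dim (insert p (tangent_space H p)) < DIM('n minkowski)"
    using dim_insert[of p "tangent_space H p"] by (simp add: le_less_trans[of _ "CARD('n)"])
  then obtain w where w: "w \<noteq> 0" "\<And>y. y \<in> span (insert p (tangent_space H p)) \<Longrightarrow> orthogonal w y"
    using orthogonal_to_subspace_exists by blast
  \<comment> \<open>Reversing the time component turns Euclidean orthogonality to w into Lorentz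
    orthogonality to \<nu>0.\<close>
  define \<nu>0 where "\<nu>0 = (fst w, - snd w)"
  have \<nu>0: "\<nu>0 \<noteq> 0" "lor v \<nu>0 = 0" if "v \<in> insert p (tangent_space H p)" for v
  proof -
    show "\<nu>0 \<noteq> 0" using w(1) by (auto simp: \<nu>0_def prod_eq_iff)
    have "orthogonal w v" using w(2) that span_base by blast
    then show "lor v \<nu>0 = 0" by (simp add: lor_eq_inner \<nu>0_def orthogonal_def inner_commute)
  qed
  have n0: "0 < lor \<nu>0 \<nu>0"
    using lor_pos_on_perp[of p \<nu>0] \<nu>0[of p] p H'(1) lor_commute[of p \<nu>0] by auto
  define \<nu> where "\<nu> = (1 / sqrt (lor \<nu>0 \<nu>0)) *\<^sub>R \<nu>0"
  have \<nu>: "lor \<nu> \<nu> = 1" "\<And>v. v \<in> insert p (tangent_space H p) \<Longrightarrow> lor v \<nu> = 0"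
    using n0 \<nu>0(2) by (simp_all add: \<nu>_def lor_simps field_simps)
  define Z where "Z = {q\<in>H. lor q \<nu> = 0 \<and> (\<forall>v\<in>tangent_space H q. lor v \<nu> = 0)}"
  have "openin (top_of_set H) Z \<and> openin (top_of_set H) (H - Z)"
    unfolding openin_subopen[of _ Z] openin_subopen[of _ "H - Z"]
  proof (intro conjI ballI)
    fix q assume q: "q \<in> Z"
    then have qH: "q \<in> H" by (simp add: Z_def)
    obtain W V \<Phi> \<Psi> L where c: "q \<in> W" "hyp_chart H W V \<Phi> \<Psi> (L :: 'n minkowski set)"
      using submanifold_hyp_chart[OF H'(2,1) qH] by metis
    interpret hyp_chart H W V \<Phi> \<Psi> L by (rule c(2))
    note x = \<Phi>_in[OF qH c(1)]
    have "flat_at \<nu> (\<Phi> q)" using q flat_at_iff[OF x] \<Psi>_\<Phi>[OF qH c(1)] by (simp add: Z_def)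
    then obtain \<rho> where \<rho>: "\<rho> > 0" "\<And>z. z \<in> L \<Longrightarrow> dist (\<Phi> q) z < \<rho> \<Longrightarrow> z \<in> V \<and> flat_at \<nu> z"
      using flat_at_nearby[OF H'(6) x] by blast
    obtain T where T: "openin (top_of_set H) T" "\<Psi> (\<Phi> q) \<in> T" "\<And>y. y \<in> T \<Longrightarrow> y \<in> H \<and> y \<in> W \<and> dist (\<Phi> q) (\<Phi> y) < \<rho>"
      using openin_chart_ball[OF x \<rho>(1)] by blast
    have "y \<in> Z" if "y \<in> T" for y
      using \<rho>(2)[of "\<Phi> y"] T(3)[OF that] \<Phi>_in[of y] flat_at_iff[of "\<Phi> y"] \<Psi>_\<Phi>[of y] by (simp add: Z_def)
    then show "\<exists>T. openin (top_of_set H) T \<and> q \<in> T \<and> T \<subseteq> Z"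
      using T(1,2) \<Psi>_\<Phi>[OF qH c(1)] by auto
  next
    fix q assume q: "q \<in> H - Z"
    then have qH: "q \<in> H" by simp
    obtain W V \<Phi> \<Psi> L where c: "q \<in> W" "hyp_chart H W V \<Phi> \<Psi> (L :: 'n minkowski set)"
      using submanifold_hyp_chart[OF H'(2,1) qH] by metis
    interpret hyp_chart H W V \<Phi> \<Psi> L by (rule c(2))
    note x = \<Phi>_in[OF qH c(1)]
    have "\<not> flat_at \<nu> (\<Phi> q)" using q flat_at_iff[OF x] \<Psi>_\<Phi>[OF qH c(1)] by (auto simp: Z_def)
    then obtain \<rho> where \<rho>: "\<rho> > 0" "\<And>z. dist (\<Phi> q) z < \<rho> \<Longrightarrow> \<not> flat_at \<nu> z"
      using not_flat_at_nearby[OF x(1)] by blast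
    obtain T where T: "openin (top_of_set H) T" "\<Psi> (\<Phi> q) \<in> T" "\<And>y. y \<in> T \<Longrightarrow> y \<in> H \<and> y \<in> W \<and> dist (\<Phi> q) (\<Phi> y) < \<rho>"
      using openin_chart_ball[OF x \<rho>(1)] by blast
    have "y \<in> H - Z" if "y \<in> T" for y
      using \<rho>(2)[of "\<Phi> y"] T(3)[OF that] \<Phi>_in[of y] flat_at_iff[of "\<Phi> y"] \<Psi>_\<Phi>[of y] by (simp add: Z_def)
    then show "\<exists>T. openin (top_of_set H) T \<and> q \<in> T \<and> T \<subseteq> H - Z"
      using T(1,2) \<Psi>_\<Phi>[OF qH c(1)] by auto
  qed
  moreover have "Z \<subseteq> H" by (auto simp: Z_def)
  ultimately have "Z = {} \<or> Z = H"
    using H'(4) unfolding connected_clopen by (simp add: closedin_def)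
  moreover have "p \<in> Z" using p \<nu>(2) by (simp add: Z_def)
  ultimately have "Z = H" by blast
  then have "lor q \<nu> = 0" if "q \<in> H" for q using that unfolding Z_def by blast
  then show ?thesis by (rule that[OF \<nu>(1)])
qed

lemma dim_lor_orthogonal:
  fixes p \<nu> :: "'n::finite minkowski"
  assumes "p \<in> hyp" "lor \<nu> \<nu> = 1" "lor p \<nu> = 0"
  shows "dim {w. lor w p = 0 \<and> lor w \<nu> = 0} = CARD('n) - 1"
proof -
  let ?flip = "\<lambda>w::'n minkowski. (fst w, - snd w)"
  let ?A = "span {?flip p, ?flip \<nu>}"
  have perp: "(\<forall>x\<in>?A. orthogonal x y) \<longleftrightarrow> lor y p = 0 \<and> lor y \<nu> = 0" for y
  proof
    assume "\<forall>x\<in>?A. orthogonal x y"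
    then have "orthogonal (?flip p) y" "orthogonal (?flip \<nu>) y" by (auto intro: span_base)
    then show "lor y p = 0 \<and> lor y \<nu> = 0" by (simp add: lor_eq_inner orthogonal_def inner_commute)
  next
    assume "lor y p = 0 \<and> lor y \<nu> = 0"
    then have *: "orthogonal y x" if "x \<in> {?flip p, ?flip \<nu>}" for x
      using that by (auto simp: lor_eq_inner orthogonal_def)
    have "orthogonal y x" if "x \<in> ?A" for x by (rule orthogonal_to_span[OF that *])
    then show "\<forall>x\<in>?A. orthogonal x y" by (simp add: orthogonal_commute)
  qed
  have "?flip p \<noteq> 0" using hyp_snd_ge_1[OF assms(1)] by (auto simp: prod_eq_iff)
  moreover have "?flip \<nu> \<notin> span {?flip p}"
  proof
    assume "?flip \<nu> \<in> span {?flip p}"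
    then obtain c where "?flip \<nu> = c *\<^sub>R ?flip p" unfolding span_singleton by blast
    then have "\<nu> = c *\<^sub>R p" by (simp add: prod_eq_iff)
    then have "lor p \<nu> = - c" using hypD(1)[OF assms(1)] by (simp add: lor_simps)
    then show False using assms(2,3) \<open>\<nu> = c *\<^sub>R p\<close> by (simp add: lor_simps)
  qed
  ultimately have "dim ?A = 2" by (simp add: dim_insert dim_span insert_commute[of "?flip p"])
  then have "dim {y \<in> (UNIV :: 'n minkowski set). \<forall>x\<in>?A. orthogonal x y} + 2 = DIM('n minkowski)"
    using dim_subspace_orthogonal_to_vectors[of ?A "UNIV :: 'n minkowski set"] by simp
  then show ?thesis unfolding perp by simp
qed

text \<open>One inclusion is known. Projection along p identifies the zero set of <.,\<nu>> in
  \<open>hyp\<close> with the linear space K. The image of H in K is open by invariance of domain,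
  as the dimensions agree, and closed because H is closed; since K is connected, the image is all of
  K.\<close>

lemma totally_geodesic_hyperplane_eq:
  fixes H :: "'n::finite minkowski set"
  assumes H: "totally_geodesic_hyperplane H"
  obtains \<nu> where "lor \<nu> \<nu> = 1" "H = {p\<in>hyp. lor p \<nu> = 0}"
proof -
  have H': "H \<subseteq> hyp" "submanifold (CARD('n) - 1) H" "H \<noteq> {}" "closed H"
    using H by (auto simp: totally_geodesic_hyperplane_def)
  obtain \<nu> where \<nu>: "lor \<nu> \<nu> = 1" "\<And>p. p \<in> H \<Longrightarrow> lor p \<nu> = 0"
    using totally_geodesic_in_hyperplane[OF H] by blast
  obtain p where p: "p \<in> H" using H'(3) by blast
  then have ph: "p \<in> hyp" "lor p \<nu> = 0" using H'(1) \<nu>(2) by auto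
  define K where "K = {w. lor w p = 0 \<and> lor w \<nu> = 0}"
  have sK: "subspace K" by (auto simp: K_def subspace_def lor_simps)
  \<comment> \<open>The inverse of the projection: on the hyperboloid the coefficient of p is
    recovered from the component w as sqrt(1 + <w,w>).\<close>
  define \<sigma> where "\<sigma> w = w + sqrt (1 + lor w w) *\<^sub>R p" for w
  have \<pi>K: "hyp_proj p q \<in> K" if "q \<in> hyp" "lor q \<nu> = 0" for q
    using hyp_proj_perp[OF ph(1)] that ph by (simp add: K_def hyp_proj_def lor_simps)
  have \<sigma>\<pi>: "\<sigma> (hyp_proj p q) = q" if "q \<in> hyp" for q
  proof -
    have "lor (hyp_proj p q) (hyp_proj p q) = (lor q p)\<^sup>2 - 1"
      using hypD(1)[OF ph(1)] hypD(1)[OF that]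
      by (simp add: hyp_proj_def lor_simps lor_commute[of p q] power2_eq_square algebra_simps)
    then have "sqrt (1 + lor (hyp_proj p q) (hyp_proj p q)) = - lor q p"
      using lor_reverse_cauchy_schwarz[OF that ph(1)] by (simp add: real_sqrt_abs)
    then show ?thesis by (simp add: \<sigma>_def hyp_proj_def)
  qed
  have \<pi>\<sigma>: "hyp_proj p (\<sigma> w) = w" if "w \<in> K" for w
    using that hypD(1)[OF ph(1)] by (simp add: \<sigma>_def hyp_proj_def K_def lor_simps)
  have cont\<sigma>: "continuous_on UNIV \<sigma>"
    unfolding \<sigma>_def by (intro continuous_intros lor.continuous_on)
  have cont\<pi>: "continuous_on A (hyp_proj p)" for A
    unfolding hyp_proj_def by (intro continuous_intros lor.continuous_on)
  let ?P = "hyp_proj p ` H"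
  have "openin (top_of_set K) ?P"
    unfolding openin_subopen[of _ ?P]
  proof
    fix y assume "y \<in> ?P"
    then obtain q where q: "q \<in> H" "y = hyp_proj p q" by blast
    obtain W V \<Phi> \<Psi> L where c: "q \<in> W" "hyp_chart H W V \<Phi> \<Psi> (L :: 'n minkowski set)" "dim L = CARD('n) - 1"
      using submanifold_hyp_chart[OF H'(2,1) q(1)] .
    interpret hyp_chart H W V \<Phi> \<Psi> L by (rule c(2))
    have "openin (top_of_set K) ((\<lambda>x. hyp_proj p (\<Psi> x)) ` (V \<inter> L))"
    proof (rule invariance_of_domain_subspaces[OF _ subspace_L sK])
      show "openin (top_of_set L) (V \<inter> L)" using open_V by (simp add: openin_open_Int Int_commute)
      show "dim K \<le> dim L" using dim_lor_orthogonal[OF ph(1) \<nu>(1) ph(2)] c(3) by (simp add: K_def)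
      show "continuous_on (V \<inter> L) (\<lambda>x. hyp_proj p (\<Psi> x))"
        by (rule continuous_on_compose2[OF cont\<pi> continuous_on_subset[OF continuous_\<Psi>]]) auto
      show "(\<lambda>x. hyp_proj p (\<Psi> x)) \<in> V \<inter> L \<rightarrow> K"
        using \<pi>K \<Psi>_hyp \<nu>(2) \<Psi>_in(1) by blast
      show "inj_on (\<lambda>x. hyp_proj p (\<Psi> x)) (V \<inter> L)"
      proof (rule inj_onI)
        fix x y assume xy: "x \<in> V \<inter> L" "y \<in> V \<inter> L" "hyp_proj p (\<Psi> x) = hyp_proj p (\<Psi> y)"
        then have "\<Psi> x = \<Psi> y" using \<sigma>\<pi> \<Psi>_hyp by (metis IntD1 IntD2)
        then show "x = y" using xy \<Psi>_in(3) by (metis IntD1 IntD2)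
      qed
    qed
    moreover have "y \<in> (\<lambda>x. hyp_proj p (\<Psi> x)) ` (V \<inter> L)"
      using q(2) \<Phi>_in[OF q(1) c(1)] \<Psi>_\<Phi>[OF q(1) c(1)] by (intro image_eqI[of _ _ "\<Phi> q"]) auto
    moreover have "(\<lambda>x. hyp_proj p (\<Psi> x)) ` (V \<inter> L) \<subseteq> ?P" using \<Psi>_in(1) by blast
    ultimately show "\<exists>T. openin (top_of_set K) T \<and> y \<in> T \<and> T \<subseteq> ?P" by blast
  qed
  moreover have "?P = K \<inter> \<sigma> -` H"
    using \<pi>K \<sigma>\<pi> \<pi>\<sigma> H'(1) \<nu>(2) by (auto simp: image_iff subset_iff) metis
  moreover have "closedin (top_of_set K) (K \<inter> \<sigma> -` H)"
    by (rule continuous_closedin_preimage[OF continuous_on_subset[OF cont\<sigma>] H'(4)]) simp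
  moreover have "connected K" using sK by (intro convex_connected subspace_imp_convex)
  ultimately have "?P = K" using H'(3) unfolding connected_clopen by (metis image_is_empty)
  have "q \<in> H" if "q \<in> hyp" "lor q \<nu> = 0" for q
  proof -
    have "hyp_proj p q \<in> ?P" using \<pi>K[OF that] \<open>?P = K\<close> by simp
    then obtain h where "h \<in> H" "hyp_proj p q = hyp_proj p h" by blast
    then show ?thesis using \<sigma>\<pi> that(1) H'(1) by (metis subsetD)
  qed
  then have "H = {p\<in>hyp. lor p \<nu> = 0}" using H'(1) \<nu>(2) by blast
  then show ?thesis by (rule that[OF \<nu>(1)])
qed

text \<open>The foot of the perpendicular from p is q0 = (p - x \<nu>)/c with c = sqrt(1 + x^2). For
  q in the hyperplane <p,q> = c <q0,q> <= -c by the reverse Cauchy-Schwarz inequality, so the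
  distance is arcosh c, and its sinh is |x|.\<close>

lemma hdist_point_hyperplane:
  assumes \<nu>: "lor \<nu> \<nu> = 1" and p: "p \<in> hyp"
  shows "sinh (hdist_point_set p {q\<in>hyp. lor q \<nu> = 0}) = \<bar>lor p \<nu>\<bar>"
    and "0 \<le> hdist_point_set p {q\<in>hyp. lor q \<nu> = 0}"
proof -
  let ?H = "{q\<in>hyp. lor q \<nu> = 0}"
  define x where "x = lor p \<nu>"
  define c where "c = sqrt (1 + x\<^sup>2)"
  have c: "1 \<le> c" "c\<^sup>2 = 1 + x\<^sup>2" by (auto simp: c_def)
  define q0 where "q0 = (1 / c) *\<^sub>R (p - x *\<^sub>R \<nu>)"
  have l: "lor p p = -1" "lor \<nu> p = x" "lor p \<nu> = x" using hypD(1)[OF p] by (simp_all add: x_def lor_commute)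
  have "lor q0 q0 = -1"
  proof -
    have "lor (p - x *\<^sub>R \<nu>) (p - x *\<^sub>R \<nu>) = - (c\<^sup>2)" using l \<nu> c by (simp add: lor_simps power2_eq_square)
    then have "lor q0 q0 = 1 / c * (1 / c * - (c\<^sup>2))" unfolding q0_def lor.scaleR_left lor.scaleR_right by simp
    then show ?thesis using c(1) by (simp add: power2_eq_square)
  qed
  moreover have pq0: "lor q0 p = - c"
  proof -
    have "lor (p - x *\<^sub>R \<nu>) p = - (c\<^sup>2)" using l c by (simp add: lor_simps power2_eq_square)
    then have "lor q0 p = 1 / c * - (c\<^sup>2)" unfolding q0_def lor.scaleR_left by simp
    then show ?thesis using c(1) by (simp add: power2_eq_square)
  qed
  ultimately have "q0 \<in> hyp" using hyp_futureI[OF p, of q0] c(1) by simp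
  moreover have "lor q0 \<nu> = 0" using l \<nu> by (simp add: q0_def lor_simps)
  ultimately have q0: "q0 \<in> ?H" by simp
  have ge: "c \<le> - lor p q" if "q \<in> ?H" for q
  proof -
    have "lor p q = c * lor q0 q"
      using that c(1) by (simp add: q0_def lor_simps lor_commute[of \<nu> q])
    moreover have "lor q0 q \<le> -1" using lor_reverse_cauchy_schwarz that q0 by blast
    ultimately show ?thesis using mult_left_mono[of 1 "- lor q0 q" c] c(1) by simp
  qed
  have "(INF q\<in>?H. hdist p q) = hdist p q0"
  proof (rule cInf_eq_minimum)
    show "hdist p q0 \<in> hdist p ` ?H" using q0 by blast
    fix d assume "d \<in> hdist p ` ?H"
    then obtain q where q: "q \<in> ?H" "d = hdist p q" by blast
    have "arcosh c \<le> arcosh (- lor p q)"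
      using ge[OF q(1)] c(1) by (cases "c = - lor p q") (auto intro: less_imp_le arcosh_real_strict_mono)
    then show "hdist p q0 \<le> d" using q(2) pq0 by (simp add: hdist_def lor_commute[of p q0])
  qed
  then have d: "hdist_point_set p ?H = arcosh c"
    using pq0 by (simp add: hdist_point_set_def hdist_def lor_commute[of p q0])
  have nn: "0 \<le> arcosh c" using arcosh_real_strict_mono[of 1 c] c(1) by (cases "c = 1") auto
  then show "0 \<le> hdist_point_set p ?H" using d by simp
  have "(sinh (arcosh c))\<^sup>2 = x\<^sup>2" using cosh_arcosh_real[OF c(1)] c(2) by (simp add: sinh_square_eq)
  then have "\<bar>sinh (arcosh c)\<bar> = \<bar>x\<bar>" using power2_eq_iff by (metis abs_eq_iff)
  moreover have "0 \<le> sinh (arcosh c)" using nn by simp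
  ultimately show "sinh (hdist_point_set p ?H) = \<bar>lor p \<nu>\<bar>" using d x_def by simp
qed

lemma hdist_sets_le:
  assumes \<nu>: "lor \<nu> \<nu> = 1" and S: "S \<subseteq> hyp" and p: "p \<in> S"
  shows "sinh (hdist_sets S {q\<in>hyp. lor q \<nu> = 0}) \<le> \<bar>lor p \<nu>\<bar>"
proof -
  let ?H = "{q\<in>hyp. lor q \<nu> = 0}"
  have "bdd_below ((\<lambda>p. hdist_point_set p ?H) ` S)"
    using hdist_point_hyperplane(2)[OF \<nu>] S by (intro bdd_belowI2[of _ 0]) auto
  then have "hdist_sets S ?H \<le> hdist_point_set p ?H"
    unfolding hdist_sets_def using p by (rule cINF_lower)
  then have "sinh (hdist_sets S ?H) \<le> sinh (hdist_point_set p ?H)" by simp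
  also have "\<dots> = \<bar>lor p \<nu>\<bar>" by (rule hdist_point_hyperplane(1)[OF \<nu>]) (use S p in blast)
  finally show ?thesis .
qed

section \<open>The volume measure of a submanifold\<close>

definition jac :: "(real^'k::finite \<Rightarrow> 'n::finite minkowski) \<Rightarrow> real^'k \<Rightarrow> real" where
  "jac r u = sqrt (det (gram r u))"

lemma linear_axis_expansion:
  fixes l :: "real^'k::finite \<Rightarrow> 'b::real_vector"
  assumes "linear l"
  shows "l v = (\<Sum>c\<in>UNIV. (v $ c) *\<^sub>R l (axis c 1))"
proof -
  have "v = (\<Sum>c\<in>UNIV. (v $ c) *\<^sub>R axis c 1)"
    by (simp add: basis_expansion[of v, unfolded scalar_mult_eq_scaleR])
  then have "l v = l (\<Sum>c\<in>UNIV. (v $ c) *\<^sub>R axis c 1)" by simp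
  then show ?thesis by (simp add: linear_sum[OF assms] linear_scale[OF assms])
qed

text \<open>By the chain rule the Gram matrix of r is the congruence of that of \<Psi> by the matrix
  of T.\<close>

lemma det_gram_transform:
  fixes r :: "real^'k::finite \<Rightarrow> 'n::finite minkowski" and \<Psi> :: "real^'k \<Rightarrow> 'n minkowski"
  assumes "linear T" "linear (frechet_derivative \<Psi> (at y))"
    and D: "\<And>v. frechet_derivative r (at u) v = frechet_derivative \<Psi> (at y) (T v)"
  shows "det (gram r u) = (det (matrix T))\<^sup>2 * det (gram \<Psi> y)"
proof -
  let ?D = "frechet_derivative \<Psi> (at y)"
  have "gram r u = transpose (matrix T) ** gram \<Psi> y ** matrix T"
  proof (simp only: vec_eq_iff, intro allI)
    fix a b
    have "gram r u $ a $ b = lor (?D (T (axis a 1))) (?D (T (axis b 1)))"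
      by (simp add: gram_def D)
    also have "\<dots> = lor (\<Sum>c\<in>UNIV. (T (axis a 1) $ c) *\<^sub>R ?D (axis c 1)) (\<Sum>d\<in>UNIV. (T (axis b 1) $ d) *\<^sub>R ?D (axis d 1))"
      by (simp only: linear_axis_expansion[OF assms(2), of "T (axis _ 1)"])
    also have "\<dots> = (\<Sum>d\<in>UNIV. \<Sum>c\<in>UNIV. T (axis a 1) $ c * gram \<Psi> y $ c $ d * T (axis b 1) $ d)"
      by (simp add: lor.sum_left lor.sum_right lor_simps gram_def sum_distrib_left mult_ac)
    also have "\<dots> = (transpose (matrix T) ** gram \<Psi> y ** matrix T) $ a $ b"
      by (simp add: matrix_matrix_mult_def transpose_def matrix_def sum_distrib_right)
    finally show "gram r u $ a $ b = (transpose (matrix T) ** gram \<Psi> y ** matrix T) $ a $ b" .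
  qed
  then show ?thesis by (simp add: det_mul power2_eq_square)
qed

lemma continuous_on_gram:
  assumes "smooth_on r U"
  shows "continuous_on U (\<lambda>u. det (gram r u))" "continuous_on U (jac r)"
proof -
  show "continuous_on U (\<lambda>u. det (gram r u))"
    unfolding det_def gram_def
    by (simp, intro continuous_intros lor.continuous_on smooth_on_continuous smooth_on_deriv assms)
  then show "continuous_on U (jac r)" unfolding jac_def by (intro continuous_intros)
qed

locale param_chart = hyp_chart S W V \<Phi> \<Psi> "UNIV :: (real^'k::finite) set"
  for S :: "'n::finite minkowski set" and W and V :: "(real^'k) set" and \<Phi> \<Psi>
begin

lemma gram_posdef:
  assumes "y \<in> V" "x \<noteq> 0"
  shows "0 < x \<bullet> (gram \<Psi> y *v x)"
proof -
  have "x \<bullet> (gram \<Psi> y *v x) = (\<Sum>i\<in>UNIV. \<Sum>j\<in>UNIV. x $ i * (gram \<Psi> y $ i $ j * x $ j))"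
    by (simp add: inner_vec_def matrix_vector_mult_def sum_distrib_left)
  also have "\<dots> = lor (\<Sum>i\<in>UNIV. (x $ i) *\<^sub>R D\<Psi> y (axis i 1)) (\<Sum>j\<in>UNIV. (x $ j) *\<^sub>R D\<Psi> y (axis j 1))"
    by (subst sum.swap) (simp add: lor.sum_left lor.sum_right lor_simps gram_def sum_distrib_left mult_ac)
  also have "\<dots> = lor (D\<Psi> y x) (D\<Psi> y x)"
    by (simp only: linear_axis_expansion[OF linear_D\<Psi>[OF assms(1)], of x])
  also have "0 < \<dots>"
  proof -
    have "D\<Psi> y x \<noteq> 0" using D\<Phi>_D\<Psi>[OF assms(1), of x] assms(2) linear_0[OF linear_D\<Phi>[OF \<Psi>_in(2)[OF assms(1)]]] by auto
    moreover have "D\<Psi> y x \<in> tangent_space S (\<Psi> y)" using tangent_space_eq[OF assms(1)] by simp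
    ultimately show ?thesis using lor_positive_tangent[OF assms(1)] by (simp add: lor_positive_def)
  qed
  finally show ?thesis .
qed

lemma det_gram_pos: "y \<in> V \<Longrightarrow> 0 < det (gram \<Psi> y)"
  by (rule det_posdef_pos[OF gram_posdef])

lemma jac_pos: "y \<in> V \<Longrightarrow> 0 < jac \<Psi> y"
  by (simp add: jac_def det_gram_pos)

lemma local_param: "local_param S V \<Psi>" and image_\<Psi>: "\<Psi> ` V = S \<inter> W"
proof -
  show im: "\<Psi> ` V = S \<inter> W"
    using \<Psi>_in \<Psi>_\<Phi> \<Phi>_in by (auto simp: image_iff) (metis UNIV_I)
  have "inj (D\<Psi> u)" if "u \<in> V" for u
    using D\<Phi>_D\<Psi>[OF that] by (metis UNIV_I injI)
  moreover have "openin (top_of_set S) (\<Psi> ` V)" unfolding im using open_W by (rule openin_open_Int)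
  moreover have "homeomorphism V (\<Psi> ` V) \<Psi> \<Phi>"
    unfolding homeomorphism_def im
    using \<Psi>_in \<Psi>_\<Phi> image_\<Phi> continuous_\<Psi> im smooth_on_continuous[OF smooth_\<Phi>] by (auto intro: continuous_on_subset)
  ultimately show "local_param S V \<Psi>"
    unfolding local_param_def using open_V smooth_\<Psi> by blast
qed

end

section \<open>Existence of a countable atlas, and volume as a Borel measure\<close>

lemma param_chart_exists:
  fixes S :: "'n::finite minkowski set"
  assumes "submanifold CARD('k::finite) S" "S \<subseteq> hyp" "p \<in> S"
  obtains W and V :: "(real^'k) set" and \<Phi> \<Psi> where "p \<in> W" "param_chart S W V \<Phi> \<Psi>"
proof (rule submanifold_parametrization[OF assms(1,3)])
  fix W and V :: "(real^'k) set" and \<Phi> \<Psi>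
  assume "p \<in> W" "slice_chart S W V \<Phi> \<Psi> UNIV"
  then show ?thesis
    using assms(2) by (intro that[of W V \<Phi> \<Psi>] param_chart.intro hyp_chart.intro hyp_chart_axioms.intro)
qed

text \<open>The images of parametrized patches are relatively open and cover S, so countably many of
  them suffice by Lindelof's theorem.\<close>

lemma countable_atlas_exists:
  fixes S :: "'n::finite minkowski set"
  assumes S: "submanifold CARD('k::finite) S" "S \<subseteq> hyp"
  shows "\<exists>\<A> :: nat \<Rightarrow> (real^'k) set \<times> (real^'k \<Rightarrow> 'n minkowski). countable_atlas S \<A>"
proof (cases "S = {}")
  case True
  \<comment> \<open>An atlas is indexed by all natural numbers, so the empty S is given a sequence
    of empty patches.\<close>
  have "countable_atlas S (\<lambda>_. ({} :: (real^'k) set, \<lambda>_. 0))"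
    unfolding countable_atlas_def local_param_def smooth_on_def using Ck_on_const[of "{}"]
    by (auto simp: True homeomorphism_def)
  then show ?thesis by blast
next
  case False
  define F where "F = {T. \<exists>(V :: (real^'k) set) \<Psi>. local_param S V \<Psi> \<and> T = \<Psi> ` V}"
  have op: "openin (top_of_set S) T" if "T \<in> F" for T using that by (auto simp: F_def local_param_def)
  obtain F' where F': "F' \<subseteq> F" "countable F'" "\<Union>F' = \<Union>F" using Lindelof_openin[OF op] by blast
  have UF: "\<Union>F = S"
  proof
    show "\<Union>F \<subseteq> S" using op openin_imp_subset by blast
    show "S \<subseteq> \<Union>F"
    proof
      fix p assume p: "p \<in> S"
      obtain W and V :: "(real^'k) set" and \<Phi> \<Psi> where c: "p \<in> W" "param_chart S W V \<Phi> \<Psi>"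
        using param_chart_exists[OF S p] .
      interpret param_chart S W V \<Phi> \<Psi> by (rule c(2))
      have "\<Psi> ` V \<in> F" using local_param by (auto simp: F_def)
      moreover have "p \<in> \<Psi> ` V" using image_\<Psi> p c(1) by simp
      ultimately show "p \<in> \<Union>F" by blast
    qed
  qed
  then have ne: "F' \<noteq> {}" using False F' by auto
  define T where "T = from_nat_into F'"
  have "\<exists>c :: (real^'k) set \<times> (real^'k \<Rightarrow> 'n minkowski). local_param S (fst c) (snd c) \<and> T i = snd c ` fst c" for i
    using from_nat_into[OF ne, of i] F'(1) by (auto simp: F_def T_def)
  then obtain \<A> :: "nat \<Rightarrow> (real^'k) set \<times> (real^'k \<Rightarrow> 'n minkowski)"
    where A: "\<And>i. local_param S (fst (\<A> i)) (snd (\<A> i))" "\<And>i. T i = snd (\<A> i) ` fst (\<A> i)"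
    by metis
  have "(\<Union>i. T i) = S" using range_from_nat_into[OF ne F'(2)] F'(3) UF by (simp add: T_def)
  then have "countable_atlas S \<A>" unfolding countable_atlas_def using A by auto
  then show ?thesis by blast
qed

locale atlas =
  fixes S :: "'n::finite minkowski set" and \<A> :: "nat \<Rightarrow> (real^'k::finite) set \<times> (real^'k \<Rightarrow> 'n minkowski)"
  assumes atlas: "countable_atlas S \<A>" and S_hyp: "S \<subseteq> hyp" and closed_S: "closed S"
    and submanifold_S: "submanifold CARD('k) S"
begin

definition U where "U i = fst (\<A> i)"
definition r where "r i = snd (\<A> i)"
definition piece where "piece i = {u \<in> U i. \<forall>j<i. r i u \<notin> r j ` U j}"
text \<open>Extension of the parametrization by 0, Borel on the whole coordinate space. The default
  value carries no mass, since the density of \<open>vol\<close> lives on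
  \<open>piece i\<close>.\<close>

definition R where "R i u = (if u \<in> U i then r i u else 0)"
text \<open>The pieces are placed side by side in nat x \<open>real^'k\<close>, weighted with
  sqrt(det g), and pushed forward to Minkowski space. As a Borel measure it supports integrals of
  functions and dominated convergence.\<close>

definition vol :: "'n minkowski measure" where
  "vol = distr (density (count_space UNIV \<Otimes>\<^sub>M lborel) (\<lambda>(i, u). ennreal (indicator (piece i) u * jac (r i) u)))
           borel (\<lambda>(i, u). R i u)"

lemma open_U: "open (U i)" and smooth_r: "smooth_on (r i) (U i)" and inj_r: "inj_on (r i) (U i)"
  and openin_r: "openin (top_of_set S) (r i ` U i)" and r_in: "u \<in> U i \<Longrightarrow> r i u \<in> S"
  and S_eq: "S = (\<Union>i. r i ` U i)"
proof -
  have l: "local_param S (U i) (r i)" "S = (\<Union>i. r i ` U i)" for i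
    using atlas by (auto simp: countable_atlas_def U_def r_def)
  then show "open (U i)" "smooth_on (r i) (U i)" "openin (top_of_set S) (r i ` U i)" "S = (\<Union>i. r i ` U i)"
    by (auto simp: local_param_def)
  show "u \<in> U i \<Longrightarrow> r i u \<in> S" using l(2) by blast
  show "inj_on (r i) (U i)" using l(1)[of i] by (auto simp: local_param_def homeomorphism_def intro: inj_on_inverseI)
qed

lemma borel_r [measurable]: "r i ` U i \<in> sets borel"
proof -
  obtain T where "open T" "r i ` U i = S \<inter> T" using openin_r[of i] by (auto simp: openin_open)
  then show ?thesis using closed_S by auto
qed

lemma borel_U [measurable]: "U i \<in> sets borel" using open_U by auto

lemma R_measurable [measurable]: "R i \<in> borel_measurable borel"
  unfolding R_def by (intro borel_measurable_continuous_on_if borel_U smooth_on_continuous[OF smooth_r]) auto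

lemma piece_measurable [measurable]: "piece i \<in> sets borel"
proof -
  have "piece i = U i \<inter> (R i -` (- (\<Union>j<i. r j ` U j)) \<inter> space borel)"
    by (auto simp: piece_def R_def; metis image_eqI lessThan_iff)
  also have "\<dots> \<in> sets borel"
  proof -
    have X: "- (\<Union>j<i. r j ` U j) \<in> sets borel" by (intro borel_comp sets.finite_UN) auto
    show ?thesis by (intro sets.Int borel_U measurable_sets[OF R_measurable X])
  qed
  finally show ?thesis .
qed

lemma indicator_jac_measurable:
  assumes "C \<subseteq> U i" "C \<in> sets borel"
  shows "(\<lambda>u. indicator C u * jac (r i) u) \<in> borel_measurable borel"
proof -
  have "continuous_on C (jac (r i))" using continuous_on_gram(2)[OF smooth_r] assms(1) by (rule continuous_on_subset)
  from borel_measurable_continuous_on_indicator[OF assms(2) this] show ?thesis by simp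
qed

lemma piece_jac_measurable [measurable]: "(\<lambda>u. indicator (piece i) u * jac (r i) u) \<in> borel_measurable borel"
  by (rule indicator_jac_measurable) (auto simp: piece_def[of i] piece_measurable[of i, unfolded piece_def])

lemma pair_measurable:
  "(\<lambda>(i, u). ennreal (indicator (piece i) u * jac (r i) u)) \<in> borel_measurable (count_space UNIV \<Otimes>\<^sub>M lborel)"
  "(\<lambda>(i, u). R i u) \<in> borel_measurable (count_space UNIV \<Otimes>\<^sub>M lborel)"
  by (auto intro!: measurable_pair_measure_countable1)

lemma sets_vol [simp, measurable_cong]: "sets vol = sets borel" and space_vol [simp]: "space vol = UNIV"
  by (simp_all add: vol_def)

lemma nn_integral_vol:
  assumes g [measurable]: "g \<in> borel_measurable borel"
  shows "(\<integral>\<^sup>+ p. g p \<partial>vol) = (\<Sum>i. \<integral>\<^sup>+ u. ennreal (indicator (piece i) u * jac (r i) u) * g (R i u) \<partial>lborel)"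
proof -
  have m: "(\<lambda>x. g ((\<lambda>(i, u). R i u) x)) \<in> borel_measurable (count_space UNIV \<Otimes>\<^sub>M lborel)"
    by (rule measurable_compose[OF pair_measurable(2) g])
  have "(\<integral>\<^sup>+ p. g p \<partial>vol) = (\<integral>\<^sup>+ x. (\<lambda>(i, u). ennreal (indicator (piece i) u * jac (r i) u)) x * g ((\<lambda>(i, u). R i u) x) \<partial>(count_space UNIV \<Otimes>\<^sub>M lborel))"
    unfolding vol_def using pair_measurable m
    by (subst nn_integral_distr) (auto simp: nn_integral_density)
  also have "\<dots> = (\<integral>\<^sup>+ i. \<integral>\<^sup>+ u. ennreal (indicator (piece i) u * jac (r i) u) * g (R i u) \<partial>lborel \<partial>count_space UNIV)"
    by (subst lborel.nn_integral_fst[symmetric]) (use pair_measurable m in \<open>auto intro: borel_measurable_times_ennreal\<close>)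
  finally show ?thesis by (simp add: nn_integral_count_space_nat)
qed

lemma emeasure_vol:
  assumes "E \<in> sets borel"
  shows "emeasure vol E = (\<Sum>i. \<integral>\<^sup>+ u. ennreal (indicator (piece i) u * jac (r i) u) * indicator E (R i u) \<partial>lborel)"
  using nn_integral_vol[of "indicator E"] assms by (simp add: nn_integral_indicator)

end

text \<open>\<open>k_volume\<close> selects its atlas by \<open>SOME\<close>. Naming the same term
  here lets the measure of that very atlas represent it without comparing atlases.\<close>

lemma k_volume_eq_vol:
  fixes S :: "'n::finite minkowski set"
  defines "\<A> \<equiv> (SOME \<A> :: nat \<Rightarrow> (real^'k::finite) set \<times> (real^'k \<Rightarrow> 'n minkowski). countable_atlas S \<A>)"
  assumes "S \<subseteq> hyp" "closed S" "submanifold CARD('k) S"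
  shows "atlas S \<A>" and "E \<in> sets borel \<Longrightarrow> k_volume TYPE('k) S E = emeasure (atlas.vol \<A>) E"
proof -
  have "countable_atlas S \<A>" unfolding \<A>_def
    by (rule someI_ex[OF countable_atlas_exists[OF assms(4,2)]])
  then show *: "atlas S \<A>" using assms by unfold_locales
  interpret atlas S \<A> by (rule *)
  assume E: "E \<in> sets borel"
  have "ennreal (sqrt (det (gram (r i) u))) * indicator {u \<in> U i. r i u \<in> E \<and> (\<forall>j<i. r i u \<notin> r j ` U j)} u =
     ennreal (indicator (piece i) u * jac (r i) u) * indicator E (R i u)" for i u
    by (auto simp: indicator_def piece_def R_def jac_def)
  then show "k_volume TYPE('k) S E = emeasure vol E"
    unfolding emeasure_vol[OF E] k_volume_def \<A>_def[symmetric] Let_def U_def[symmetric] r_def[symmetric] by simp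
qed

section \<open>Volume and integrals in an arbitrary slice chart\<close>

lemma measurable_restrict_chart:
  fixes \<Psi> :: "'c::euclidean_space \<Rightarrow> 'b::euclidean_space"
  assumes "open V" "continuous_on V \<Psi>"
  shows "(\<lambda>y. if y \<in> V then \<Psi> y else 0) \<in> borel_measurable borel"
  using assms by (intro borel_measurable_continuous_on_if) auto

context atlas
begin

context
  fixes W and V :: "(real^'k) set" and \<Phi> \<Psi>
  assumes chart: "param_chart S W V \<Phi> \<Psi>"
begin

interpretation param_chart S W V \<Phi> \<Psi> by (rule chart)

definition chart_map where "chart_map y = (if y \<in> V then \<Psi> y else 0)"

lemma chart_map_measurable [measurable]: "chart_map \<in> borel_measurable borel"
  unfolding chart_map_def[abs_def] by (rule measurable_restrict_chart[OF open_V continuous_\<Psi>])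

text \<open>Near u the patch is \<Psi> composed with the transition map, so the Gram determinants
  differ by the square of the Jacobian determinant of the transition.\<close>

lemma jac_transition:
  assumes u: "u \<in> U i" "r i u \<in> W"
  defines "T \<equiv> \<lambda>v. D\<Phi> (r i u) (frechet_derivative (r i) (at u) v)"
  shows "((\<lambda>u. \<Phi> (r i u)) has_derivative T) (at u)"
    and "jac (r i) u = \<bar>det (matrix T)\<bar> * jac \<Psi> (\<Phi> (r i u))"
proof -
  note r' = smooth_on_has_derivative[OF smooth_r u(1)]
  show T: "((\<lambda>u. \<Phi> (r i u)) has_derivative T) (at u)"
    unfolding T_def using has_derivative_compose[OF r' smooth_on_has_derivative[OF smooth_\<Phi> u(2)]] by simp
  let ?y = "\<Phi> (r i u)"
  have yV: "?y \<in> V" using \<Phi>_in(1)[OF r_in[OF u(1)] u(2)] .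
  have "((\<lambda>u. \<Psi> (\<Phi> (r i u))) has_derivative (\<lambda>v. D\<Psi> ?y (T v))) (at u)"
    using has_derivative_compose[OF T smooth_on_has_derivative[OF smooth_\<Psi> yV]] by simp
  moreover have "((\<lambda>u. \<Psi> (\<Phi> (r i u))) has_derivative frechet_derivative (r i) (at u)) (at u)"
  proof (rule has_derivative_transform_within_open[OF r'])
    show "open (U i \<inter> r i -` W)"
      by (rule continuous_open_preimage[OF smooth_on_continuous[OF smooth_r] open_U open_W])
    show "r i x = \<Psi> (\<Phi> (r i x))" if "x \<in> U i \<inter> r i -` W" for x
      using \<Psi>_\<Phi>[OF r_in, of x i] that by auto
  qed (use u in auto)
  ultimately have "frechet_derivative (r i) (at u) = (\<lambda>v. D\<Psi> ?y (T v))"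
    using has_derivative_unique by blast
  then have "det (gram (r i) u) = (det (matrix T))\<^sup>2 * det (gram \<Psi> ?y)"
    using has_derivative_linear[OF T] linear_D\<Psi>[OF yV] by (intro det_gram_transform) auto
  then show "jac (r i) u = \<bar>det (matrix T)\<bar> * jac \<Psi> ?y"
    by (simp add: jac_def real_sqrt_mult)
qed

text \<open>The part of E counted in the i-th patch is moved into the chart by the transition map,
  where the change of variables trades one density for the other. The images of these parts are
  disjoint and fill the preimage of E, so the choice of atlas drops out.\<close>

lemma emeasure_vol_chart:
  assumes E: "E \<in> sets borel" "E \<subseteq> W"
  shows "emeasure vol E = (\<integral>\<^sup>+ y. ennreal (indicator V y * jac \<Psi> y) * indicator E (chart_map y) \<partial>lborel)"
proof -
  note [measurable] = E(1)
  define C where "C i = {u \<in> piece i. r i u \<in> E}" for i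
  \<comment> \<open>The change of variables asks for a function that is nonnegative everywhere. Off
    V the Gram determinant may be negative, and then its \<open>sqrt\<close> is negative
    too.\<close>
  define f where "f y = max 0 (jac \<Psi> y)" for y
  define \<tau> where "\<tau> i u = \<Phi> (r i u)" for i u
  define T where "T i u = (\<lambda>v. D\<Phi> (r i u) (frechet_derivative (r i) (at u) v))" for i u
  have C_U: "C i \<subseteq> U i" for i by (auto simp: C_def piece_def)
  have CW: "u \<in> U i" "r i u \<in> W" "r i u \<in> S" if "u \<in> C i" for i u
    using that E(2) r_in[of u i] by (auto simp: C_def piece_def)
  have CV: "\<tau> i u \<in> V" "\<Psi> (\<tau> i u) = r i u" if "u \<in> C i" for i u
    using \<Phi>_in(1)[of "r i u"] \<Psi>_\<Phi>[of "r i u"] CW[OF that] by (auto simp: \<tau>_def)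
  have C_borel: "C i \<in> sets borel" for i
  proof -
    have "C i = piece i \<inter> (R i -` E \<inter> space borel)" by (auto simp: C_def R_def piece_def)
    also have "\<dots> \<in> sets borel" by (intro sets.Int piece_measurable measurable_sets[OF R_measurable E(1)])
    finally show ?thesis .
  qed
  have D_iff: "y \<in> \<tau> i ` C i \<longleftrightarrow> y \<in> V \<and> \<Psi> y \<in> E \<and> \<Psi> y \<in> r i ` U i \<and> (\<forall>j<i. \<Psi> y \<notin> r j ` U j)" for i y
  proof
    assume "y \<in> \<tau> i ` C i"
    then obtain u where u: "u \<in> C i" "y = \<tau> i u" by blast
    then show "y \<in> V \<and> \<Psi> y \<in> E \<and> \<Psi> y \<in> r i ` U i \<and> (\<forall>j<i. \<Psi> y \<notin> r j ` U j)"
      using CV[OF u(1)] by (simp add: C_def piece_def)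
  next
    assume y: "y \<in> V \<and> \<Psi> y \<in> E \<and> \<Psi> y \<in> r i ` U i \<and> (\<forall>j<i. \<Psi> y \<notin> r j ` U j)"
    then obtain u where u: "u \<in> U i" "\<Psi> y = r i u" by blast
    have "u \<in> C i" using y u by (auto simp: C_def piece_def)
    moreover have "\<tau> i u = y" using \<Psi>_in(3)[of y] y u by (simp add: \<tau>_def)
    ultimately show "y \<in> \<tau> i ` C i" by blast
  qed
  have D_borel: "\<tau> i ` C i \<in> sets borel" for i
  proof -
    have X: "E \<inter> r i ` U i \<inter> - (\<Union>j<i. r j ` U j) \<in> sets borel"
      by (intro sets.Int borel_comp sets.finite_UN E borel_r) auto
    have "\<tau> i ` C i = V \<inter> (chart_map -` (E \<inter> r i ` U i \<inter> - (\<Union>j<i. r j ` U j)) \<inter> space borel)"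
      by (intro set_eqI) (simp only: D_iff, auto simp: chart_map_def)
    also have "\<dots> \<in> sets borel"
      using open_V by (intro sets.Int measurable_sets[OF chart_map_measurable X]) auto
    finally show ?thesis .
  qed
  have jac_f: "\<bar>det (matrix (T i u))\<bar> * f (\<tau> i u) = jac (r i) u" if "u \<in> C i" for i u
    using jac_transition(2)[OF CW(1,2)[OF that]] jac_pos[OF CV(1)[OF that]] by (simp add: T_def f_def \<tau>_def)
  have f_meas: "(\<lambda>y. indicator A y * f y) \<in> borel_measurable borel" if "A \<in> sets borel" "A \<subseteq> V" for A
  proof -
    have "continuous_on A f" unfolding f_def
      by (intro continuous_intros continuous_on_subset[OF continuous_on_gram(2)[OF smooth_\<Psi>] that(2)])
    from borel_measurable_continuous_on_indicator[OF that(1) this] show ?thesis by simp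
  qed
  have piece_int: "(\<integral>\<^sup>+ u. ennreal (indicator (piece i) u * jac (r i) u) * indicator E (R i u) \<partial>lborel)
     = (\<integral>\<^sup>+ y. ennreal (indicator (\<tau> i ` C i) y * f y) \<partial>lborel)" for i
  proof -
    have "ennreal (indicator (piece i) u * jac (r i) u) * indicator E (R i u) =
        ennreal (indicator (C i) u * (\<bar>det (matrix (T i u))\<bar> * f (\<tau> i u)))" for u
      using jac_f[of u i] by (auto simp: indicator_def C_def R_def piece_def)
    then have "(\<integral>\<^sup>+ u. ennreal (indicator (piece i) u * jac (r i) u) * indicator E (R i u) \<partial>lborel)
      = (\<integral>\<^sup>+ u. ennreal (indicator (C i) u * (\<bar>det (matrix (T i u))\<bar> * f (\<tau> i u))) \<partial>lborel)" by simp
    also have "\<dots> = (\<integral>\<^sup>+ y. ennreal (indicator (\<tau> i ` C i) y * f y) \<partial>lborel)"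
    proof (rule nn_integral_change_of_variables[OF C_borel])
      show "(\<tau> i has_derivative T i x) (at x within C i)" if "x \<in> C i" for x
        unfolding \<tau>_def T_def
        by (rule has_derivative_at_withinI[OF jac_transition(1)[OF CW(1,2)[OF that]]])
      show "inj_on (\<tau> i) (C i)"
      proof (rule inj_onI)
        fix u v assume uv: "u \<in> C i" "v \<in> C i" "\<tau> i u = \<tau> i v"
        then have "r i u = r i v" using CV(2)[OF uv(1)] CV(2)[OF uv(2)] by simp
        then show "u = v" using inj_onD[OF inj_r[of i]] uv(1,2) C_U[of i] by blast
      qed
      show "(\<lambda>y. indicator (\<tau> i ` C i) y * f y) \<in> borel_measurable borel"
        by (rule f_meas[OF D_borel]) (use D_iff in blast)
      have "(\<lambda>x. indicator (C i) x * (\<bar>det (matrix (T i x))\<bar> * f (\<tau> i x))) = (\<lambda>x. indicator (C i) x * jac (r i) x)"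
        using jac_f by (auto simp: fun_eq_iff indicator_def)
      then show "(\<lambda>x. indicator (C i) x * (\<bar>det (matrix (T i x))\<bar> * f (\<tau> i x))) \<in> borel_measurable borel"
        using indicator_jac_measurable[OF C_U C_borel] by simp
    qed (simp add: f_def)
    finally show ?thesis .
  qed
  have "emeasure vol E = (\<Sum>i. \<integral>\<^sup>+ y. ennreal (indicator (\<tau> i ` C i) y * f y) \<partial>lborel)"
    unfolding emeasure_vol[OF E(1)] piece_int ..
  also have "\<dots> = (\<integral>\<^sup>+ y. (\<Sum>i. ennreal (indicator (\<tau> i ` C i) y * f y)) \<partial>lborel)"
  proof (rule nn_integral_suminf[symmetric])
    have "\<tau> i ` C i \<subseteq> V" for i using D_iff by blast
    from f_meas[OF D_borel this]
    show "(\<lambda>y. ennreal (indicator (\<tau> i ` C i) y * f y)) \<in> borel_measurable lborel" for i by simp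
  qed
  also have "\<dots> = (\<integral>\<^sup>+ y. ennreal (indicator V y * jac \<Psi> y) * indicator E (chart_map y) \<partial>lborel)"
  proof (rule nn_integral_cong)
    fix y
    show "(\<Sum>i. ennreal (indicator (\<tau> i ` C i) y * f y)) = ennreal (indicator V y * jac \<Psi> y) * indicator E (chart_map y)"
    proof (cases "y \<in> V \<and> \<Psi> y \<in> E")
      case False
      then have "y \<notin> \<tau> i ` C i" for i using D_iff by blast
      then show ?thesis using False by (auto simp: indicator_def chart_map_def)
    next
      case True
      then have "\<exists>i. \<Psi> y \<in> r i ` U i" using \<Psi>_in(1)[of y] S_eq by auto
      \<comment> \<open>The first patch containing \<Psi> y owns the point, so exactly one summand
        is nonzero.\<close>
      then obtain m where m: "\<Psi> y \<in> r m ` U m" "\<And>j. j < m \<Longrightarrow> \<Psi> y \<notin> r j ` U j"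
        using exists_least_iff[of "\<lambda>i. \<Psi> y \<in> r i ` U i"] by blast
      have "y \<in> \<tau> i ` C i \<longleftrightarrow> i = m" for i
        using D_iff[of y i] True m by (metis linorder_neqE_nat)
      then have "(\<lambda>i. ennreal (indicator (\<tau> i ` C i) y * f y)) = (\<lambda>i. if i = m then ennreal (f y) else 0)"
        by (auto simp: fun_eq_iff)
      then have "(\<Sum>i. ennreal (indicator (\<tau> i ` C i) y * f y)) = ennreal (f y)"
        using sums_unique[OF sums_single[of m "\<lambda>_. ennreal (f y)"]] by simp
      then show ?thesis using True jac_pos[of y] by (simp add: chart_map_def f_def)
    qed
  qed
  finally show ?thesis .
qed

lemma jac_indicator_measurable [measurable]: "(\<lambda>y. indicator V y * jac \<Psi> y) \<in> borel_measurable borel"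
  using borel_measurable_continuous_on_indicator[OF borel_open[OF open_V] continuous_on_gram(2)[OF smooth_\<Psi>]] by simp

text \<open>An equality of measures, rather than of volumes of sets, is what transports integrals of
  signed functions to the chart.\<close>

lemma density_vol_chart:
  "density vol (\<lambda>p. ennreal (indicator W p)) = distr (density lborel (\<lambda>y. ennreal (indicator V y * jac \<Psi> y))) borel chart_map"
proof (rule measure_eqI)
  have W [measurable]: "W \<in> sets borel" using open_W by simp
  fix E assume "E \<in> sets (density vol (\<lambda>p. ennreal (indicator W p)))"
  then have E [measurable]: "E \<in> sets borel" by simp
  have "emeasure (density vol (\<lambda>p. ennreal (indicator W p))) E = (\<integral>\<^sup>+ p. indicator (W \<inter> E) p \<partial>vol)"
    by (subst emeasure_density) (auto intro!: nn_integral_cong simp: indicator_def simp del: nn_integral_indicator)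
  also have "\<dots> = emeasure vol (W \<inter> E)" by simp
  also have "\<dots> = (\<integral>\<^sup>+ y. ennreal (indicator V y * jac \<Psi> y) * indicator (W \<inter> E) (chart_map y) \<partial>lborel)"
    by (rule emeasure_vol_chart) auto
  also have "\<dots> = (\<integral>\<^sup>+ y. ennreal (indicator V y * jac \<Psi> y) * indicator (chart_map -` E) y \<partial>lborel)"
    using \<Psi>_in(2) by (intro nn_integral_cong) (auto simp: indicator_def chart_map_def)
  also have "\<dots> = emeasure (distr (density lborel (\<lambda>y. ennreal (indicator V y * jac \<Psi> y))) borel chart_map) E"
    by (subst emeasure_distr) (auto simp: emeasure_density measurable_sets_borel[OF chart_map_measurable])
  finally show "emeasure (density vol (\<lambda>p. ennreal (indicator W p))) E =
     emeasure (distr (density lborel (\<lambda>y. ennreal (indicator V y * jac \<Psi> y))) borel chart_map) E" .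
qed simp

lemma integral_vol_chart:
  fixes h :: "'n minkowski \<Rightarrow> real"
  assumes h [measurable]: "h \<in> borel_measurable borel" and supp: "\<And>p. p \<notin> W \<Longrightarrow> h p = 0"
  shows "(\<integral>p. h p \<partial>vol) = (\<integral>y. indicator V y * jac \<Psi> y * h (chart_map y) \<partial>lborel)"
proof -
  have W [measurable]: "W \<in> sets borel" using open_W by simp
  have "(\<integral>p. h p \<partial>vol) = (\<integral>p. indicator W p *\<^sub>R h p \<partial>vol)"
    using supp by (intro Bochner_Integration.integral_cong) (auto simp: indicator_def)
  also have "\<dots> = (\<integral>p. h p \<partial>density vol (\<lambda>p. ennreal (indicator W p)))"
    by (rule integral_density[symmetric]) auto
  also have "\<dots> = (\<integral>y. h (chart_map y) \<partial>density lborel (\<lambda>y. ennreal (indicator V y * jac \<Psi> y)))"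
    unfolding density_vol_chart by (rule integral_distr) auto
  also have "\<dots> = (\<integral>y. (indicator V y * jac \<Psi> y) *\<^sub>R h (chart_map y) \<partial>lborel)"
  proof (rule integral_density)
    have "0 \<le> indicator V y * jac \<Psi> y" for y using jac_pos[of y] by (simp add: indicator_def less_imp_le)
    then show "AE y in lborel. 0 \<le> indicator V y * jac \<Psi> y" by simp
  qed auto
  finally show ?thesis by simp
qed

lemma emeasure_vol_chart_compact:
  assumes K: "compact K" "K \<subseteq> S \<inter> W"
  shows "emeasure vol K < \<infinity>"
proof -
  have KP: "compact (\<Phi> ` K)" "\<Phi> ` K \<subseteq> V"
    using K \<Phi>_in(1) by (auto intro!: compact_continuous_image continuous_on_subset[OF smooth_on_continuous[OF smooth_\<Phi>]])
  have "compact (jac \<Psi> ` \<Phi> ` K)"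
    by (rule compact_continuous_image[OF continuous_on_subset[OF continuous_on_gram(2)[OF smooth_\<Psi>] KP(2)] KP(1)])
  then obtain C where C: "\<And>y. y \<in> \<Phi> ` K \<Longrightarrow> \<bar>jac \<Psi> y\<bar> \<le> C"
    using compact_imp_bounded bounded_iff by (metis image_eqI real_norm_def)
  have "emeasure vol K = (\<integral>\<^sup>+ y. ennreal (indicator V y * jac \<Psi> y) * indicator K (chart_map y) \<partial>lborel)"
    using K by (intro emeasure_vol_chart borel_compact) auto
  also have "\<dots> \<le> (\<integral>\<^sup>+ y. ennreal C * indicator (\<Phi> ` K) y \<partial>lborel)"
  proof (rule nn_integral_mono)
    fix y
    show "ennreal (indicator V y * jac \<Psi> y) * indicator K (chart_map y) \<le> ennreal C * indicator (\<Phi> ` K) y"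
    proof (cases "y \<in> V \<and> \<Psi> y \<in> K")
      case True
      then have "y \<in> \<Phi> ` K" using \<Psi>_in(3)[of y] by (metis UNIV_I image_eqI)
      then show ?thesis using True C[of y] by (simp add: chart_map_def ennreal_leI)
    qed (auto simp: chart_map_def indicator_def)
  qed
  also have "\<dots> = ennreal C * emeasure lborel (\<Phi> ` K)"
    using KP(1) by (intro nn_integral_cmult_indicator) (auto intro: borel_compact)
  also have "\<dots> < \<infinity>"
    using emeasure_compact_finite[OF KP(1)] by (simp add: ennreal_mult_less_top)
  finally show ?thesis .
qed

end

text \<open>In one chart the density is bounded on compact sets; finitely many balls whose closures
  lie in charts cover K.\<close>

lemma emeasure_vol_compact:
  assumes K: "compact K" "K \<subseteq> S"
  shows "emeasure vol K < \<infinity>"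
proof -
  have "\<exists>d>0. emeasure vol (cball p d \<inter> K) < \<infinity>" if p: "p \<in> K" for p
  proof -
    obtain W and V :: "(real^'k) set" and \<Phi> \<Psi> where c: "p \<in> W" "param_chart S W V \<Phi> \<Psi>"
      using param_chart_exists[OF submanifold_S S_hyp] p K(2) by (metis subsetD)
    interpret param_chart S W V \<Phi> \<Psi> by (rule c(2))
    obtain d where "0 < d" "cball p d \<subseteq> W" using open_W c(1) open_contains_cball by blast
    moreover have "emeasure vol (cball p d \<inter> K) < \<infinity>"
      by (rule emeasure_vol_chart_compact[OF c(2)]) (use K calculation in \<open>auto intro: compact_Int_closed\<close>)
    ultimately show ?thesis by blast
  qed
  then obtain d where d: "\<And>p. p \<in> K \<Longrightarrow> 0 < d p" "\<And>p. p \<in> K \<Longrightarrow> emeasure vol (cball p (d p) \<inter> K) < \<infinity>"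
    by metis
  obtain F where F: "F \<subseteq> K" "finite F" "K \<subseteq> (\<Union>p\<in>F. ball p (d p))"
    by (rule compactE_image[OF K(1), of K "\<lambda>p. ball p (d p)"]) (use d(1) in auto)
  have "emeasure vol K \<le> emeasure vol (\<Union>p\<in>F. cball p (d p) \<inter> K)"
  proof (rule emeasure_mono)
    show "K \<subseteq> (\<Union>p\<in>F. cball p (d p) \<inter> K)" using F(3) ball_subset_cball by blast
    show "(\<Union>p\<in>F. cball p (d p) \<inter> K) \<in> sets vol"
      using F(2) K(1) by (auto intro!: sets.finite_UN simp: borel_compact compact_Int_closed)
  qed
  also have "\<dots> \<le> (\<Sum>p\<in>F. emeasure vol (cball p (d p) \<inter> K))"
    using F(2) K(1) by (intro emeasure_subadditive_finite) (auto simp: borel_compact)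
  also have "\<dots> < \<infinity>"
  proof -
    have "emeasure vol (cball p (d p) \<inter> K) < \<infinity>" if "p \<in> F" for p using F(1) d(2) that by blast
    then show ?thesis using F(2) by simp
  qed
  finally show ?thesis .
qed

end

section \<open>The divergence formula\<close>

lemma Ck_on_mult:
  fixes f g :: "'a::euclidean_space \<Rightarrow> real"
  assumes "open U" "Ck_on m f U" "Ck_on m g U"
  shows "Ck_on m (\<lambda>x. f x * g x) U"
  by (rule Ck_on_bilinear[OF assms(1) bounded_bilinear_mult assms(2,3)])

lemma Ck_on_prod:
  fixes f :: "'i \<Rightarrow> 'a::euclidean_space \<Rightarrow> real"
  assumes "open U" "\<And>i. i \<in> I \<Longrightarrow> Ck_on m (f i) U"
  shows "Ck_on m (\<lambda>x. \<Prod>i\<in>I. f i x) U"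
  using assms(2)
  by (induction I rule: infinite_finite_induct)
     (use assms(1) in \<open>auto intro!: Ck_on_const Ck_on_mult\<close>)

lemma Ck_on_det:
  fixes A :: "'a::euclidean_space \<Rightarrow> real^'k^'k"
  assumes "open U" "\<And>i j. Ck_on m (\<lambda>x. A x $ i $ j) U"
  shows "Ck_on m (\<lambda>x. det (A x)) U"
  unfolding det_def by (intro Ck_on_sum Ck_on_mult Ck_on_prod Ck_on_const assms)

text \<open>The family c * x powr s is closed under differentiation, so the induction runs over both
  constants.\<close>

lemma Ck_on_powr: "Ck_on m (\<lambda>x::real. c * x powr s) {0<..}"
proof (induction m arbitrary: c s)
  case 0
  then show ?case by (auto intro!: continuous_intros)
next
  case (Suc m)
  show ?case
  proof (rule Ck_on_SucI'[where f'="\<lambda>x v. (v * c * s) * x powr (s - 1)"])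
    fix x :: real assume "x \<in> {0<..}"
    then have "((\<lambda>x. c * x powr s) has_real_derivative c * (s * x powr (s - 1))) (at x)"
      by (intro DERIV_cmult has_real_derivative_powr) simp
    then show "((\<lambda>x. c * x powr s) has_derivative (\<lambda>v. v * c * s * x powr (s - 1))) (at x)"
      unfolding has_field_derivative_def by (rule has_derivative_eq_rhs) (simp add: fun_eq_iff)
  qed (use Suc in auto)
qed

text \<open>F vanishes on V off a compact subset of V, so its extension by 0 is continuously
  differentiable on the whole space and \<open>integral_derivative_zero\<close> applies.\<close>

lemma integral_frechet_derivative_zero:
  fixes F :: "'a::euclidean_space \<Rightarrow> real"
  assumes V: "open V" and F: "Ck_on 1 F V" and C: "compact C" "C \<subseteq> V" and F0: "\<And>y. y \<in> V \<Longrightarrow> y \<notin> C \<Longrightarrow> F y = 0"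
  shows "integrable lborel (\<lambda>y. indicator V y * frechet_derivative F (at y) v)"
    and "(\<integral>y. indicator V y * frechet_derivative F (at y) v \<partial>lborel) = 0"
proof -
  define G where "G y = (if y \<in> V then F y else 0)" for y
  define G' where "G' y w = indicator V y * frechet_derivative F (at y) w" for y w
  have D: "(F has_derivative frechet_derivative F (at y)) (at y)" if "y \<in> V" for y
    using Ck_on_SucD(1)[of 0 F V] F that by simp
  have oC: "open (- C)" using C(1) by (simp add: compact_imp_closed open_Compl)
  have G0: "(G has_derivative (\<lambda>_. 0)) (at y)" if "y \<notin> C" for y
    by (rule has_derivative_transform_within_open[OF has_derivative_const oC])
       (use that F0 in \<open>auto simp: G_def\<close>)
  have GV: "(G has_derivative frechet_derivative F (at y)) (at y)" if "y \<in> V" for y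
    by (rule has_derivative_transform_within_open[OF D[OF that] V that]) (simp add: G_def)
  have G'0: "G' y w = 0" if "y \<notin> C" for y w
  proof (cases "y \<in> V")
    case True
    have "frechet_derivative F (at y) = (\<lambda>_. 0)" by (rule has_derivative_unique[OF GV[OF True] G0[OF that]])
    then show ?thesis by (simp add: G'_def)
  qed (simp add: G'_def)
  have G'D: "(G has_derivative G' y) (at y)" for y
  proof (cases "y \<in> V")
    case True
    then have "G' y = frechet_derivative F (at y)" by (auto simp: G'_def)
    then show ?thesis using GV[OF True] by simp
  next
    case False
    then have "y \<notin> C" "G' y = (\<lambda>_. 0)" using C(2) by (auto simp: G'_def)
    then show ?thesis using G0 by simp
  qed
  have cV: "continuous_on V (\<lambda>y. G' y v)"
  proof -
    have "continuous_on V (\<lambda>y. frechet_derivative F (at y) v)" using F by simp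
    then show ?thesis by (rule continuous_on_eq) (simp add: G'_def)
  qed
  have cC: "continuous_on (- C) (\<lambda>y. G' y v)"
    by (rule continuous_on_eq[OF continuous_on_const[of _ 0]]) (simp add: G'0)
  have "continuous_on (V \<union> - C) (\<lambda>y. G' y v)" by (rule continuous_on_open_Un[OF V oC cV cC])
  moreover have "V \<union> - C = UNIV" using C(2) by blast
  ultimately have cont: "continuous_on UNIV (\<lambda>y. G' y v)" by simp
  have "integrable lborel (\<lambda>y. indicator C y *\<^sub>R G' y v)"
    by (rule borel_integrable_compact[OF C(1) continuous_on_subset[OF cont]]) simp
  moreover have "(\<lambda>y. indicator C y *\<^sub>R G' y v) = (\<lambda>y. indicator V y * frechet_derivative F (at y) v)"
    using G'0 by (auto simp: fun_eq_iff indicator_def G'_def)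
  ultimately show "integrable lborel (\<lambda>y. indicator V y * frechet_derivative F (at y) v)" by simp
  have "(\<integral>y. G' y v \<partial>lborel) = 0"
  proof (rule integral_derivative_zero[OF G'D cont, of C])
    show "bounded C" using C(1) by (rule compact_imp_bounded)
    show "G y = 0" if "y \<notin> C" for y using F0 that by (simp add: G_def)
  qed
  then show "(\<integral>y. indicator V y * frechet_derivative F (at y) v \<partial>lborel) = 0" by (simp add: G'_def)
qed

text \<open>Cramer's rule for the inverse matrix. The entries are quotients of determinants, which
  makes their smoothness visible.\<close>

definition minv :: "real^'k^'k \<Rightarrow> real^'k^'k" where
  "minv A = (\<chi> i j. det (\<chi> a b. if b = i then axis j 1 $ a else A $ a $ b) / det A)"

lemma minv_inverse:
  fixes A :: "real^'k^'k"
  assumes "det A \<noteq> 0"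
  shows "A ** minv A = mat 1" "minv A ** A = mat 1"
proof -
  have "(A ** minv A) $ a $ j = mat 1 $ a $ j" for a j
  proof -
    have "A *v (\<chi> i. minv A $ i $ j) = axis j 1"
      using cramer[OF assms, of "\<chi> i. minv A $ i $ j" "axis j 1"] by (simp add: minv_def vec_eq_iff)
    then have "(A *v (\<chi> i. minv A $ i $ j)) $ a = axis j 1 $ a" by simp
    then show ?thesis by (simp add: matrix_vector_mult_def matrix_matrix_mult_def mat_def axis_def)
  qed
  then show "A ** minv A = mat 1" by (simp add: vec_eq_iff)
  then show "minv A ** A = mat 1" using matrix_left_right_inverse by blast
qed

lemma minv_symmetric:
  fixes A :: "real^'k^'k"
  assumes "det A \<noteq> 0" "transpose A = A"
  shows "minv A $ i $ j = minv A $ j $ i"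
proof -
  have "transpose (minv A) ** A = mat 1"
    using arg_cong[OF minv_inverse(1)[OF assms(1)], of transpose] assms(2) by (simp add: matrix_transpose_mul transpose_mat)
  then have "transpose (minv A) = minv A"
    using minv_inverse(1)[OF assms(1)] by (metis matrix_mul_assoc matrix_mul_lid matrix_mul_rid)
  then show ?thesis by (metis (mono_tags) transpose_def vec_lambda_beta)
qed

section \<open>The Laplacian of the position vector on a minimal submanifold\<close>

context param_chart
begin

abbreviation e_ax :: "'k \<Rightarrow> real^'k" where "e_ax i \<equiv> axis i 1"

definition dPsi :: "'k \<Rightarrow> real^'k \<Rightarrow> 'n minkowski" where "dPsi i y = D\<Psi> y (e_ax i)"

definition ginv :: "'k \<Rightarrow> 'k \<Rightarrow> real^'k \<Rightarrow> real" where "ginv i j y = minv (gram \<Psi> y) $ i $ j"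

text \<open>The coefficients of the Laplace-Beltrami operator in divergence form, the density being
  included.\<close>

definition \<omega> :: "'k \<Rightarrow> 'k \<Rightarrow> real^'k \<Rightarrow> real" where "\<omega> i j y = jac \<Psi> y * ginv i j y"

lemma gram_dPsi: "gram \<Psi> y $ i $ j = lor (dPsi i y) (dPsi j y)"
  by (simp add: gram_def dPsi_def)

lemma det_gram_nz: "y \<in> V \<Longrightarrow> det (gram \<Psi> y) \<noteq> 0"
  using det_gram_pos by force

lemma ginv_gram:
  assumes "y \<in> V"
  shows "(\<Sum>j\<in>UNIV. ginv i j y * gram \<Psi> y $ j $ l) = (if i = l then 1 else 0)"
proof -
  have "(minv (gram \<Psi> y) ** gram \<Psi> y) $ i $ l = (mat 1 :: real^'k^'k) $ i $ l"
    using minv_inverse(2)[OF det_gram_nz[OF assms]] by simp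
  then show ?thesis by (simp add: matrix_matrix_mult_def mat_def ginv_def)
qed

lemma ginv_symmetric: "y \<in> V \<Longrightarrow> ginv i j y = ginv j i y"
  unfolding ginv_def
  by (rule minv_symmetric[OF det_gram_nz]) (auto simp: transpose_def gram_def vec_eq_iff lor_commute)

lemma Ck_dPsi: "Ck_on m (dPsi i) V"
  using smooth_on_deriv[OF smooth_\<Psi>] unfolding smooth_on_def dPsi_def[abs_def] by blast

lemma Ck_gram: "Ck_on m (\<lambda>y. gram \<Psi> y $ i $ j) V"
  unfolding gram_dPsi by (intro Ck_on_bilinear[OF open_V bounded_bilinear_lor] Ck_dPsi)

lemma jac_powr: "y \<in> V \<Longrightarrow> jac \<Psi> y = det (gram \<Psi> y) powr (1/2)"
  using det_gram_pos[of y] by (simp add: jac_def powr_half_sqrt)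

text \<open>The quotient sqrt(det g) / det g is written as det g to the power -1/2, which is smooth
  because det g > 0; the remaining factor is a determinant whose entries are Gram entries and
  constants.\<close>

lemma Ck_\<omega>: "Ck_on m (\<omega> i j) V"
proof (rule Ck_on_cong[OF open_V])
  let ?c = "\<lambda>y. det (\<chi> a b. if b = i then e_ax j $ a else gram \<Psi> y $ a $ b)"
  show "?c y * (1 * det (gram \<Psi> y) powr (- 1/2)) = \<omega> i j y" if "y \<in> V" for y
  proof -
    have "det (gram \<Psi> y) powr (- 1/2) = det (gram \<Psi> y) powr (1/2) / det (gram \<Psi> y)"
      using det_gram_pos[OF that] powr_diff[of "det (gram \<Psi> y)" "1/2" 1] by simp
    then show ?thesis using jac_powr[OF that] by (simp add: \<omega>_def ginv_def minv_def mult.commute)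
  qed
  have "Ck_on m ?c V"
  proof (rule Ck_on_det[OF open_V])
    fix a b
    show "Ck_on m (\<lambda>y. (\<chi> a b. if b = i then e_ax j $ a else gram \<Psi> y $ a $ b) $ a $ b) V"
      using Ck_gram[of m a b] Ck_on_const[OF open_V] by (cases "b = i") auto
  qed
  moreover have "Ck_on m (\<lambda>y. 1 * det (gram \<Psi> y) powr (- 1/2)) V"
    by (rule Ck_on_compose[OF open_V open_greaterThan[of 0] _ Ck_on_powr Ck_on_det[OF open_V Ck_gram]])
       (use det_gram_pos in auto)
  ultimately show "Ck_on m (\<lambda>y. ?c y * (1 * det (gram \<Psi> y) powr (- 1/2))) V"
    by (rule Ck_on_mult[OF open_V])
qed

lemma tangent_expansion:
  assumes "y \<in> V"
  shows "D\<Psi> y b = (\<Sum>i\<in>UNIV. (b $ i) *\<^sub>R dPsi i y)"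
  unfolding dPsi_def by (rule linear_axis_expansion[OF linear_D\<Psi>[OF assms]])

lemma dPsi_tangent: "y \<in> V \<Longrightarrow> dPsi i y \<in> tangent_space S (\<Psi> y)"
  by (simp add: tangent_space_eq dPsi_def)

lemma tangent_orthogonal_zero:
  assumes y: "y \<in> V" and t: "t \<in> tangent_space S (\<Psi> y)" "\<And>l. lor t (dPsi l y) = 0"
  shows "t = 0"
proof (rule lor_positive_orthogonal_zero[OF lor_positive_tangent[OF y] t(1)])
  fix v assume "v \<in> tangent_space S (\<Psi> y)"
  then obtain b where "v = D\<Psi> y b" using tangent_space_eq[OF y] by auto
  then show "lor t v = 0" using t(2) tangent_expansion[OF y] by (simp add: lor.sum_right lor_simps)
qed simp

text \<open>The double sum is tangent and has the same products with all coordinate vectors as w,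
  because \<open>ginv\<close> inverts the Gram matrix; this determines the projection.\<close>

lemma lor_proj_tangent:
  assumes y: "y \<in> V"
  shows "lor_proj (tangent_space S (\<Psi> y)) w = (\<Sum>i\<in>UNIV. \<Sum>j\<in>UNIV. (ginv i j y * lor w (dPsi j y)) *\<^sub>R dPsi i y)"
proof (rule lor_proj_unique[OF lor_positive_tangent[OF y]])
  let ?t = "\<Sum>i\<in>UNIV. \<Sum>j\<in>UNIV. (ginv i j y * lor w (dPsi j y)) *\<^sub>R dPsi i y"
  have sT: "subspace (tangent_space S (\<Psi> y))" using subspace_tangent_space[OF y] by simp
  show tT: "?t \<in> tangent_space S (\<Psi> y)"
    by (intro subspace_sum[OF sT] subspace_scale[OF sT] dPsi_tangent[OF y])
  have lt: "lor ?t (dPsi l y) = lor w (dPsi l y)" for l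
  proof -
    have "lor ?t (dPsi l y) = (\<Sum>i\<in>UNIV. \<Sum>j\<in>UNIV. ginv i j y * lor w (dPsi j y) * gram \<Psi> y $ i $ l)"
      by (simp add: lor.sum_left lor_simps gram_dPsi)
    also have "\<dots> = (\<Sum>j\<in>UNIV. lor w (dPsi j y) * (\<Sum>i\<in>UNIV. ginv j i y * gram \<Psi> y $ i $ l))"
      by (subst sum.swap) (simp add: sum_distrib_left ginv_symmetric[OF y, of _] mult_ac)
    also have "\<dots> = lor w (dPsi l y)" by (simp add: ginv_gram[OF y] if_distrib[of "\<lambda>u. _ * u"] cong: if_cong)
    finally show ?thesis .
  qed
  fix v assume "v \<in> tangent_space S (\<Psi> y)"
  then obtain b where "v = D\<Psi> y b" using tangent_space_eq[OF y] by auto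
  then have "lor (w - ?t) v = (\<Sum>i\<in>UNIV. b $ i * lor (w - ?t) (dPsi i y))"
    using tangent_expansion[OF y] by (simp add: lor.sum_right lor_simps)
  also have "\<dots> = 0" using lt by (simp add: lor.diff_left)
  finally show "lor (w - ?t) v = 0" .
qed simp

lemma deriv2_bilinear_expansion:
  assumes y: "y \<in> V"
  shows "deriv2 \<Psi> y b c = (\<Sum>i\<in>UNIV. \<Sum>j\<in>UNIV. (b $ i * c $ j) *\<^sub>R deriv2 \<Psi> y (e_ax i) (e_ax j))"
proof -
  have "deriv2 \<Psi> y b c = (\<Sum>i\<in>UNIV. (b $ i) *\<^sub>R deriv2 \<Psi> y (e_ax i) c)"
    by (rule linear_axis_expansion[OF linear_deriv2_left[OF smooth_\<Psi> y]])
  also have "\<dots> = (\<Sum>i\<in>UNIV. (b $ i) *\<^sub>R (\<Sum>j\<in>UNIV. (c $ j) *\<^sub>R deriv2 \<Psi> y (e_ax i) (e_ax j)))"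
    by (intro sum.cong refl arg_cong[where f="(*\<^sub>R) _"] linear_axis_expansion[OF linear_deriv2_right[OF open_V smooth_\<Psi> y]])
  finally show ?thesis by (simp add: scaleR_sum_right)
qed

text \<open>A trace over an orthonormal basis is the trace against the inverse Gram matrix: if E e
  are the coordinates of the basis vectors, the matrix with entries the sums of E e $ i * E e $ j
  over e inverts the Gram matrix.\<close>

lemma minimal_trace:
  assumes y: "y \<in> V" and mc: "mean_curvature S (\<Psi> y) = 0"
  shows "(\<Sum>i\<in>UNIV. \<Sum>j\<in>UNIV. ginv i j y *\<^sub>R deriv2 \<Psi> y (e_ax i) (e_ax j)) - real CARD('k) *\<^sub>R \<Psi> y
     \<in> tangent_space S (\<Psi> y)"
proof -
  let ?T = "tangent_space S (\<Psi> y)"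
  define B where "B = (SOME B. orthonormal_basis ?T B)"
  define E where "E e = D\<Phi> (\<Psi> y) e" for e
  have T: "lor_positive ?T" by (rule lor_positive_tangent[OF y]) simp
  have B: "orthonormal_basis ?T B" unfolding B_def by (rule orthonormal_basis_some[OF T])
  define M where "M = (\<chi> i j. \<Sum>e\<in>B. E e $ i * E e $ j)"
  have "(M ** gram \<Psi> y) $ i $ l = mat 1 $ i $ l" for i l
  proof -
    have eT: "D\<Psi> y (E e) = e" if "e \<in> B" for e
      unfolding E_def using D\<Phi>_tangent(2)[OF y UNIV_I, of e] that B unfolding orthonormal_basis_def by blast
    have "(M ** gram \<Psi> y) $ i $ l = (\<Sum>e\<in>B. E e $ i * (\<Sum>j\<in>UNIV. E e $ j * gram \<Psi> y $ j $ l))"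
      by (simp add: matrix_matrix_mult_def M_def sum_distrib_left sum_distrib_right mult.assoc) (rule sum.swap)
    also have "\<dots> = (\<Sum>e\<in>B. E e $ i * lor (D\<Psi> y (E e)) (dPsi l y))"
      by (simp add: tangent_expansion[OF y] lor.sum_left lor_simps gram_dPsi)
    also have "\<dots> = (\<Sum>e\<in>B. lor (dPsi l y) e * E e $ i)"
      using eT by (intro sum.cong) (auto simp: lor_commute mult.commute)
    also have "\<dots> = E (\<Sum>e\<in>B. lor (dPsi l y) e *\<^sub>R e) $ i"
      using linear_D\<Phi>[OF \<Psi>_in(2)[OF y UNIV_I]] by (simp add: E_def linear_sum linear_scale)
    also have "(\<Sum>e\<in>B. lor (dPsi l y) e *\<^sub>R e) = dPsi l y"
      by (rule orthonormal_basis_expansion[OF T B dPsi_tangent[OF y], symmetric])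
    also have "E (dPsi l y) = e_ax l" unfolding E_def dPsi_def by (rule D\<Phi>_D\<Psi>[OF y]) auto
    finally show ?thesis by (simp add: mat_def axis_def)
  qed
  then have "M ** gram \<Psi> y = mat 1" by (simp add: vec_eq_iff)
  then have "M = minv (gram \<Psi> y)"
    using minv_inverse(1)[OF det_gram_nz[OF y]] by (metis matrix_mul_assoc matrix_mul_lid matrix_mul_rid)
  then have M: "ginv i j y = (\<Sum>e\<in>B. E e $ i * E e $ j)" for i j
    by (metis (no_types, lifting) M_def ginv_def vec_lambda_beta)
  have "(\<Sum>e\<in>B. deriv2 \<Psi> y (E e) (E e)) = (\<Sum>e\<in>B. \<Sum>i\<in>UNIV. \<Sum>j\<in>UNIV. (E e $ i * E e $ j) *\<^sub>R deriv2 \<Psi> y (e_ax i) (e_ax j))"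
    by (intro sum.cong refl deriv2_bilinear_expansion[OF y])
  also have "\<dots> = (\<Sum>i\<in>UNIV. \<Sum>j\<in>UNIV. \<Sum>e\<in>B. (E e $ i * E e $ j) *\<^sub>R deriv2 \<Psi> y (e_ax i) (e_ax j))"
    by (subst sum.swap, intro sum.cong refl sum.swap)
  also have "\<dots> = (\<Sum>i\<in>UNIV. \<Sum>j\<in>UNIV. ginv i j y *\<^sub>R deriv2 \<Psi> y (e_ax i) (e_ax j))"
    by (simp add: M scaleR_sum_left)
  finally have "(\<Sum>e\<in>B. deriv2 \<Psi> y (E e) (E e)) = (\<Sum>i\<in>UNIV. \<Sum>j\<in>UNIV. ginv i j y *\<^sub>R deriv2 \<Psi> y (e_ax i) (e_ax j))" .
  moreover have "(\<Sum>e\<in>B. deriv2 \<Psi> y (E e) (E e)) - real (dim (UNIV :: (real^'k) set)) *\<^sub>R \<Psi> y \<in> ?T"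
    unfolding B_def E_def by (rule mean_curvature_zero_deriv2[OF y UNIV_I mc])
  ultimately show ?thesis by (simp add: dim_UNIV)
qed

abbreviation D\<omega> where "D\<omega> i j y \<equiv> frechet_derivative (\<omega> i j) (at y)"

lemma \<omega>_has_derivative: "y \<in> V \<Longrightarrow> (\<omega> i j has_derivative D\<omega> i j y) (at y)"
  using Ck_on_SucD(1)[OF Ck_\<omega>[of "Suc 0"]] by simp

lemma dPsi_has_derivative: "y \<in> V \<Longrightarrow> (dPsi i has_derivative (\<lambda>v. deriv2 \<Psi> y v (e_ax i))) (at y)"
  unfolding dPsi_def[abs_def] by (rule has_derivative_deriv2[OF smooth_\<Psi>])

lemma gram_has_derivative:
  "y \<in> V \<Longrightarrow> ((\<lambda>y. gram \<Psi> y $ i $ j) has_derivative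
     (\<lambda>v. lor (dPsi i y) (deriv2 \<Psi> y v (e_ax j)) + lor (deriv2 \<Psi> y v (e_ax i)) (dPsi j y))) (at y)"
  unfolding gram_dPsi by (intro lor.FDERIV dPsi_has_derivative)

text \<open>Jacobi's formula under the square root gives half the trace of the inverse Gram matrix
  times the derivative of the Gram matrix. The two terms of that derivative contribute equally by
  symmetry, which cancels the factor 1/2.\<close>

lemma jac_has_derivative:
  assumes y: "y \<in> V"
  shows "(jac \<Psi> has_derivative (\<lambda>v. \<Sum>i\<in>UNIV. \<Sum>j\<in>UNIV. \<omega> i j y * lor (deriv2 \<Psi> y v (e_ax i)) (dPsi j y))) (at y)"
proof -
  let ?g = "gram \<Psi> y" and ?a = "\<lambda>v i j. lor (deriv2 \<Psi> y v (e_ax i)) (dPsi j y)"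
  let ?S = "\<lambda>v. \<Sum>i\<in>UNIV. \<Sum>j\<in>UNIV. (lor (dPsi i y) (deriv2 \<Psi> y v (e_ax j)) + ?a v i j) * minv ?g $ j $ i"
  have "((\<lambda>y. det (gram \<Psi> y)) has_derivative (\<lambda>v. det ?g * ?S v)) (at y)"
    by (rule has_derivative_det[OF gram_has_derivative[OF y] minv_inverse(2)[OF det_gram_nz[OF y]]])
  then have d: "(jac \<Psi> has_derivative (\<lambda>v. det ?g * ?S v * (inverse (sqrt (det ?g)) / 2))) (at y)"
    unfolding jac_def[abs_def]
    by (rule has_derivative_eq_rhs[OF has_derivative_real_sqrt[of "\<lambda>y. det (gram \<Psi> y)" y, OF det_gram_pos[OF y]]]) auto
  have S: "?S v = 2 * (\<Sum>i\<in>UNIV. \<Sum>j\<in>UNIV. ginv i j y * ?a v i j)" for v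
  proof -
    have "?S v = (\<Sum>i\<in>UNIV. \<Sum>j\<in>UNIV. ginv j i y * ?a v j i) + (\<Sum>i\<in>UNIV. \<Sum>j\<in>UNIV. ginv j i y * ?a v i j)"
      by (simp add: ginv_def distrib_right distrib_left sum.distrib lor_commute mult.commute)
    moreover have "(\<Sum>i\<in>UNIV. \<Sum>j\<in>UNIV. ginv j i y * ?a v j i) = (\<Sum>i\<in>UNIV. \<Sum>j\<in>UNIV. ginv i j y * ?a v i j)"
      by (rule sum.swap)
    ultimately show ?thesis by (simp add: ginv_symmetric[OF y])
  qed
  have "det ?g * ?S v * (inverse (sqrt (det ?g)) / 2) = (\<Sum>i\<in>UNIV. \<Sum>j\<in>UNIV. \<omega> i j y * ?a v i j)" for v
  proof -
    have "det ?g * inverse (sqrt (det ?g)) = jac \<Psi> y"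
      using det_gram_pos[OF y] by (simp add: jac_def field_simps)
    then have "det ?g * ?S v * (inverse (sqrt (det ?g)) / 2) = jac \<Psi> y * (\<Sum>i\<in>UNIV. \<Sum>j\<in>UNIV. ginv i j y * ?a v i j)"
      unfolding S by (simp add: mult_ac)
    then show ?thesis by (simp add: \<omega>_def sum_distrib_left mult.assoc)
  qed
  then show ?thesis using d by simp
qed

text \<open>The coordinate divergence of $\sqrt{\det g}\,g^{ij}\partial_j\Psi$ is orthogonal to the surface,
  and minimality determines its normal component.\<close>

lemma laplacian_position:
  assumes y: "y \<in> V" and mc: "mean_curvature S (\<Psi> y) = 0"
  shows "(\<Sum>i\<in>UNIV. \<Sum>j\<in>UNIV. D\<omega> i j y (e_ax i) *\<^sub>R dPsi j y + \<omega> i j y *\<^sub>R deriv2 \<Psi> y (e_ax i) (e_ax j))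
    = (jac \<Psi> y * CARD('k)) *\<^sub>R \<Psi> y" (is "?Z = _")
proof -
  let ?T = "tangent_space S (\<Psi> y)"
  let ?d = "\<lambda>i j. deriv2 \<Psi> y (e_ax i) (e_ax j)"
  have sT: "subspace ?T" using subspace_tangent_space[OF y] by simp
  have Zl: "lor ?Z (dPsi l y) = 0" for l
  proof -
    \<comment> \<open>The derivative, in the i-th coordinate direction, of the identity that the sum
      over j of \<omega> i j times the Gram entry (j,l) equals the density for i = l and 0
      otherwise.\<close>
    have eq: "(\<Sum>j\<in>UNIV. D\<omega> i j y (e_ax i) * gram \<Psi> y $ j $ l) +
        (\<Sum>j\<in>UNIV. \<omega> i j y * (lor (dPsi j y) (?d i l) + lor (?d i j) (dPsi l y))) =
        (if i = l then (\<Sum>a\<in>UNIV. \<Sum>b\<in>UNIV. \<omega> a b y * lor (?d l a) (dPsi b y)) else 0)" for i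
    proof -
      have "((\<lambda>y. \<Sum>j\<in>UNIV. \<omega> i j y * gram \<Psi> y $ j $ l) has_derivative
         (\<lambda>v. \<Sum>j\<in>UNIV. \<omega> i j y * (lor (dPsi j y) (deriv2 \<Psi> y v (e_ax l)) + lor (deriv2 \<Psi> y v (e_ax j)) (dPsi l y))
             + D\<omega> i j y v * gram \<Psi> y $ j $ l)) (at y)"
        by (intro has_derivative_sum has_derivative_mult \<omega>_has_derivative gram_has_derivative y)
      moreover have "((\<lambda>y. \<Sum>j\<in>UNIV. \<omega> i j y * gram \<Psi> y $ j $ l) has_derivative
         (\<lambda>v. if i = l then (\<Sum>a\<in>UNIV. \<Sum>b\<in>UNIV. \<omega> a b y * lor (deriv2 \<Psi> y v (e_ax a)) (dPsi b y)) else 0)) (at y)"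
      proof (rule has_derivative_transform_within_open[OF _ open_V y])
        show "((\<lambda>y. if i = l then jac \<Psi> y else 0) has_derivative
         (\<lambda>v. if i = l then (\<Sum>a\<in>UNIV. \<Sum>b\<in>UNIV. \<omega> a b y * lor (deriv2 \<Psi> y v (e_ax a)) (dPsi b y)) else 0)) (at y)"
          using jac_has_derivative[OF y] by (cases "i = l") auto
        show "(if i = l then jac \<Psi> z else 0) = (\<Sum>j\<in>UNIV. \<omega> i j z * gram \<Psi> z $ j $ l)" if "z \<in> V" for z
          using ginv_gram[OF that, of i l] by (simp add: \<omega>_def mult.assoc sum_distrib_left[symmetric])
      qed
      ultimately have "(\<lambda>v. \<Sum>j\<in>UNIV. \<omega> i j y * (lor (dPsi j y) (deriv2 \<Psi> y v (e_ax l)) + lor (deriv2 \<Psi> y v (e_ax j)) (dPsi l y))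
             + D\<omega> i j y v * gram \<Psi> y $ j $ l) =
         (\<lambda>v. if i = l then (\<Sum>a\<in>UNIV. \<Sum>b\<in>UNIV. \<omega> a b y * lor (deriv2 \<Psi> y v (e_ax a)) (dPsi b y)) else 0)"
        by (rule has_derivative_unique)
      from fun_cong[OF this, of "e_ax i"] show ?thesis by (auto simp: sum.distrib)
    qed
    have "lor ?Z (dPsi l y) = (\<Sum>i\<in>UNIV. (\<Sum>j\<in>UNIV. D\<omega> i j y (e_ax i) * gram \<Psi> y $ j $ l) + (\<Sum>j\<in>UNIV. \<omega> i j y * lor (?d i j) (dPsi l y)))"
      by (simp add: lor.sum_left lor_simps gram_dPsi sum.distrib)
    also have "\<dots> = (\<Sum>i\<in>UNIV. (if i = l then (\<Sum>a\<in>UNIV. \<Sum>b\<in>UNIV. \<omega> a b y * lor (?d l a) (dPsi b y)) else 0)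
         - (\<Sum>j\<in>UNIV. \<omega> i j y * lor (dPsi j y) (?d i l)))"
    proof (rule sum.cong[OF refl])
      fix i
      show "(\<Sum>j\<in>UNIV. D\<omega> i j y (e_ax i) * gram \<Psi> y $ j $ l) + (\<Sum>j\<in>UNIV. \<omega> i j y * lor (?d i j) (dPsi l y)) =
        (if i = l then (\<Sum>a\<in>UNIV. \<Sum>b\<in>UNIV. \<omega> a b y * lor (?d l a) (dPsi b y)) else 0)
         - (\<Sum>j\<in>UNIV. \<omega> i j y * lor (dPsi j y) (?d i l))"
        unfolding eq[of i, symmetric] by (simp add: distrib_left sum.distrib)
    qed
    also have "\<dots> = (\<Sum>a\<in>UNIV. \<Sum>b\<in>UNIV. \<omega> a b y * lor (?d l a) (dPsi b y)) - (\<Sum>i\<in>UNIV. \<Sum>j\<in>UNIV. \<omega> i j y * lor (dPsi j y) (?d i l))"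
      by (simp add: sum_subtractf)
    \<comment> \<open>The two double sums coincide by the symmetry of second derivatives.\<close>
    also have "\<dots> = 0"
      by (simp add: deriv2_symmetric[OF open_V smooth_\<Psi> y, of "e_ax l"] lor_commute)
    finally show ?thesis .
  qed
  let ?W = "?Z - (jac \<Psi> y * CARD('k)) *\<^sub>R \<Psi> y"
  have "?W = (\<Sum>i\<in>UNIV. \<Sum>j\<in>UNIV. D\<omega> i j y (e_ax i) *\<^sub>R dPsi j y) +
      jac \<Psi> y *\<^sub>R ((\<Sum>i\<in>UNIV. \<Sum>j\<in>UNIV. ginv i j y *\<^sub>R ?d i j) - real CARD('k) *\<^sub>R \<Psi> y)"
    by (simp add: sum.distrib \<omega>_def scaleR_diff_right scaleR_sum_right)
  also have "\<dots> \<in> ?T"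
    by (intro subspace_add[OF sT] subspace_sum[OF sT] subspace_scale[OF sT] dPsi_tangent minimal_trace y mc)
  finally have "?W \<in> ?T" .
  moreover have "lor ?W (dPsi l y) = 0" for l
    using Zl[of l] tangent_perp[OF y UNIV_I dPsi_tangent[OF y], of l] lor_commute[of "\<Psi> y"] by (simp add: lor_simps)
  ultimately have "?W = 0" by (rule tangent_orthogonal_zero[OF y])
  then show ?thesis by simp
qed

end

section \<open>Continuously differentiable cutoffs\<close>

lemma DERIV_pos_part_square: "((\<lambda>s::real. (max 0 s)\<^sup>2) has_real_derivative 2 * max 0 s) (at s)"
proof (cases s "0::real" rule: linorder_cases)
  case less
  have "((\<lambda>s::real. 0) has_real_derivative 0) (at s)" by simp
  then have "((\<lambda>s::real. (max 0 s)\<^sup>2) has_real_derivative 0) (at s)"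
    by (rule has_field_derivative_transform_within_open[of _ _ _ "{..<0}"]) (use less in auto)
  then show ?thesis using less by simp
next
  case greater
  have "((\<lambda>s::real. s\<^sup>2) has_real_derivative 2 * s) (at s)" by (auto intro!: derivative_eq_intros)
  then have "((\<lambda>s::real. (max 0 s)\<^sup>2) has_real_derivative 2 * s) (at s)"
    by (rule has_field_derivative_transform_within_open[of _ _ _ "{0<..}"]) (use greater in auto)
  then show ?thesis using greater by simp
next
  case equal
  have "((\<lambda>h::real. (max 0 h)\<^sup>2 / h) \<longlongrightarrow> 0) (at 0)"
  proof (rule Lim_null_comparison)
    show "\<forall>\<^sub>F h in at 0. norm ((max 0 h)\<^sup>2 / h :: real) \<le> \<bar>h\<bar>"
      by (rule always_eventually) (auto simp: max_def power2_eq_square)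
    show "((\<lambda>h::real. \<bar>h\<bar>) \<longlongrightarrow> 0) (at 0)" using tendsto_rabs[OF tendsto_ident_at, of 0 UNIV] by simp
  qed
  then show ?thesis using equal by (simp add: DERIV_def)
qed

lemma Ck_on_pos_part_square: "Ck_on 1 (\<lambda>s::real. (max 0 s)\<^sup>2) UNIV"
proof -
  have "Ck_on (Suc 0) (\<lambda>s::real. (max 0 s)\<^sup>2) UNIV"
  proof (rule Ck_on_SucI'[where f'="\<lambda>s v. v * (2 * max 0 s)"])
    show "((\<lambda>s::real. (max 0 s)\<^sup>2) has_derivative (\<lambda>v. v * (2 * max 0 s))) (at s)" for s
      using DERIV_pos_part_square[of s] unfolding has_field_derivative_def by (rule has_derivative_eq_rhs) auto
    show "Ck_on 0 (\<lambda>s::real. v * (2 * max 0 s)) UNIV" for v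
      by (auto intro!: continuous_intros)
  qed auto
  then show ?thesis by simp
qed

text \<open>Squares of positive parts are once continuously differentiable, which is what the
  divergence formula asks of its functions. The inner function s is at least 3d^2 on the ball and at
  most 0 outside the doubled ball; dividing by (3d^2)^2 lets the outer truncation saturate at
  1.\<close>

lemma bump_exists:
  fixes p :: "'a::euclidean_space"
  assumes "0 < d"
  obtains \<beta> :: "'a \<Rightarrow> real" where "Ck_on 1 \<beta> UNIV" "\<And>q. q \<in> ball p d \<Longrightarrow> \<beta> q = 1" "\<And>q. q \<notin> cball p (2 * d) \<Longrightarrow> \<beta> q = 0"
proof -
  define s where "s q = 4 * d\<^sup>2 + - 1 * ((q + - p) \<bullet> (q + - p))" for q
  define \<beta> where "\<beta> q = 1 + - 1 * (max 0 (1 + - (1 / (3 * d\<^sup>2)\<^sup>2) * (max 0 (s q))\<^sup>2))\<^sup>2" for q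
  have c: "Ck_on m (\<lambda>_. c :: 'b::euclidean_space) (UNIV :: 'a set)" for c m by (rule Ck_on_const) simp
  have i: "Ck_on m (\<lambda>q. q) (UNIV :: 'a set)" for m by (rule Ck_on_bounded_linear) auto
  have "Ck_on 1 s UNIV"
    unfolding s_def[abs_def]
    by (intro Ck_on_add Ck_on_mult Ck_on_bilinear[OF _ bounded_bilinear_inner] c i) auto
  then have "Ck_on 1 (\<lambda>q. (max 0 (s q))\<^sup>2) UNIV"
    by (intro Ck_on_compose[OF _ _ _ Ck_on_pos_part_square]) auto
  then have "Ck_on 1 (\<lambda>q. 1 + - (1 / (3 * d\<^sup>2)\<^sup>2) * (max 0 (s q))\<^sup>2) UNIV"
    by (intro Ck_on_add Ck_on_mult c) auto
  then have "Ck_on 1 (\<lambda>q. (max 0 (1 + - (1 / (3 * d\<^sup>2)\<^sup>2) * (max 0 (s q))\<^sup>2))\<^sup>2) UNIV"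
    by (intro Ck_on_compose[OF _ _ _ Ck_on_pos_part_square]) auto
  then have "Ck_on 1 \<beta> UNIV"
    unfolding \<beta>_def[abs_def] by (intro Ck_on_add Ck_on_mult c) auto
  moreover have "\<beta> q = 1" if "q \<in> ball p d" for q
  proof -
    have "(norm (q - p))\<^sup>2 \<le> d\<^sup>2" using that by (intro power_mono) (auto simp: dist_norm norm_minus_commute)
    then have "3 * d\<^sup>2 \<le> s q" by (simp add: s_def power2_norm_eq_inner)
    then have "(3 * d\<^sup>2)\<^sup>2 \<le> (max 0 (s q))\<^sup>2" by (intro power_mono) auto
    then have "1 \<le> (1 / (3 * d\<^sup>2)\<^sup>2) * (max 0 (s q))\<^sup>2" using assms by (simp add: field_simps)
    then show ?thesis by (simp add: \<beta>_def)
  qed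
  moreover have "\<beta> q = 0" if "q \<notin> cball p (2 * d)" for q
  proof -
    have "(2 * d)\<^sup>2 \<le> (norm (q - p))\<^sup>2" using that assms by (intro power_mono) (auto simp: dist_norm norm_minus_commute)
    then have "s q \<le> 0" by (simp add: s_def power2_norm_eq_inner power_mult_distrib)
    then show ?thesis by (simp add: \<beta>_def)
  qed
  ultimately show ?thesis by (rule that)
qed

lemma continuous_on_local:
  fixes f :: "'a::metric_space \<Rightarrow> 'b::topological_space"
  assumes "\<And>p. p \<in> S \<Longrightarrow> \<exists>W. open W \<and> p \<in> W \<and> continuous_on (S \<inter> W) f"
  shows "continuous_on S f"
  unfolding continuous_on_eq_continuous_within
proof
  fix p assume "p \<in> S"
  then obtain W where W: "open W" "p \<in> W" "continuous_on (S \<inter> W) f" using assms by blast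
  then have "continuous (at p within S \<inter> W) f" using \<open>p \<in> S\<close> by (simp add: continuous_on_eq_continuous_within)
  moreover have "at p within S = at p within (S \<inter> W)" by (rule at_within_nhd[OF W(2,1)]) blast
  ultimately show "continuous (at p within S) f" by simp
qed

text \<open>f vanishes along every curve of S near p. Its derivative in ambient directions may well
  be nonzero, so only tangent vectors are treated.\<close>

lemma derivative_tangent_zero:
  assumes f: "(f has_derivative f') (at p)" and v: "v \<in> tangent_space S p" and N: "open N" "p \<in> N"
    and f0: "\<And>q. q \<in> S \<Longrightarrow> q \<in> N \<Longrightarrow> f q = (0::'b::real_normed_vector)"
  shows "f' v = 0"
proof -
  obtain e \<gamma> where e: "e > 0" "smooth_on \<gamma> {-e<..<e}" "\<gamma> ` {-e<..<e} \<subseteq> S" "\<gamma> 0 = p"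
    and d: "(\<gamma> has_vector_derivative v) (at (0::real))"
    using v by (auto simp: tangent_space_def)
  have "((\<lambda>t. f (\<gamma> t)) has_vector_derivative f' v) (at 0)"
    using vector_derivative_diff_chain_within[OF d, of f f'] f e(4) by (simp add: o_def has_derivative_at_withinI)
  moreover have "((\<lambda>t. f (\<gamma> t)) has_vector_derivative 0) (at 0)"
  proof (rule has_vector_derivative_transform_within_open[OF has_vector_derivative_const])
    show "open ({-e<..<e} \<inter> \<gamma> -` N)"
      by (rule continuous_open_preimage[OF smooth_on_continuous[OF e(2)] _ N(1)]) simp
    show "0 = f (\<gamma> t)" if "t \<in> {-e<..<e} \<inter> \<gamma> -` N" for t using f0 that e(3) by force
  qed (use e N in auto)
  ultimately show ?thesis by (rule vector_derivative_unique_at)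
qed

lemma (in param_chart) continuous_ginv: "continuous_on V (ginv i j)"
proof -
  have "continuous_on V (\<lambda>y. \<omega> i j y / jac \<Psi> y)"
    using Ck_\<omega>[of 0 i j] continuous_on_gram(2)[OF smooth_\<Psi>] jac_pos by (intro continuous_intros) force+
  then show ?thesis by (rule continuous_on_eq) (use jac_pos in \<open>force simp: \<omega>_def\<close>)
qed

section \<open>From one chart to the whole submanifold\<close>

context atlas
begin

text \<open>For fixed w this is the gradient on S of the linear function p -> <p,w>.\<close>

abbreviation tang where "tang w p \<equiv> lor_proj (tangent_space S p) w"

lemma continuous_tang: "continuous_on S (tang w)"
proof (rule continuous_on_local)
  fix p assume p: "p \<in> S"
  obtain W and V :: "(real^'k) set" and \<Phi> \<Psi> where c: "p \<in> W" "param_chart S W V \<Phi> \<Psi>"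
    using param_chart_exists[OF submanifold_S S_hyp p] .
  interpret param_chart S W V \<Phi> \<Psi> by (rule c(2))
  have c\<Phi>: "continuous_on (S \<inter> W) \<Phi>" by (rule continuous_on_subset[OF smooth_on_continuous[OF smooth_\<Phi>]]) simp
  have sub: "\<Phi> ` (S \<inter> W) \<subseteq> V" using \<Phi>_in(1) by blast
  have cR: "continuous_on V (dPsi i)" for i using Ck_dPsi[of 0 i] by simp
  have "continuous_on V (\<lambda>y. \<Sum>i\<in>UNIV. \<Sum>j\<in>UNIV. (ginv i j y * lor w (dPsi j y)) *\<^sub>R dPsi i y)"
    by (intro continuous_intros continuous_ginv lor.continuous_on cR)
  from continuous_on_compose2[OF this c\<Phi> sub]
  have "continuous_on (S \<inter> W) (tang w)"
  proof (rule continuous_on_eq)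
    fix q assume "q \<in> S \<inter> W"
    then show "(\<Sum>i\<in>UNIV. \<Sum>j\<in>UNIV. (ginv i j (\<Phi> q) * lor w (dPsi j (\<Phi> q))) *\<^sub>R dPsi i (\<Phi> q)) = tang w q"
      using lor_proj_tangent[OF \<Phi>_in(1)[of q], of w] \<Psi>_\<Phi>[of q] by simp
  qed
  then show "\<exists>W. open W \<and> p \<in> W \<and> continuous_on (S \<inter> W) (tang w)" using open_W c(1) by blast
qed

text \<open>On a minimal S this is the divergence of f grad x for x = <.,\<nu>>, with the Laplacian
  of x already replaced by k x. The indicator makes it a function on the ambient space.\<close>

definition div_grad :: "'n minkowski \<Rightarrow> ('n minkowski \<Rightarrow> real) \<Rightarrow> 'n minkowski \<Rightarrow> real" where
  "div_grad \<nu> f p = indicator S p * (frechet_derivative f (at p) (tang \<nu> p) + CARD('k) * lor p \<nu> * f p)"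

context
  fixes f :: "'n minkowski \<Rightarrow> real" and N K :: "'n minkowski set"
  assumes N: "open N" "S \<subseteq> N" and f: "Ck_on 1 f N" and K: "compact K" "K \<subseteq> S" and f0: "\<And>p. p \<in> S \<Longrightarrow> p \<notin> K \<Longrightarrow> f p = 0"
begin

lemma f_has_derivative: "p \<in> S \<Longrightarrow> (f has_derivative frechet_derivative f (at p)) (at p)"
  using Ck_on_SucD(1)[OF f[unfolded One_nat_def]] N(2) by blast

lemma lor_positive_S:
  assumes "p \<in> S" shows "lor_positive (tangent_space S p)"
proof -
  obtain W and V :: "(real^'k) set" and \<Phi> \<Psi> where c: "p \<in> W" "param_chart S W V \<Phi> \<Psi>"
    using param_chart_exists[OF submanifold_S S_hyp assms] .
  interpret param_chart S W V \<Phi> \<Psi> by (rule c(2))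
  show ?thesis using lor_positive_tangent[of "\<Phi> p"] \<Phi>_in(1)[OF assms c(1)] \<Psi>_\<Phi>[OF assms c(1)] by simp
qed

lemma div_grad_zero: "p \<notin> K \<Longrightarrow> div_grad \<nu> f p = 0"
proof (cases "p \<in> S")
  case True
  assume "p \<notin> K"
  have "frechet_derivative f (at p) (tang \<nu> p) = 0"
    by (rule derivative_tangent_zero[OF f_has_derivative[OF True] lor_proj_in[OF lor_positive_S[OF True]], of "- K"])
       (use K f0 \<open>p \<notin> K\<close> in \<open>auto intro: compact_imp_closed\<close>)
  then show ?thesis using f0[OF True \<open>p \<notin> K\<close>] by (simp add: div_grad_def)
qed (simp add: div_grad_def)

lemma continuous_div_grad: "continuous_on S (\<lambda>p. frechet_derivative f (at p) (tang \<nu> p) + CARD('k) * lor p \<nu> * f p)"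
proof -
  have cD: "continuous_on S (\<lambda>p. frechet_derivative f (at p) b)" for b
    using Ck_on_SucD(2)[OF f[unfolded One_nat_def], of b] N(2) by (simp add: continuous_on_subset)
  have cf: "continuous_on S f" using Ck_on_mono[OF f[unfolded One_nat_def]] N(2) by (simp add: continuous_on_subset)
  have "continuous_on S (\<lambda>p. \<Sum>b\<in>Basis. (tang \<nu> p \<bullet> b) *\<^sub>R frechet_derivative f (at p) b)"
    by (intro continuous_intros cD continuous_tang)
  then have "continuous_on S (\<lambda>p. frechet_derivative f (at p) (tang \<nu> p))"
    by (rule continuous_on_eq) (rule linear_Basis_expansion[OF has_derivative_linear[OF f_has_derivative], symmetric])
  then show ?thesis by (intro continuous_intros lor.continuous_on cf)
qed

lemma div_grad_measurable: "div_grad \<nu> f \<in> borel_measurable borel"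
  unfolding div_grad_def[abs_def]
  using borel_measurable_continuous_on_indicator[OF borel_closed[OF closed_S] continuous_div_grad] by simp

lemma div_grad_integrable: "integrable vol (div_grad \<nu> f)"
proof -
  let ?h = "\<lambda>p. frechet_derivative f (at p) (tang \<nu> p) + CARD('k) * lor p \<nu> * f p"
  have "compact (?h ` K)"
    by (rule compact_continuous_image[OF continuous_on_subset[OF continuous_div_grad K(2)] K(1)])
  then have "\<exists>B. \<forall>x\<in>?h ` K. norm x \<le> B"
    using compact_imp_bounded[of "?h ` K"] by (simp only: bounded_iff)
  then obtain B where "\<forall>x\<in>?h ` K. norm x \<le> B" ..
  then have B: "norm (?h p) \<le> B" if "p \<in> K" for p using that by blast
  show ?thesis
  proof (rule integrableI_bounded_set[where A=K and B=B])
    show "K \<in> sets vol" using K(1) by (simp add: borel_compact)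
    show "div_grad \<nu> f \<in> borel_measurable vol" using div_grad_measurable by simp
    show "emeasure vol K < \<infinity>" by (rule emeasure_vol_compact[OF K])
    show "AE p in vol. p \<in> K \<longrightarrow> norm (div_grad \<nu> f p) \<le> B"
      using B K(2) by (intro always_eventually) (auto simp: div_grad_def)
    show "AE p in vol. p \<notin> K \<longrightarrow> div_grad \<nu> f p = 0" using div_grad_zero by simp
  qed
qed

text \<open>F i is the i-th coordinate component of f grad x times the density. By
  \<open>laplacian_position\<close> the sum of the coordinate derivatives is the density times
  \<open>div_grad\<close>, and each coordinate derivative integrates to 0.\<close>

lemma integral_div_grad_chart:
  assumes chart: "param_chart S W V \<Phi> (\<Psi> :: real^'k \<Rightarrow> _)" and KW: "K \<subseteq> W"
    and minimal: "\<And>p. p \<in> S \<Longrightarrow> mean_curvature S p = 0"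
  shows "(\<integral>p. div_grad \<nu> f p \<partial>vol) = 0"
proof -
  interpret param_chart S W V \<Phi> \<Psi> by (rule chart)
  define F where "F i y = (\<Sum>j\<in>UNIV. (\<omega> i j y * lor (dPsi j y) \<nu>) * f (\<Psi> y))" for i y
  have Vsub: "\<Psi> y \<in> N" if "y \<in> V" for y using \<Psi>_in(1)[OF that] N(2) by blast
  have CkF: "Ck_on 1 (F i) V" for i
  proof -
    have f\<Psi>: "Ck_on 1 (\<lambda>y. f (\<Psi> y)) V"
      by (rule Ck_on_compose[OF open_V N(1) Vsub f]) (assumption | rule smooth_\<Psi>[unfolded smooth_on_def, rule_format])+
    show ?thesis unfolding F_def[abs_def]
      by (intro Ck_on_sum Ck_on_mult open_V Ck_\<omega> f\<Psi> Ck_on_linear_comp[OF open_V lor.bounded_linear_left] Ck_dPsi)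
  qed
  have C: "compact (\<Phi> ` K)" "\<Phi> ` K \<subseteq> V"
    using K KW \<Phi>_in(1) by (auto intro!: compact_continuous_image continuous_on_subset[OF smooth_on_continuous[OF smooth_\<Phi>]])
  have F0: "F i y = 0" if "y \<in> V" "y \<notin> \<Phi> ` K" for i y
  proof -
    have "\<Psi> y \<notin> K" using that \<Psi>_in(3)[OF that(1)] by (metis UNIV_I image_eqI)
    then show ?thesis using f0 \<Psi>_in(1)[OF that(1)] by (simp add: F_def)
  qed
  note I = integral_frechet_derivative_zero[OF open_V CkF C F0]
  have eq: "(\<Sum>i\<in>UNIV. frechet_derivative (F i) (at y) (e_ax i)) = jac \<Psi> y * div_grad \<nu> f (\<Psi> y)" if y: "y \<in> V" for y
  proof -
    let ?Df = "frechet_derivative f (at (\<Psi> y))"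
    have pS: "\<Psi> y \<in> S" using \<Psi>_in(1)[OF y] by simp
    have lin: "linear ?Df" using has_derivative_linear[OF f_has_derivative[OF pS]] .
    have f\<Psi>: "((\<lambda>y. f (\<Psi> y)) has_derivative (\<lambda>v. ?Df (D\<Psi> y v))) (at y)"
      using has_derivative_compose[OF smooth_on_has_derivative[OF smooth_\<Psi> y] f_has_derivative[OF pS]] by simp
    have FD0: "(F i has_derivative (\<lambda>v. \<Sum>j\<in>UNIV. \<omega> i j y * lor (dPsi j y) \<nu> * ?Df (D\<Psi> y v) +
        (\<omega> i j y * lor (deriv2 \<Psi> y v (e_ax j)) \<nu> + D\<omega> i j y v * lor (dPsi j y) \<nu>) * f (\<Psi> y))) (at y)" for i
      unfolding F_def[abs_def]
      by (intro has_derivative_sum has_derivative_mult \<omega>_has_derivative y f\<Psi>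
           bounded_linear.has_derivative[OF lor.bounded_linear_left] dPsi_has_derivative)
    have FD: "frechet_derivative (F i) (at y) (e_ax i) = (\<Sum>j\<in>UNIV. \<omega> i j y * lor (dPsi j y) \<nu> * ?Df (dPsi i y) +
        (\<omega> i j y * lor (deriv2 \<Psi> y (e_ax i) (e_ax j)) \<nu> + D\<omega> i j y (e_ax i) * lor (dPsi j y) \<nu>) * f (\<Psi> y))" for i
      by (subst frechet_derivative_eqI[OF FD0]) (simp add: dPsi_def)
    have "(\<Sum>i\<in>UNIV. frechet_derivative (F i) (at y) (e_ax i)) =
       (\<Sum>i\<in>UNIV. \<Sum>j\<in>UNIV. \<omega> i j y * lor (dPsi j y) \<nu> * ?Df (dPsi i y)) +
       lor (\<Sum>i\<in>UNIV. \<Sum>j\<in>UNIV. D\<omega> i j y (e_ax i) *\<^sub>R dPsi j y + \<omega> i j y *\<^sub>R deriv2 \<Psi> y (e_ax i) (e_ax j)) \<nu> * f (\<Psi> y)"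
      unfolding FD by (simp add: sum.distrib lor.sum_left lor_simps sum_distrib_right distrib_right add.commute)
    also have "lor (\<Sum>i\<in>UNIV. \<Sum>j\<in>UNIV. D\<omega> i j y (e_ax i) *\<^sub>R dPsi j y + \<omega> i j y *\<^sub>R deriv2 \<Psi> y (e_ax i) (e_ax j)) \<nu>
       = jac \<Psi> y * CARD('k) * lor (\<Psi> y) \<nu>"
      unfolding laplacian_position[OF y minimal[OF pS]] by (simp add: lor_simps)
    also have "(\<Sum>i\<in>UNIV. \<Sum>j\<in>UNIV. \<omega> i j y * lor (dPsi j y) \<nu> * ?Df (dPsi i y)) = jac \<Psi> y * ?Df (tang \<nu> (\<Psi> y))"
      unfolding lor_proj_tangent[OF y]
      by (simp add: linear_sum[OF lin] linear_scale[OF lin] \<omega>_def sum_distrib_left lor_commute mult.assoc)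
    finally show ?thesis using pS by (simp add: div_grad_def algebra_simps)
  qed
  have "(\<integral>p. div_grad \<nu> f p \<partial>vol) = (\<integral>y. indicator V y * jac \<Psi> y * div_grad \<nu> f (chart_map V \<Psi> y) \<partial>lborel)"
    using div_grad_zero KW by (intro integral_vol_chart[OF chart div_grad_measurable]) blast
  also have "\<dots> = (\<integral>y. (\<Sum>i\<in>UNIV. indicator V y * frechet_derivative (F i) (at y) (e_ax i)) \<partial>lborel)"
    using eq by (intro Bochner_Integration.integral_cong refl)
      (auto simp: chart_map_def[OF chart] indicator_def sum_distrib_left[symmetric])
  also have "\<dots> = (\<Sum>i\<in>UNIV. \<integral>y. indicator V y * frechet_derivative (F i) (at y) (e_ax i) \<partial>lborel)"
    by (rule Bochner_Integration.integral_sum) (rule I(1))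
  also have "\<dots> = 0" by (simp add: I(2))
  finally show ?thesis .
qed

end

lemma div_grad_add:
  assumes "open N" "S \<subseteq> N" "Ck_on 1 f N" "Ck_on 1 g N"
  shows "div_grad \<nu> (\<lambda>p. f p + g p) p = div_grad \<nu> f p + div_grad \<nu> g p"
proof (cases "p \<in> S")
  case True
  have "(f has_derivative frechet_derivative f (at p)) (at p)" "(g has_derivative frechet_derivative g (at p)) (at p)"
    using Ck_on_SucD(1)[OF assms(3)[unfolded One_nat_def]] Ck_on_SucD(1)[OF assms(4)[unfolded One_nat_def]] assms(2) True
    by blast+
  from frechet_derivative_eqI[OF has_derivative_add[OF this]]
  show ?thesis by (simp add: div_grad_def algebra_simps)
qed (simp add: div_grad_def)

text \<open>Multiplying successively by factors 1 - \<beta> replaces a normalized partition of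
  unity, so nothing has to be divided by a sum of bumps.\<close>

theorem integral_div_grad:
  assumes N: "open N" "S \<subseteq> N" and f: "Ck_on 1 f N" and K: "compact K" "K \<subseteq> S" and f0: "\<And>p. p \<in> S \<Longrightarrow> p \<notin> K \<Longrightarrow> f p = 0"
    and minimal: "\<And>p. p \<in> S \<Longrightarrow> mean_curvature S p = 0"
  shows "(\<integral>p. div_grad \<nu> f p \<partial>vol) = 0"
proof -
  have "\<exists>d>0. \<exists>W (V :: (real^'k) set) \<Phi> \<Psi>. param_chart S W V \<Phi> \<Psi> \<and> cball p (2 * d) \<subseteq> W" if p: "p \<in> K" for p
  proof -
    have pS: "p \<in> S" using p K(2) by blast
    obtain W and V :: "(real^'k) set" and \<Phi> \<Psi> where c: "p \<in> W" "param_chart S W V \<Phi> \<Psi>"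
      using param_chart_exists[OF submanifold_S S_hyp pS] .
    interpret param_chart S W V \<Phi> \<Psi> by (rule c(2))
    obtain e where "0 < e" "cball p e \<subseteq> W" using open_W c(1) open_contains_cball by blast
    then show ?thesis using c(2) by (intro exI[of _ "e / 2"] conjI exI[of _ W] exI[of _ V] exI[of _ \<Phi>] exI[of _ \<Psi>]) auto
  qed
  then obtain d where d: "\<And>p. p \<in> K \<Longrightarrow> 0 < d p"
     "\<And>p. p \<in> K \<Longrightarrow> \<exists>W (V :: (real^'k) set) \<Phi> \<Psi>. param_chart S W V \<Phi> \<Psi> \<and> cball p (2 * d p) \<subseteq> W"
    by metis
  have "\<exists>\<beta> :: 'n minkowski \<Rightarrow> real. Ck_on 1 \<beta> UNIV \<and> (\<forall>q\<in>ball p (d p). \<beta> q = 1) \<and> (\<forall>q. q \<notin> cball p (2 * d p) \<longrightarrow> \<beta> q = 0)"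
    if "p \<in> K" for p
    using bump_exists[OF d(1)[OF that], of p] by metis
  then obtain \<beta> :: "'n minkowski \<Rightarrow> 'n minkowski \<Rightarrow> real" where \<beta>: "\<And>p. p \<in> K \<Longrightarrow> Ck_on 1 (\<beta> p) UNIV"
     "\<And>p q. p \<in> K \<Longrightarrow> q \<in> ball p (d p) \<Longrightarrow> \<beta> p q = 1" "\<And>p q. p \<in> K \<Longrightarrow> q \<notin> cball p (2 * d p) \<Longrightarrow> \<beta> p q = 0"
    by metis
  have \<beta>N: "Ck_on 1 (\<beta> p) N" if "p \<in> K" for p using \<beta>(1)[OF that] Ck_on_subset by blast
  obtain F where F: "F \<subseteq> K" "finite F" "K \<subseteq> (\<Union>p\<in>F. ball p (d p))"
    by (rule compactE_image[OF K(1), of K "\<lambda>p. ball p (d p)"]) (use d(1) in auto)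
  define g where "g A q = f q * (\<Prod>p\<in>A. 1 + - 1 * \<beta> p q)" for A q
  have Ckg: "Ck_on 1 (g A) N" if "A \<subseteq> K" for A
    unfolding g_def[abs_def] using that \<beta>N
    by (intro Ck_on_mult Ck_on_prod Ck_on_add Ck_on_const N(1) f) auto
  have g0: "g A p = 0" if "p \<in> S" "p \<notin> K" for A p using f0[OF that] by (simp add: g_def)
  text \<open>Replacing $f$ by $f(1-\beta_p)$ does not change the integral, because $f\beta_p$ lives in one chart.\<close>
  have step: "(\<integral>p. div_grad \<nu> (g A) p \<partial>vol) = (\<integral>p. div_grad \<nu> f p \<partial>vol)" if "finite A" "A \<subseteq> K" for A
    using that
  proof (induction A rule: finite_induct)
    case empty
    then show ?case by (simp add: g_def)
  next
    case (insert x A)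
    have xK: "x \<in> K" and AK: "A \<subseteq> K" using insert by auto
    define h where "h q = g A q * \<beta> x q" for q
    have Ckh: "Ck_on 1 h N" unfolding h_def[abs_def] by (intro Ck_on_mult N(1) Ckg AK \<beta>N xK)
    obtain W and V :: "(real^'k) set" and \<Phi> \<Psi> where c: "param_chart S W V \<Phi> \<Psi>" "cball x (2 * d x) \<subseteq> W"
      using d(2)[OF xK] by blast
    have Kx: "compact (K \<inter> cball x (2 * d x))" "K \<inter> cball x (2 * d x) \<subseteq> S" "K \<inter> cball x (2 * d x) \<subseteq> W"
      using K c(2) by (auto intro: compact_Int_closed)
    have h0: "h q = 0" if "q \<in> S" "q \<notin> K \<inter> cball x (2 * d x)" for q
      using g0[of q] \<beta>(3)[OF xK, of q] that by (cases "q \<in> K") (simp_all add: h_def)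
    have hi: "(\<integral>p. div_grad \<nu> h p \<partial>vol) = 0"
      by (rule integral_div_grad_chart[OF N Ckh Kx(1,2) h0 c(1) Kx(3) minimal])
    have gA: "g A = (\<lambda>q. g (insert x A) q + h q)"
      using insert(1,2) by (auto simp: g_def h_def fun_eq_iff algebra_simps)
    have CkI: "Ck_on 1 (g (insert x A)) N" by (rule Ckg) (use insert in auto)
    have "div_grad \<nu> (g A) p = div_grad \<nu> (g (insert x A)) p + div_grad \<nu> h p" for p
      by (subst gA) (rule div_grad_add[OF N CkI Ckh])
    then have "(\<integral>p. div_grad \<nu> (g A) p \<partial>vol) = (\<integral>p. div_grad \<nu> (g (insert x A)) p + div_grad \<nu> h p \<partial>vol)" by simp
    also have "\<dots> = (\<integral>p. div_grad \<nu> (g (insert x A)) p \<partial>vol) + (\<integral>p. div_grad \<nu> h p \<partial>vol)"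
      by (intro Bochner_Integration.integral_add div_grad_integrable[OF N CkI K g0] div_grad_integrable[OF N Ckh Kx(1,2) h0])
    finally show ?case using hi insert.IH AK by simp
  qed
  \<comment> \<open>Every point of K lies in a ball where one of the factors is 0. The final
    function vanishes on S, and the empty set serves as its compact support.\<close>
  have gF: "g F p = 0" if "p \<in> S" "p \<notin> {}" for p
  proof (cases "p \<in> K")
    case True
    then obtain q where q: "q \<in> F" "p \<in> ball q (d q)" using F(3) by blast
    have "q \<in> K" using q(1) F(1) by blast
    then have "1 + - 1 * \<beta> q p = 0" using \<beta>(2)[of q p] q(2) by simp
    then show ?thesis using F(2) q(1) by (auto simp: g_def)
  qed (use g0 that in auto)
  have "div_grad \<nu> (g F) p = 0" for p
    by (rule div_grad_zero[OF N Ckg[OF F(1)] _ _ gF, of "{}"]) auto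
  then show ?thesis using step[OF F(2,1)] by simp
qed

end

section \<open>The comparison function and the cutoffs\<close>

lemma Q_plus_has_derivative:
  "(Q_plus k a has_real_derivative (t\<^sup>2 + 1) powr (real k / 2 - 1)) (at t)"
proof -
  let ?q = "\<lambda>s::real. (s\<^sup>2 + 1) powr (real k / 2 - 1)"
  \<comment> \<open>The oriented integral is differentiated inside an interval having both a and t
    in its interior, which covers t < a as well.\<close>
  define l where "l = min a t - 1"
  define u where "u = max a t + 1"
  have b: "l < a" "a < u" "l < t" "t < u" by (auto simp: l_def u_def)
  have "s\<^sup>2 + 1 \<noteq> 0" for s :: real by (smt (verit) zero_le_power2)
  then have c: "continuous_on {l..u} ?q" by (intro continuous_intros) auto
  have "((\<lambda>x. LBINT s=ereal a..ereal x. ?q s) has_vector_derivative ?q t) (at t within {l..u})"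
    by (rule interval_integral_FTC2[OF _ _ c]) (use b in auto)
  then have "((\<lambda>x. LBINT s=ereal a..ereal x. ?q s) has_vector_derivative ?q t) (at t)"
    using at_within_interior[of t "{l..u}"] b by (simp add: interior_atLeastAtMost_real)
  then have "((\<lambda>x. LBINT s=ereal a..ereal x. ?q s) has_real_derivative ?q t) (at t)"
    by (simp add: has_real_derivative_iff_has_vector_derivative)
  from DERIV_add[OF this DERIV_const]
  show ?thesis unfolding Q_plus_def[abs_def] by simp
qed

lemma Q_plus_continuous: "continuous_on A (Q_plus k a)"
  using Q_plus_has_derivative by (intro continuous_at_imp_continuous_on) (auto intro: DERIV_isCont)

text \<open>Equality holds at $t=a$; this is what the constant $\frac1{ka}(a^2+1)^{k/2}$ in $Q$ is for.\<close>

lemma Q_plus_lower_bound: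
  assumes "0 < a" "0 < k" "a \<le> t"
  shows "(t\<^sup>2 + 1) powr (real k / 2) \<le> real k * t * Q_plus k a t"
proof -
  let ?D = "\<lambda>t. Q_plus k a t - (t\<^sup>2 + 1) powr (real k / 2) / (real k * t)"
  have "?D a \<le> ?D t"
  \<comment> \<open>The derivative of Q cancels against one term of the quotient rule, and the
    derivative of the difference is (s^2+1)^(k/2) / (k s^2).\<close>
  proof (rule DERIV_nonneg_imp_nondecreasing[OF assms(3)])
    fix s assume s: "a \<le> s" "s \<le> t"
    have s0: "0 < s" using s assms by simp
    have p: "0 < s\<^sup>2 + 1" by (smt (verit) zero_le_power2)
    have pw: "(s\<^sup>2 + 1) powr (real k / 2) = (s\<^sup>2 + 1) * (s\<^sup>2 + 1) powr (real k / 2 - 1)"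
      using p powr_add[of "s\<^sup>2 + 1" 1 "real k / 2 - 1"] by simp
    have "((\<lambda>t. (t\<^sup>2 + 1) powr (real k / 2) / (real k * t)) has_real_derivative
        ((real k / 2 * (s\<^sup>2 + 1) powr (real k / 2 - 1) * (2 * s)) * (real k * s) - (s\<^sup>2 + 1) powr (real k / 2) * real k) / (real k * s)\<^sup>2) (at s)"
      using s0 p assms(2) by (auto intro!: derivative_eq_intros simp: power2_eq_square)
    from DERIV_diff[OF Q_plus_has_derivative this]
    have d: "(?D has_real_derivative (s\<^sup>2 + 1) powr (real k / 2 - 1) -
        ((real k / 2 * (s\<^sup>2 + 1) powr (real k / 2 - 1) * (2 * s)) * (real k * s) - (s\<^sup>2 + 1) powr (real k / 2) * real k) / (real k * s)\<^sup>2) (at s)" .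
    have "(s\<^sup>2 + 1) powr (real k / 2 - 1) -
        ((real k / 2 * (s\<^sup>2 + 1) powr (real k / 2 - 1) * (2 * s)) * (real k * s) - (s\<^sup>2 + 1) powr (real k / 2) * real k) / (real k * s)\<^sup>2
      = (s\<^sup>2 + 1) powr (real k / 2) / (real k * s\<^sup>2)"
      using s0 assms(2) by (simp add: field_simps power2_eq_square)
    then show "\<exists>y. (?D has_real_derivative y) (at s) \<and> 0 \<le> y" using d by auto
  qed
  moreover have "?D a = 0" by (simp add: Q_plus_def)
  moreover have "0 < real k * t" using assms by simp
  ultimately show ?thesis by (simp add: field_simps)
qed

lemma Q_plus_pos:
  assumes "0 < a" "0 < k" "a \<le> t"
  shows "0 < Q_plus k a t"
proof -
  have "0 < (t\<^sup>2 + 1) powr (real k / 2)" by (smt (verit) zero_le_power2 powr_gt_zero)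
  then have "0 < real k * t * Q_plus k a t" using Q_plus_lower_bound[OF assms] by linarith
  then show ?thesis by (rule zero_less_mult_pos) (use assms in simp)
qed

lemma Q_plus_strict_mono: "s < t \<Longrightarrow> Q_plus k a s < Q_plus k a t"
  by (rule DERIV_pos_imp_increasing) (use Q_plus_has_derivative in \<open>fastforce simp: add_nonneg_eq_0_iff\<close>)+

lemma Q_plus_less_iff: "Q_plus k a s < Q_plus k a t \<longleftrightarrow> s < t"
  using Q_plus_strict_mono by (metis linorder_neqE_linordered_idom order_less_asym)

text \<open>Variation of constants: (t^2+1)^(-k/2) solves the homogeneous equation (1+t^2)F' + ktF =
  0, and Q is the variable coefficient that produces the right side 1.\<close>

definition F_plus :: "nat \<Rightarrow> real \<Rightarrow> real \<Rightarrow> real" where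
  "F_plus k a t = Q_plus k a t * (t\<^sup>2 + 1) powr (- real k / 2)"

lemma F_plus_derivative:
  "(F_plus k a has_real_derivative (1 - real k * t * F_plus k a t) / (t\<^sup>2 + 1)) (at t)"
proof -
  have p: "0 < t\<^sup>2 + 1" by (smt (verit) zero_le_power2)
  have d: "(F_plus k a has_real_derivative (t\<^sup>2 + 1) powr (real k / 2 - 1) * (t\<^sup>2 + 1) powr (- real k / 2) +
     Q_plus k a t * (- real k / 2 * (t\<^sup>2 + 1) powr (- real k / 2 - 1) * (2 * t))) (at t)"
    unfolding F_plus_def[abs_def]
    by (rule DERIV_cong[OF DERIV_mult'[OF Q_plus_has_derivative]])
       (use p in \<open>auto intro!: derivative_eq_intros\<close>)
  have e1: "(t\<^sup>2 + 1) powr (real k / 2 - 1) * (t\<^sup>2 + 1) powr (- real k / 2) = 1 / (t\<^sup>2 + 1)"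
  proof -
    have "(t\<^sup>2 + 1) powr (real k / 2 - 1) * (t\<^sup>2 + 1) powr (- real k / 2) = (t\<^sup>2 + 1) powr ((real k / 2 - 1) + (- real k / 2))"
      by (simp only: powr_add)
    then show ?thesis using p by (simp add: powr_minus_divide)
  qed
  have e2: "(t\<^sup>2 + 1) powr (- real k / 2 - 1) = (t\<^sup>2 + 1) powr (- real k / 2) / (t\<^sup>2 + 1)"
    using p powr_diff[of "t\<^sup>2 + 1" "- real k / 2" 1] by simp
  show ?thesis
  proof (rule DERIV_cong[OF d], unfold e1 e2 F_plus_def)
    have "1 / P + Q * (- real k / 2 * (X / P) * (2 * t)) = (1 - real k * t * (Q * X)) / P" if "0 < P" for P Q X
      using that by (simp add: field_simps)
    from this[OF p] show "1 / (t\<^sup>2 + 1) + Q_plus k a t * (- real k / 2 * ((t\<^sup>2 + 1) powr (- real k / 2) / (t\<^sup>2 + 1)) * (2 * t))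
      = (1 - real k * t * (Q_plus k a t * (t\<^sup>2 + 1) powr (- real k / 2))) / (t\<^sup>2 + 1)" .
  qed
qed

text \<open>The first inequality is F' <= 0 on [a,\<infinity>), a rescaling of
  \<open>Q_plus_lower_bound\<close>. The bound by Q later dominates the error of the height
  cutoff.\<close>

lemma F_plus_ge:
  assumes "0 < a" "0 < k" "a \<le> t"
  shows "1 \<le> real k * t * F_plus k a t" "0 \<le> F_plus k a t" "F_plus k a t \<le> Q_plus k a t"
proof -
  have p: "1 \<le> t\<^sup>2 + 1" by simp
  have "t\<^sup>2 + 1 \<noteq> 0" using p by linarith
  then have i: "(t\<^sup>2 + 1) powr (real k / 2) * (t\<^sup>2 + 1) powr (- real k / 2) = 1"
    by (simp add: powr_add[symmetric])
  have "(t\<^sup>2 + 1) powr (real k / 2) * (t\<^sup>2 + 1) powr (- real k / 2) \<le> real k * t * Q_plus k a t * (t\<^sup>2 + 1) powr (- real k / 2)"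
    by (intro mult_right_mono Q_plus_lower_bound assms) simp
  then show "1 \<le> real k * t * F_plus k a t" unfolding i by (simp add: F_plus_def mult.assoc)
  show "0 \<le> F_plus k a t" using Q_plus_pos[OF assms] by (simp add: F_plus_def)
  have "(t\<^sup>2 + 1) powr (- real k / 2) \<le> (t\<^sup>2 + 1) powr 0" by (rule powr_mono[OF _ p]) simp
  also have "\<dots> = 1" using \<open>t\<^sup>2 + 1 \<noteq> 0\<close> by simp
  finally have "(t\<^sup>2 + 1) powr (- real k / 2) \<le> 1" .
  then show "F_plus k a t \<le> Q_plus k a t" using Q_plus_pos[OF assms] by (simp add: F_plus_def mult_left_le)
qed

text \<open>In other words (1+t^2)F = Q/Q', which turns a derivative \<zeta>' of the cutoff,
  weighted by (1+x^2)F, into \<zeta>' Q/Q'.\<close>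

lemma F_plus_weight:
  "(t\<^sup>2 + 1) * F_plus k a t * (t\<^sup>2 + 1) powr (real k / 2 - 1) = Q_plus k a t"
proof -
  have p: "0 < t\<^sup>2 + 1" by (smt (verit) zero_le_power2)
  have "(t\<^sup>2 + 1) * (t\<^sup>2 + 1) powr (- real k / 2) * (t\<^sup>2 + 1) powr (real k / 2 - 1)
     = (t\<^sup>2 + 1) powr 1 * (t\<^sup>2 + 1) powr (- real k / 2) * (t\<^sup>2 + 1) powr (real k / 2 - 1)"
    using p by simp
  also have "\<dots> = (t\<^sup>2 + 1) powr (1 + (- real k / 2) + (real k / 2 - 1))"
    by (simp only: powr_add)
  also have "\<dots> = 1" using less_imp_neq[OF p] by simp
  finally show ?thesis by (simp add: F_plus_def mult_ac)
qed

text \<open>A continuously differentiable approximation of the positive part from below. Its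
  derivative is nondecreasing in s, lies in [0,1] and is 0 at s = 0 for every n, so the derivatives
  converge at every point to the indicator of s > 0.\<close>

definition pos_approx :: "nat \<Rightarrow> real \<Rightarrow> real" where
  "pos_approx n s = max 0 s - max 0 s / (1 + real n * max 0 s)"

definition pos_approx_deriv :: "nat \<Rightarrow> real \<Rightarrow> real" where
  "pos_approx_deriv n s = 1 - 1 / (1 + real n * max 0 s)\<^sup>2"

lemma pos_approx_has_derivative: "(pos_approx n has_real_derivative pos_approx_deriv n s) (at s)"
proof (cases s "0::real" rule: linorder_cases)
  case less
  have "((\<lambda>s::real. 0) has_real_derivative 0) (at s)" by simp
  then have "(pos_approx n has_real_derivative 0) (at s)"
    by (rule has_field_derivative_transform_within_open[of _ _ _ "{..<0}"]) (use less in \<open>auto simp: pos_approx_def\<close>)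
  then show ?thesis using less by (simp add: pos_approx_deriv_def)
next
  case greater
  have p: "0 < 1 + real n * s" using greater by (simp add: add_pos_nonneg)
  have "((\<lambda>s. s - s / (1 + real n * s)) has_real_derivative 1 - (1 * (1 + real n * s) - s * real n) / ((1 + real n * s) * (1 + real n * s))) (at s)"
    using p by (auto intro!: derivative_eq_intros)
  then have "(pos_approx n has_real_derivative 1 - (1 * (1 + real n * s) - s * real n) / ((1 + real n * s) * (1 + real n * s))) (at s)"
    by (rule has_field_derivative_transform_within_open[of _ _ _ "{0<..}"]) (use greater in \<open>auto simp: pos_approx_def\<close>)
  then show ?thesis using greater by (simp add: pos_approx_deriv_def power2_eq_square mult.commute)
next
  case equal
  have "((\<lambda>h. pos_approx n h / h) \<longlongrightarrow> 0) (at 0)"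
  proof (rule Lim_null_comparison)
    have "norm (pos_approx n h / h) \<le> real n * \<bar>h\<bar>" for h
    proof (cases "0 < h")
      case True
      define c where "c = 1 + real n * h"
      have c: "1 < c \<or> c = 1" "real n * h = c - 1" using True by (auto simp: c_def)
      have "pos_approx n h / h = 1 - 1 / c" using True by (simp add: pos_approx_def c_def diff_divide_distrib)
      also have "\<dots> = (c - 1) / c" using c by (auto simp: diff_divide_distrib)
      finally have eq: "pos_approx n h / h = (c - 1) / c" .
      have "(c - 1) / c \<le> (c - 1) / 1" using c by (intro divide_left_mono) auto
      moreover have "0 \<le> (c - 1) / c" using c by auto
      ultimately show ?thesis unfolding eq using True by (simp add: c_def)
    qed (auto simp: pos_approx_def mult_nonneg_nonpos)
    then show "\<forall>\<^sub>F h in at 0. norm (pos_approx n h / h) \<le> real n * \<bar>h\<bar>" by simp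
    show "((\<lambda>h::real. real n * \<bar>h\<bar>) \<longlongrightarrow> 0) (at 0)"
      using tendsto_mult_right_zero[OF tendsto_rabs_zero[OF tendsto_ident_at]] by blast
  qed
  then show ?thesis using equal by (simp add: DERIV_def pos_approx_deriv_def pos_approx_def)
qed

lemma pos_approx_deriv_continuous: "continuous_on UNIV (pos_approx_deriv n)"
proof -
  have "1 + real n * max 0 s \<noteq> 0" for s by (smt (verit) mult_nonneg_nonneg of_nat_0_le_iff)
  then show ?thesis unfolding pos_approx_deriv_def[abs_def] by (intro continuous_intros) auto
qed

lemma pos_approx_deriv_bounds: "0 \<le> pos_approx_deriv n s" "pos_approx_deriv n s \<le> 1" "s \<le> t \<Longrightarrow> pos_approx_deriv n s \<le> pos_approx_deriv n t" "s \<le> 0 \<Longrightarrow> pos_approx_deriv n s = 0"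
proof -
  have le: "1 \<le> 1 + real n * max 0 s" for s by simp
  then have le2: "1 \<le> (1 + real n * max 0 s)\<^sup>2" for s by simp
  show "0 \<le> pos_approx_deriv n s" "pos_approx_deriv n s \<le> 1" using le2[of s] by (auto simp: pos_approx_deriv_def divide_le_eq_1)
  show "pos_approx_deriv n s = 0" if "s \<le> 0" using that by (simp add: pos_approx_deriv_def)
  show "pos_approx_deriv n s \<le> pos_approx_deriv n t" if "s \<le> t"
  proof -
    have "(1 + real n * max 0 s)\<^sup>2 \<le> (1 + real n * max 0 t)\<^sup>2"
      using that le[of s] by (intro power_mono add_left_mono mult_left_mono max.mono) auto
    then have "1 / (1 + real n * max 0 t)\<^sup>2 \<le> 1 / (1 + real n * max 0 s)\<^sup>2"
    proof (rule divide_left_mono)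
      have pos: "0 < 1 + real n * max 0 s" for s using le[of s] by linarith
      show "0 < (1 + real n * max 0 t)\<^sup>2 * (1 + real n * max 0 s)\<^sup>2"
        by (intro mult_pos_pos zero_less_power pos)
    qed simp
    then show ?thesis by (simp add: pos_approx_deriv_def)
  qed
qed

lemma pos_approx_bounds: "s \<le> t \<Longrightarrow> 0 \<le> pos_approx n t - pos_approx n s" "s \<le> t \<Longrightarrow> pos_approx n t - pos_approx n s \<le> t - s" "s \<le> 0 \<Longrightarrow> pos_approx n s = 0"
proof -
  show "pos_approx n s = 0" if "s \<le> 0" using that by (simp add: pos_approx_def)
  show "0 \<le> pos_approx n t - pos_approx n s" if "s \<le> t"
    using DERIV_nonneg_imp_nondecreasing[OF that, of "pos_approx n"] pos_approx_has_derivative pos_approx_deriv_bounds(1) by force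
  have "((\<lambda>s. s - pos_approx n s) has_real_derivative 1 - pos_approx_deriv n s) (at s)" for s
    using DERIV_diff[OF DERIV_ident pos_approx_has_derivative] .
  then show "pos_approx n t - pos_approx n s \<le> t - s" if "s \<le> t"
    using DERIV_nonneg_imp_nondecreasing[OF that, of "\<lambda>s. s - pos_approx n s"] pos_approx_deriv_bounds(2)
    by (smt (verit, best))
qed

lemma pos_approx_limits:
  "(\<lambda>n. pos_approx n s) \<longlonglongrightarrow> max 0 s" "(\<lambda>n. pos_approx_deriv n s) \<longlonglongrightarrow> (if 0 < s then 1 else 0)"
proof -
  have *: "(\<lambda>n. 1 / (1 + real n * s)) \<longlonglongrightarrow> 0" if "0 < s" for s :: real
    using that by real_asymp
  show "(\<lambda>n. pos_approx n s) \<longlonglongrightarrow> max 0 s"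
  proof (cases "0 < s")
    case True
    have "(\<lambda>n. s - s * (1 / (1 + real n * s))) \<longlonglongrightarrow> s - s * 0"
      by (intro tendsto_intros * True)
    then show ?thesis using True by (simp add: pos_approx_def)
  qed (simp add: pos_approx_def)
  show "(\<lambda>n. pos_approx_deriv n s) \<longlonglongrightarrow> (if 0 < s then 1 else 0)"
  proof (cases "0 < s")
    case True
    have "(\<lambda>n. 1 - (1 / (1 + real n * s))\<^sup>2) \<longlonglongrightarrow> 1 - 0\<^sup>2"
      by (intro tendsto_intros * True)
    then show ?thesis using True by (simp add: pos_approx_deriv_def power_divide)
  qed (simp add: pos_approx_deriv_def)
qed

section \<open>Monotonicity\<close>

text \<open>An odd extension has an even derivative. It lets the radial factor be used on both sides
  of the hyperplane, where x has either sign.\<close>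

lemma DERIV_sgn_mult_abs:
  assumes "x \<noteq> (0::real)" "(f has_real_derivative d) (at \<bar>x\<bar>)"
  shows "((\<lambda>x. sgn x * f \<bar>x\<bar>) has_real_derivative d) (at x)"
proof (cases "0 < x")
  case True
  then have "(f has_real_derivative d) (at x)" using assms(2) by simp
  then show ?thesis
    by (rule has_field_derivative_transform_within_open[of _ _ _ "{0<..}"]) (use True in auto)
next
  case False
  then have x: "x < 0" using assms(1) by simp
  have "((\<lambda>x. - f (- x)) has_real_derivative d) (at x)"
    using DERIV_minus[OF DERIV_chain'[OF DERIV_minus[OF DERIV_ident], of f d x]] assms(2) x by simp
  then show ?thesis
    by (rule has_field_derivative_transform_within_open[of _ _ _ "{..<0}"]) (use x in auto)
qed

lemma hyp_norm_le: assumes "p \<in> hyp" shows "norm p \<le> 2 * snd p"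
proof -
  have s: "0 < snd p" using hypD(2)[OF assms] .
  have "(norm (fst p))\<^sup>2 \<le> (snd p)\<^sup>2" using hyp_norm_fst[OF assms] by simp
  then have "norm (fst p) \<le> snd p" by (rule power2_le_imp_le) (use s in simp)
  then show ?thesis using norm_Pair_le[of "fst p" "snd p"] s by simp
qed

text \<open>With u the height divided by n + 1, this bounds the error of the height cutoff uniformly
  in n.\<close>

lemma mult_max_le_one: "0 \<le> u \<Longrightarrow> u * max 0 (1 - u) \<le> (1::real)"
  by (cases "u \<le> 1") (auto intro: mult_le_one)

context atlas
begin

text \<open>Both upper bounds are Cauchy-Schwarz on the complement of p, for the gradient of x
  against the tangential parts of \<nu> and of the time axis. They control |grad x|^2 and the change
  of the height along grad x.\<close>

lemma tang_bounds:
  assumes p: "p \<in> S" and \<nu>: "lor \<nu> \<nu> = 1"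
  shows "0 \<le> lor (tang \<nu> p) \<nu>" "lor (tang \<nu> p) \<nu> \<le> (lor p \<nu>)\<^sup>2 + 1"
    and "\<bar>snd (tang \<nu> p)\<bar> \<le> sqrt ((lor p \<nu>)\<^sup>2 + 1) * snd p"
proof -
  obtain W and V :: "(real^'k) set" and \<Phi> \<Psi> where c: "p \<in> W" "param_chart S W V \<Phi> \<Psi>"
    using param_chart_exists[OF submanifold_S S_hyp p] .
  interpret param_chart S W V \<Phi> \<Psi> by (rule c(2))
  have ph: "p \<in> hyp" using p S_hyp by blast
  have T: "lor_positive (tangent_space S p)"
    using lor_positive_tangent[of "\<Phi> p"] \<Phi>_in(1)[OF p c(1)] \<Psi>_\<Phi>[OF p c(1)] by simp
  let ?t = "tang \<nu> p"
  have tT: "?t \<in> tangent_space S p" by (rule lor_proj_in[OF T])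
  then have tp: "lor ?t p = 0"
    using tangent_perp[of "\<Phi> p" ?t] \<Phi>_in(1)[OF p c(1)] \<Psi>_\<Phi>[OF p c(1)] by simp
  have tt: "lor ?t \<nu> = lor ?t ?t"
    using lor_proj_perp[OF T tT, of \<nu>] by (simp add: lor_simps lor_commute[of \<nu>])
  show nn: "0 \<le> lor ?t \<nu>" unfolding tt by (rule lor_nonneg_on_perp[OF ph tp])
  have pp: "lor p p = -1" by (rule hypD(1)[OF ph])
  \<comment> \<open>The part of \<nu> tangent to the hyperboloid, with <w,w> = 1 + x^2; this is
    where the bound on |grad x|^2 comes from.\<close>
  define w where "w = \<nu> + lor p \<nu> *\<^sub>R p"
  have wp: "lor w p = 0" using pp by (simp add: w_def lor_simps lor_commute[of \<nu> p])
  have ww: "lor w w = (lor p \<nu>)\<^sup>2 + 1"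
    using pp \<nu> by (simp add: w_def lor_simps lor_commute[of \<nu> p] power2_eq_square algebra_simps)
  have tw: "lor ?t w = lor ?t ?t" using tt tp by (simp add: w_def lor_simps)
  have "(lor ?t w)\<^sup>2 \<le> lor ?t ?t * lor w w" by (rule lor_cauchy_schwarz_on_perp[OF ph tp wp])
  then have "lor ?t ?t * lor ?t ?t \<le> lor ?t ?t * ((lor p \<nu>)\<^sup>2 + 1)" by (simp add: tw ww power2_eq_square)
  then show le: "lor ?t \<nu> \<le> (lor p \<nu>)\<^sup>2 + 1"
    unfolding tt using nn tt by (cases "lor ?t ?t = 0") (auto simp: mult_le_cancel_left)
  \<comment> \<open>The part of the time axis tangent to the hyperboloid; its product with a tangent
    vector is minus the height component of that vector.\<close>
  define e where "e = (0, 1) + (- snd p) *\<^sub>R p"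
  have ep: "lor e p = 0" using pp by (simp add: e_def lor_simps) (simp add: lor_def)
  have ee: "lor e e = (snd p)\<^sup>2 - 1"
    using pp by (simp add: e_def lor_simps lor_commute[of p "(0, 1)"]) (simp add: lor_def power2_eq_square algebra_simps)
  have te: "lor ?t e = - snd ?t" using tp by (simp add: e_def lor_simps) (simp add: lor_def)
  have "(lor ?t e)\<^sup>2 \<le> lor ?t ?t * lor e e" by (rule lor_cauchy_schwarz_on_perp[OF ph tp ep])
  also have "\<dots> \<le> ((lor p \<nu>)\<^sup>2 + 1) * (snd p)\<^sup>2"
    using le nn tt lor_nonneg_on_perp[OF ph ep] by (intro mult_mono) (auto simp: ee)
  finally have "\<bar>snd ?t\<bar>\<^sup>2 \<le> (sqrt ((lor p \<nu>)\<^sup>2 + 1) * snd p)\<^sup>2"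
    by (simp add: te power_mult_distrib)
  then show "\<bar>snd ?t\<bar> \<le> sqrt ((lor p \<nu>)\<^sup>2 + 1) * snd p"
    by (rule power2_le_imp_le) (use hypD(2)[OF ph] in simp)
qed

text \<open>On the hyperboloid the height bounds the norm, so a cutoff in height produces compact
  support even where S runs off to infinity.\<close>

lemma compact_height: "compact {p\<in>S. snd p \<le> c}"
proof -
  have "closed (S \<inter> {p. snd p \<le> c})"
    by (intro closed_Int closed_S closed_Collect_le continuous_intros)
  moreover have "bounded (S \<inter> {p. snd p \<le> c})"
  proof (rule boundedI)
    fix p assume "p \<in> S \<inter> {p. snd p \<le> c}"
    then show "norm p \<le> 2 * c" using hyp_norm_le[of p] S_hyp by auto
  qed
  moreover have "{p\<in>S. snd p \<le> c} = S \<inter> {p. snd p \<le> c}" by blast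
  ultimately show ?thesis by (simp only: compact_eq_bounded_closed)
qed

text \<open>A single index n drives both the smoothing of the cutoff and the height cutoff, so one
  dominated convergence on the finite volume below t2 gives the limit. Strict sublevel sets appear
  because the derivatives of \<open>pos_approx\<close> tend to the indicator of s > 0.\<close>

lemma strict_volume_comparison:
  assumes \<nu>: "lor \<nu> \<nu> = 1" and a: "0 < a" and away: "\<And>p. p \<in> S \<Longrightarrow> a \<le> \<bar>lor p \<nu>\<bar>"
    and minimal: "\<And>p. p \<in> S \<Longrightarrow> mean_curvature S p = 0"
    and t: "a \<le> t1" "t1 < t2" and fin: "emeasure vol {p\<in>S. \<bar>lor p \<nu>\<bar> \<le> t2} < \<infinity>"
  shows "measure vol {p\<in>S. \<bar>lor p \<nu>\<bar> < t1} / Q_plus CARD('k) a t1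
       \<le> measure vol {p\<in>S. \<bar>lor p \<nu>\<bar> < t2} / Q_plus CARD('k) a t2"
proof -
  define k where "k = CARD('k)"
  have k: "0 < k" by (simp add: k_def)
  let ?Q = "Q_plus k a" and ?F = "F_plus k a" and ?q = "\<lambda>s::real. (s\<^sup>2 + 1) powr (real k / 2 - 1)"
  note Qpos = Q_plus_pos[OF a k]
  define s1 where "s1 = 1 / ?Q t1"
  define s2 where "s2 = 1 / ?Q t2"
  have Q12: "0 < ?Q t1" "0 < ?Q t2" "?Q t1 < ?Q t2" using Qpos t Q_plus_strict_mono[OF t(2)] by auto
  have s12: "0 < s2" "s2 < s1" using Q12 by (auto simp: s1_def s2_def frac_less2)
  have inv_iff: "s2 < 1 / ?Q y \<longleftrightarrow> y < t2" "s1 < 1 / ?Q y \<longleftrightarrow> y < t1" if "a \<le> y" for y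
    using Qpos[OF that] Q12 Q_plus_less_iff[of k a y] by (auto simp: s1_def s2_def field_simps)
  \<comment> \<open>As n grows, \<kappa> n (1/Q) tends to the difference of the positive parts of
    1/Q - s2 and 1/Q - s1. This is min(1/Q, s1) - s2 where Q < Q(t2), and 0 elsewhere.\<close>
  define \<kappa> where "\<kappa> n s = pos_approx n (s - s2) - pos_approx n (s - s1)" for n s
  define \<kappa>' where "\<kappa>' n s = pos_approx_deriv n (s - s2) - pos_approx_deriv n (s - s1)" for n s
  have \<kappa>d: "(\<kappa> n has_real_derivative \<kappa>' n s) (at s)" for n s
  proof -
    have "((\<lambda>s. pos_approx n (s - c)) has_real_derivative pos_approx_deriv n (s - c)) (at s)" for c
    proof -
      have "((\<lambda>s. s - c) has_real_derivative 1) (at s)" by (auto intro!: derivative_eq_intros)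
      from DERIV_chain2[OF pos_approx_has_derivative this] show ?thesis by simp
    qed
    then show ?thesis unfolding \<kappa>_def[abs_def] \<kappa>'_def by (intro DERIV_diff)
  qed
  have \<kappa>b: "0 \<le> \<kappa> n s" "\<kappa> n s \<le> s1" "0 \<le> \<kappa>' n s" "\<kappa>' n s \<le> 1" for n s
    using pos_approx_bounds(1,2)[of "s - s1" "s - s2" n] pos_approx_deriv_bounds(3)[of "s - s1" "s - s2" n]
      pos_approx_deriv_bounds(1)[of n "s - s1"] pos_approx_deriv_bounds(2)[of n "s - s2"] s12 by (auto simp: \<kappa>_def \<kappa>'_def)
  have \<kappa>0: "\<kappa> n s = 0" "\<kappa>' n s = 0" if "s \<le> s2" for n s
    using that s12 pos_approx_bounds(3) pos_approx_deriv_bounds(4) by (auto simp: \<kappa>_def \<kappa>'_def)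
  have \<kappa>c: "continuous_on UNIV (\<kappa> n)" for n
    using \<kappa>d by (intro continuous_at_imp_continuous_on) (auto intro: DERIV_isCont)
  have \<kappa>'c: "continuous_on UNIV (\<kappa>' n)" for n
    unfolding \<kappa>'_def by (intro continuous_intros continuous_on_compose2[OF pos_approx_deriv_continuous]) auto
  \<comment> \<open>The domain avoids x = 0, where the odd continuation may jump, and the values
    with Q <= 0, which can occur for |x| < a and where 1/Q is of no use.\<close>
  define N0 where "N0 = {x. x \<noteq> 0 \<and> 0 < ?Q \<bar>x\<bar>}"
  have Qabs: "continuous_on A (\<lambda>x. ?Q \<bar>x\<bar>)" for A
    by (rule continuous_on_compose2[OF Q_plus_continuous[of UNIV]]) (auto intro!: continuous_intros)
  have N0: "open N0" unfolding N0_def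
    by (intro open_Collect_conj open_Collect_neq open_Collect_less continuous_intros Qabs)
  define P where "P n y = ?F y * \<kappa> n (1 / ?Q y)" for n y
  define P' where "P' n y = (1 - real k * y * ?F y) / (y\<^sup>2 + 1) * \<kappa> n (1 / ?Q y) + ?F y * (\<kappa>' n (1 / ?Q y) * (- ?q y / (?Q y)\<^sup>2))" for n y
  have Pd: "(P n has_real_derivative P' n y) (at y)" if "0 < ?Q y" for n y
  proof -
    have i: "((\<lambda>y. 1 / ?Q y) has_real_derivative - ?q y / (?Q y)\<^sup>2) (at y)"
      using that by (auto intro!: derivative_eq_intros Q_plus_has_derivative simp: power2_eq_square)
    show ?thesis unfolding P_def[abs_def] P'_def
      by (rule DERIV_cong[OF DERIV_mult'[OF F_plus_derivative DERIV_chain2[OF \<kappa>d i]]]) simp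
  qed
  have sq: "y\<^sup>2 + 1 \<noteq> 0" for y :: real by (smt (verit) zero_le_power2)
  have Fc: "continuous_on UNIV ?F"
    using F_plus_derivative by (intro continuous_at_imp_continuous_on) (auto intro: DERIV_isCont)
  have P'c: "continuous_on N0 (\<lambda>x. P' n \<bar>x\<bar>)" for n
  proof -
    have "continuous_on {y. 0 < ?Q y} (P' n)"
      unfolding P'_def using sq
      by (intro continuous_intros continuous_on_compose2[OF \<kappa>c] continuous_on_compose2[OF \<kappa>'c]
            continuous_on_subset[OF Fc] Q_plus_continuous) auto
    then show ?thesis
      by (rule continuous_on_compose2) (auto simp: N0_def intro!: continuous_intros)
  qed
  define \<psi> where "\<psi> n x = sgn x * P n \<bar>x\<bar>" for n x
  have \<psi>d: "(\<psi> n has_real_derivative P' n \<bar>x\<bar>) (at x)" if "x \<in> N0" for n x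
    unfolding \<psi>_def[abs_def] using that by (intro DERIV_sgn_mult_abs Pd) (auto simp: N0_def)
  have \<psi>C: "Ck_on 1 (\<psi> n) N0" for n
    unfolding One_nat_def
  proof (rule Ck_on_SucI'[OF N0, where f'="\<lambda>x v. v * P' n \<bar>x\<bar>"])
    show "(\<psi> n has_derivative (\<lambda>v. v * P' n \<bar>x\<bar>)) (at x)" if "x \<in> N0" for x
      using \<psi>d[OF that] unfolding has_field_derivative_def by (rule has_derivative_eq_rhs) auto
    show "Ck_on 0 (\<lambda>x. v * P' n \<bar>x\<bar>) N0" for v
      by (auto intro!: continuous_intros P'c)
  qed
  define N where "N = {p. lor p \<nu> \<in> N0}"
  have cl: "continuous_on UNIV (\<lambda>p. lor p \<nu>)" by (intro lor.continuous_on continuous_intros)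
  have oN: "open N" unfolding N_def using open_vimage[OF N0 cl] by (simp add: vimage_def)
  have SN: "S \<subseteq> N" using away a Qpos by (force simp: N_def N0_def)
  \<comment> \<open>The resulting factor \<eta> n vanishes at heights above n + 1 and tends to 1
    pointwise.\<close>
  define l where "l n p = 1 + - (1 / Suc n) * snd p" for n and p :: "'n minkowski"
  define \<eta> where "\<eta> n p = (max 0 (l n p))\<^sup>2" for n p
  define f where "f n p = \<psi> n (lor p \<nu>) * \<eta> n p" for n p
  have lC: "Ck_on 1 (l n) N" for n
    unfolding l_def[abs_def] by (intro Ck_on_add Ck_on_mult Ck_on_const Ck_on_bounded_linear bounded_linear_snd oN)
  have fC: "Ck_on 1 (f n) N" for n
  proof -
    have "Ck_on 1 (\<lambda>p. \<psi> n (lor p \<nu>)) N"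
      by (rule Ck_on_compose[OF oN N0 _ \<psi>C Ck_on_bounded_linear[OF oN lor.bounded_linear_left]]) (simp add: N_def)
    moreover have "Ck_on 1 (\<eta> n) N"
      unfolding \<eta>_def[abs_def] by (rule Ck_on_compose[OF oN open_UNIV _ Ck_on_pos_part_square lC]) simp
    ultimately show ?thesis unfolding f_def[abs_def] by (rule Ck_on_mult[OF oN])
  qed
  have f0: "f n p = 0" if "p \<in> S" "p \<notin> {p\<in>S. snd p \<le> Suc n}" for n p
    using that by (auto simp: f_def \<eta>_def l_def max_def field_simps)
  have Kn: "compact {p\<in>S. snd p \<le> Suc n}" "{p\<in>S. snd p \<le> Suc n} \<subseteq> S" for n
    using compact_height[of "Suc n"] by auto
  have fd: "frechet_derivative (f n) (at p) v = \<eta> n p * (P' n \<bar>lor p \<nu>\<bar> * lor v \<nu>) + \<psi> n (lor p \<nu>) * (2 * max 0 (l n p) * (- (1 / Suc n) * snd v))"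
    if p: "p \<in> S" for n p v
  proof -
    have pN: "lor p \<nu> \<in> N0" using p SN by (auto simp: N_def)
    have 1: "((\<lambda>p. \<psi> n (lor p \<nu>)) has_derivative (\<lambda>v. lor v \<nu> * P' n \<bar>lor p \<nu>\<bar>)) (at p)"
      using has_derivative_compose[OF bounded_linear_imp_has_derivative[OF lor.bounded_linear_left] \<psi>d[OF pN, unfolded has_field_derivative_def]]
      by (simp add: mult.commute)
    have 2: "(l n has_derivative (\<lambda>v. - (1 / Suc n) * snd v)) (at p)"
      unfolding l_def[abs_def] by (auto intro!: derivative_eq_intros)
    have "((\<lambda>s::real. (max 0 s)\<^sup>2) has_derivative (\<lambda>v. 2 * max 0 (l n p) * v)) (at (l n p))"
      using DERIV_pos_part_square[of "l n p"] by (simp add: has_field_derivative_def)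
    from has_derivative_compose[OF 2 this]
    have 3: "(\<eta> n has_derivative (\<lambda>v. 2 * max 0 (l n p) * (- (1 / Suc n) * snd v))) (at p)"
      unfolding \<eta>_def[abs_def] .
    show ?thesis
      unfolding f_def[abs_def] by (subst frechet_derivative_eqI[OF has_derivative_mult[OF 1 3]]) simp
  qed
  \<comment> \<open>This is \<zeta> + \<zeta>' Q/Q' for \<zeta> = \<kappa> n (1/Q), where \<zeta>' =
    -\<kappa>' Q'/Q^2 and the factor Q' cancels.\<close>
  define G where "G n y = \<kappa> n (1 / ?Q y) - \<kappa>' n (1 / ?Q y) / ?Q y" for n y
  define c where "c = 2 * (?Q t2 * s1) * sqrt (t2\<^sup>2 + 1)"
  \<comment> \<open>A bound for the term that comes from differentiating \<eta> n. The constant c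
    collects F \<kappa> <= Q(t2) s1 and the gradient bound sqrt(t2^2+1); the last factor confines
    height / (n+1) to [0,1].\<close>
  define E where "E n p = (if \<bar>lor p \<nu>\<bar> < t2 then c * (snd p / Suc n * max 0 (1 - snd p / Suc n)) else 0)" for n and p :: "'n minkowski"
  have c0: "0 \<le> c" using Q12 s12 by (simp add: c_def)
  define h where "h n p = indicator S p * (\<eta> n p * G n \<bar>lor p \<nu>\<bar> - E n p)" for n p
  have key: "h n p \<le> div_grad \<nu> (f n) p" for n p
  proof (cases "p \<in> S")
    case True
    define y where "y = \<bar>lor p \<nu>\<bar>"
    define T where "T = lor (tang \<nu> p) \<nu>"
    have y: "a \<le> y" "0 < y" "y\<^sup>2 = (lor p \<nu>)\<^sup>2" using away[OF True] a by (auto simp: y_def)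
    note Fy = F_plus_ge[OF a k y(1)]
    have Qy: "0 < ?Q y" by (rule Qpos[OF y(1)])
    have T: "0 \<le> T" "T \<le> y\<^sup>2 + 1" "\<bar>snd (tang \<nu> p)\<bar> \<le> sqrt (y\<^sup>2 + 1) * snd p"
      using tang_bounds[OF True \<nu>] by (simp_all add: T_def y(3))
    have \<tau>: "0 < snd p" using True S_hyp hypD(2) by blast
    have P'neg: "P' n y \<le> 0"
      unfolding P'_def using Fy \<kappa>b Qy
      by (intro add_nonpos_nonpos mult_nonpos_nonneg mult_nonneg_nonpos divide_nonpos_nonneg) (auto simp: sum_power2_ge_zero)
    have "P' n y * (y\<^sup>2 + 1) + real k * y * P n y = G n y"
    proof -
      have "P' n y * (y\<^sup>2 + 1) = (1 - real k * y * ?F y) * \<kappa> n (1 / ?Q y) - ((y\<^sup>2 + 1) * ?F y * ?q y) * \<kappa>' n (1 / ?Q y) / (?Q y)\<^sup>2"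
        unfolding P'_def using sq[of y] by (simp add: field_simps)
      also have "((y\<^sup>2 + 1) * ?F y * ?q y) * \<kappa>' n (1 / ?Q y) / (?Q y)\<^sup>2 = \<kappa>' n (1 / ?Q y) / ?Q y"
        unfolding F_plus_weight using Qy by (simp add: power2_eq_square)
      finally show ?thesis by (simp add: G_def P_def algebra_simps)
    qed
    \<comment> \<open>The identity just shown has y^2 + 1 in place of T = |grad x|^2. Since T is at
      most that value and P' <= 0, inserting T can only increase the expression.\<close>
    then have main: "G n y \<le> P' n y * T + real k * y * P n y"
      using mult_left_mono_neg[OF T(2) P'neg] by linarith
    have x\<psi>: "lor p \<nu> * \<psi> n (lor p \<nu>) = y * P n y"
      by (simp add: \<psi>_def y_def abs_sgn mult.assoc[symmetric])
    have err: "\<bar>\<psi> n (lor p \<nu>) * (2 * max 0 (l n p) * (- (1 / Suc n) * snd (tang \<nu> p)))\<bar> \<le> E n p"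
    proof (cases "y < t2")
      case True
      have "\<bar>\<psi> n (lor p \<nu>)\<bar> = \<bar>P n y\<bar>" using y by (auto simp: \<psi>_def y_def abs_mult abs_sgn_eq)
      also have "\<dots> = ?F y * \<kappa> n (1 / ?Q y)" using Fy \<kappa>b by (simp add: P_def)
      also have "\<dots> \<le> ?Q t2 * s1"
        using Fy \<kappa>b Q_plus_strict_mono[OF True, of k a] Q12 by (intro mult_mono) auto
      finally have 1: "\<bar>\<psi> n (lor p \<nu>)\<bar> \<le> ?Q t2 * s1" .
      have 2: "\<bar>snd (tang \<nu> p)\<bar> \<le> sqrt (t2\<^sup>2 + 1) * snd p"
      proof (rule order_trans[OF T(3)])
        have "y\<^sup>2 \<le> t2\<^sup>2" using True y by (intro power_mono) auto
        then show "sqrt (y\<^sup>2 + 1) * snd p \<le> sqrt (t2\<^sup>2 + 1) * snd p" using \<tau> by (intro mult_right_mono) auto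
      qed
      have "\<bar>\<psi> n (lor p \<nu>) * (2 * max 0 (l n p) * (- (1 / Suc n) * snd (tang \<nu> p)))\<bar>
          = \<bar>\<psi> n (lor p \<nu>)\<bar> * \<bar>snd (tang \<nu> p)\<bar> * (2 * max 0 (l n p) * (1 / Suc n))"
        by (simp add: abs_mult)
      also have "\<dots> \<le> (?Q t2 * s1) * (sqrt (t2\<^sup>2 + 1) * snd p) * (2 * max 0 (l n p) * (1 / Suc n))"
        using 1 2 Q12 s12 by (intro mult_right_mono mult_mono) auto
      also have "\<dots> = E n p" using True by (simp add: E_def y_def c_def l_def)
      finally show ?thesis .
    next
      case False
      then have "1 / ?Q y \<le> s2" using inv_iff(1)[OF y(1)] by simp
      then have "P n y = 0" by (simp add: P_def \<kappa>0)
      then show ?thesis using False by (simp add: \<psi>_def y_def[symmetric] E_def)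
    qed
    have "div_grad \<nu> (f n) p = \<eta> n p * (P' n y * T + real k * (lor p \<nu> * \<psi> n (lor p \<nu>)))
        + \<psi> n (lor p \<nu>) * (2 * max 0 (l n p) * (- (1 / Suc n) * snd (tang \<nu> p)))"
      using True by (simp add: div_grad_def fd T_def y_def f_def k_def algebra_simps)
    also have "\<dots> \<ge> \<eta> n p * G n y - E n p"
    proof -
      have "\<eta> n p * G n y \<le> \<eta> n p * (P' n y * T + real k * (y * P n y))"
        using mult_left_mono[OF main, of "\<eta> n p"] by (simp add: \<eta>_def mult.assoc)
      then show ?thesis using err unfolding x\<psi> by linarith
    qed
    finally show ?thesis using True by (simp add: h_def y_def)
  qed (simp add: h_def div_grad_def)
  have [measurable]: "S \<in> sets borel" using closed_S by simp
  have xm [measurable]: "(\<lambda>p. lor p \<nu>) \<in> borel_measurable borel"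
    by (intro borel_measurable_continuous_onI lor.continuous_on continuous_intros)
  have sm [measurable]: "(snd :: 'n minkowski \<Rightarrow> real) \<in> borel_measurable borel"
    by (intro borel_measurable_continuous_onI continuous_intros)
  have Qm [measurable]: "?Q \<in> borel_measurable borel" by (intro borel_measurable_continuous_onI Q_plus_continuous)
  have \<kappa>m [measurable]: "\<kappa> n \<in> borel_measurable borel" "\<kappa>' n \<in> borel_measurable borel" for n
    by (intro borel_measurable_continuous_onI \<kappa>c \<kappa>'c)+
  have hm: "h n \<in> borel_measurable vol" for n
    unfolding h_def[abs_def] G_def E_def \<eta>_def l_def by measurable
  define S2 where "S2 = {p\<in>S. \<bar>lor p \<nu>\<bar> \<le> t2}"
  have S2m [measurable]: "S2 \<in> sets borel" unfolding S2_def by measurable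
  define C where "C = s1 + 1 / ?Q a + c"
  \<comment> \<open>Finite volume below t2 makes this constant on S2 integrable; off S2 every h n
    vanishes.\<close>
  define w where "w p = C * indicator S2 p" for p
  have wi: "integrable vol w"
    unfolding w_def using fin by (intro integrable_mult_right integrable_real_indicator) (auto simp: S2_def)
  have G0: "G n y = 0" if "t2 \<le> y" for n y
  proof -
    have "1 / ?Q y \<le> s2" using inv_iff(1)[of y] that t by simp
    then show ?thesis by (simp add: G_def \<kappa>0)
  qed
  have \<eta>b: "0 \<le> \<eta> n p" "\<eta> n p \<le> 1" if "p \<in> S" for n p
  proof -
    have "0 < snd p" using that S_hyp hypD(2) by blast
    then show "\<eta> n p \<le> 1" by (auto simp: \<eta>_def l_def max_def power_le_one)
  qed (simp add: \<eta>_def)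
  have hb: "norm (h n p) \<le> w p" for n p
  proof (cases "p \<in> S \<and> \<bar>lor p \<nu>\<bar> < t2")
    case True
    define y where "y = \<bar>lor p \<nu>\<bar>"
    have y: "a \<le> y" using away True by (simp add: y_def)
    have Qa: "0 < ?Q a" "?Q a \<le> ?Q y" using Qpos[of a] Q_plus_strict_mono[of a y k a] y by (cases "a = y"; simp)+
    have "\<bar>G n y\<bar> \<le> \<kappa> n (1 / ?Q y) + \<kappa>' n (1 / ?Q y) / ?Q y"
      unfolding G_def using \<kappa>b[of n "1 / ?Q y"] Qa by (intro order_trans[OF abs_triangle_ineq4]) auto
    also have "\<dots> \<le> s1 + 1 / ?Q a"
      using \<kappa>b[of n "1 / ?Q y"] Qa by (intro add_mono frac_le) auto
    finally have 1: "\<bar>G n y\<bar> \<le> s1 + 1 / ?Q a" .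
    have \<tau>: "0 < snd p" using True S_hyp hypD(2) by blast
    have 2: "\<bar>E n p\<bar> \<le> c"
    proof -
      have "\<bar>E n p\<bar> = c * (snd p / Suc n * max 0 (1 - snd p / Suc n))"
        using True c0 \<tau> by (simp add: E_def abs_mult)
      also have "\<dots> \<le> c * 1" using \<tau> by (intro mult_left_mono mult_max_le_one c0) auto
      finally show ?thesis by simp
    qed
    have "\<bar>\<eta> n p * G n y\<bar> \<le> 1 * \<bar>G n y\<bar>" unfolding abs_mult using \<eta>b[of p n] True by (intro mult_right_mono) auto
    then have "\<bar>\<eta> n p * G n y - E n p\<bar> \<le> C" using 1 2 unfolding C_def by linarith
    then show ?thesis using True by (simp add: h_def w_def y_def S2_def)
  next
    case False
    have "0 \<le> C" using s12 c0 Qpos[of a] by (simp add: C_def)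
    then show ?thesis using False G0 by (auto simp: h_def E_def w_def indicator_def)
  qed
  \<comment> \<open>For y < t1 the function G tends to s1 - s2; for t1 <= y < t2 the terms 1/Q
    cancel and leave -s2.\<close>
  define g where "g p = s1 * indicator {p\<in>S. \<bar>lor p \<nu>\<bar> < t1} p - s2 * indicator {p\<in>S. \<bar>lor p \<nu>\<bar> < t2} p" for p
  have hlim: "(\<lambda>n. h n p) \<longlonglongrightarrow> g p" for p
  proof (cases "p \<in> S")
    case True
    define y where "y = \<bar>lor p \<nu>\<bar>"
    have y: "a \<le> y" using away True by (simp add: y_def)
    have Qy: "0 < ?Q y" by (rule Qpos[OF y])
    have l1: "(\<lambda>n. l n p) \<longlonglongrightarrow> 1"
      unfolding l_def by real_asymp
    have "(\<lambda>n. \<eta> n p) \<longlonglongrightarrow> (max 0 1)\<^sup>2" unfolding \<eta>_def by (intro tendsto_intros l1)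
    then have 1: "(\<lambda>n. \<eta> n p) \<longlonglongrightarrow> 1" by simp
    have 2: "(\<lambda>n. E n p) \<longlonglongrightarrow> 0"
    proof (cases "y < t2")
      case True
      have z: "(\<lambda>n. snd p / Suc n) \<longlonglongrightarrow> 0" by real_asymp
      have "(\<lambda>n. c * (snd p / Suc n * max 0 (1 - snd p / Suc n))) \<longlonglongrightarrow> c * (0 * max 0 (1 - 0))"
        by (intro tendsto_intros z)
      then show ?thesis using True by (simp add: E_def y_def)
    qed (simp add: E_def y_def)
    let ?s = "1 / ?Q y"
    have "(\<lambda>n. G n y) \<longlonglongrightarrow> (max 0 (?s - s2) - max 0 (?s - s1)) - ((if 0 < ?s - s2 then 1 else 0) - (if 0 < ?s - s1 then 1 else 0)) / ?Q y"
      unfolding G_def \<kappa>_def \<kappa>'_def using Qy by (intro tendsto_intros pos_approx_limits) auto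
    also have "(max 0 (?s - s2) - max 0 (?s - s1)) - ((if 0 < ?s - s2 then 1 else 0) - (if 0 < ?s - s1 then 1 else 0)) / ?Q y
       = (if y < t1 then s1 else 0) - (if y < t2 then s2 else 0)"
      using inv_iff[OF y] t(2) by (auto simp: max_def)
    finally have 3: "(\<lambda>n. G n y) \<longlonglongrightarrow> (if y < t1 then s1 else 0) - (if y < t2 then s2 else 0)" .
    have "(\<lambda>n. \<eta> n p * G n y - E n p) \<longlonglongrightarrow> 1 * ((if y < t1 then s1 else 0) - (if y < t2 then s2 else 0)) - 0"
      by (intro tendsto_intros 1 2 3)
    then show ?thesis
      using True by (cases "\<bar>lor p \<nu>\<bar> < t1"; cases "\<bar>lor p \<nu>\<bar> < t2") (simp_all add: h_def g_def y_def)
  qed (simp add: h_def g_def)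
  have gm: "g \<in> borel_measurable vol" unfolding g_def[abs_def] by measurable
  have dc: "(\<lambda>n. \<integral>p. h n p \<partial>vol) \<longlonglongrightarrow> (\<integral>p. g p \<partial>vol)"
    by (rule integral_dominated_convergence[OF gm hm wi]) (use hlim hb in simp_all)
  have hi: "integrable vol (h n)" for n
    by (rule Bochner_Integration.integrable_bound[OF wi hm]) (intro always_eventually allI order_trans[OF hb], simp)
  have "(\<integral>p. h n p \<partial>vol) \<le> 0" for n
  proof -
    have "(\<integral>p. h n p \<partial>vol) \<le> (\<integral>p. div_grad \<nu> (f n) p \<partial>vol)"
      by (intro integral_mono hi key div_grad_integrable[OF oN SN fC Kn f0])
    also have "\<dots> = 0" by (rule integral_div_grad[OF oN SN fC Kn f0 minimal])
    finally show ?thesis .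
  qed
  then have "(\<integral>p. g p \<partial>vol) \<le> 0" using dc by (intro LIMSEQ_le_const2) auto
  moreover have "(\<integral>p. g p \<partial>vol) = s1 * measure vol {p\<in>S. \<bar>lor p \<nu>\<bar> < t1} - s2 * measure vol {p\<in>S. \<bar>lor p \<nu>\<bar> < t2}"
  proof -
    have "emeasure vol {p\<in>S. \<bar>lor p \<nu>\<bar> < s} < \<infinity>" if "s \<le> t2" for s
      by (rule le_less_trans[OF emeasure_mono fin]) (use that S2m in \<open>auto simp: S2_def\<close>)
    then have "integrable vol (\<lambda>p. indicator {p\<in>S. \<bar>lor p \<nu>\<bar> < s} p :: real)" if "s \<le> t2" for s
      using that by (intro integrable_real_indicator) auto
    then show ?thesis unfolding g_def using t(2) by simp
  qed
  ultimately show ?thesis by (simp add: s1_def s2_def k_def)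
qed

text \<open>The closed sublevel set at t1 is contained in the strict one at every s > t1. Letting s
  decrease to t1, continuity of Q carries the strict comparison over.\<close>

lemma volume_comparison:
  assumes \<nu>: "lor \<nu> \<nu> = 1" and a: "0 < a" and away: "\<And>p. p \<in> S \<Longrightarrow> a \<le> \<bar>lor p \<nu>\<bar>"
    and minimal: "\<And>p. p \<in> S \<Longrightarrow> mean_curvature S p = 0"
    and t: "a \<le> t1" "t1 < t2" and fin: "emeasure vol {p\<in>S. \<bar>lor p \<nu>\<bar> \<le> t2} < \<infinity>"
  shows "measure vol {p\<in>S. \<bar>lor p \<nu>\<bar> \<le> t1} / Q_plus CARD('k) a t1
       \<le> measure vol {p\<in>S. \<bar>lor p \<nu>\<bar> \<le> t2} / Q_plus CARD('k) a t2"
proof -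
  let ?Q = "Q_plus CARD('k) a" and ?m = "measure vol"
  let ?A = "\<lambda>t. {p\<in>S. \<bar>lor p \<nu>\<bar> \<le> t}" and ?B = "\<lambda>t. {p\<in>S. \<bar>lor p \<nu>\<bar> < t}"
  have Qpos: "0 < ?Q s" if "a \<le> s" for s by (rule Q_plus_pos[OF a _ that]) simp
  have [measurable]: "S \<in> sets borel" "(\<lambda>p. lor p \<nu>) \<in> borel_measurable borel"
    using closed_S by (auto intro!: borel_measurable_continuous_onI lor.continuous_on continuous_intros)
  have fm: "A \<in> fmeasurable vol" if "A \<in> sets borel" "A \<subseteq> ?A t2" for A
    using that fin by (intro fmeasurableI le_less_trans[OF emeasure_mono fin]) auto
  have AB: "?A s \<in> fmeasurable vol" "?B s \<in> fmeasurable vol" if "s \<le> t2" for s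
    using that by (auto intro!: fm)
  define c where "c = ?m (?A t2) / ?Q t2"
  have le: "?m (?A t1) \<le> c * ?Q s" if s: "t1 < s" "s < t2" for s
  proof -
    have "?m (?A t1) \<le> ?m (?B s)" using s AB[of s] AB(1)[of t1] by (intro measure_mono_fmeasurable) auto
    also have "\<dots> = ?m (?B s) / ?Q s * ?Q s" using Qpos[of s] s t by simp
    also have "?m (?B s) / ?Q s \<le> ?m (?B t2) / ?Q t2"
      by (rule strict_volume_comparison[OF \<nu> a away minimal _ s(2) fin]) (use s t in auto)
    also have "\<dots> \<le> c" unfolding c_def
      using AB[of t2] Qpos[of t2] t by (intro divide_right_mono measure_mono_fmeasurable) auto
    finally show ?thesis using Qpos[of s] s t by (simp add: mult_right_mono)
  qed
  have "continuous_on UNIV ?Q" by (rule Q_plus_continuous)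
  then have "isCont ?Q t1" by (simp add: continuous_on_eq_continuous_at)
  then have lim: "((\<lambda>s. c * ?Q s) \<longlongrightarrow> c * ?Q t1) (at_right t1)"
    by (intro tendsto_intros) (simp add: isCont_def filterlim_at_split)
  have "\<forall>\<^sub>F s in at_right t1. ?m (?A t1) \<le> c * ?Q s"
    using le t(2) by (auto simp: eventually_at_right_field)
  from tendsto_lowerbound[OF lim this] have "?m (?A t1) \<le> c * ?Q t1" by simp
  then show ?thesis using Qpos[OF t(1)] by (simp add: c_def pos_divide_le_eq)
qed

end

text \<open>For t < a the sublevel set is empty and the quotient is 0 whatever the sign of Q; a zero
  of Q can only occur there, and is left out of the domain. Extended reals admit infinite
  volume.\<close>

theorem theorem1p2:
  fixes H \<Sigma> :: "'n::finite minkowski set" and a :: real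
  assumes "totally_geodesic_hyperplane H"
    and "minimal_submanifold CARD('k::finite) \<Sigma>"
    and "closed \<Sigma>"
    and "closure (to_ball ` \<Sigma>) \<inter> to_ball ` H = {}"
    and "0 < a" and "a \<le> sinh (hdist_sets \<Sigma> H)"
  shows "mono_on {t. Q_plus CARD('k) a t \<noteq> 0}
           (\<lambda>t. enn2ereal (k_volume TYPE('k) \<Sigma> {p\<in>\<Sigma>. sinh (hdist_point_set p H) \<le> t})
                / ereal (Q_plus CARD('k) a t))"
proof -
  obtain \<nu> where \<nu>: "lor \<nu> \<nu> = 1" "H = {p\<in>hyp. lor p \<nu> = 0}"
    using totally_geodesic_hyperplane_eq[OF assms(1)] by blast
  have \<Sigma>: "\<Sigma> \<subseteq> hyp" "submanifold CARD('k) \<Sigma>" "\<And>p. p \<in> \<Sigma> \<Longrightarrow> mean_curvature \<Sigma> p = 0"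
    using assms(2) unfolding minimal_submanifold_def by blast+
  have away: "a \<le> \<bar>lor p \<nu>\<bar>" if "p \<in> \<Sigma>" for p
    using hdist_sets_le[OF \<nu>(1) \<Sigma>(1) that] assms(6) unfolding \<nu>(2) by linarith
  define \<A> where "\<A> = (SOME \<A> :: nat \<Rightarrow> (real^'k) set \<times> (real^'k \<Rightarrow> 'n minkowski). countable_atlas \<Sigma> \<A>)"
  note vol = k_volume_eq_vol[OF \<Sigma>(1) assms(3) \<Sigma>(2), folded \<A>_def]
  interpret atlas \<Sigma> \<A> by (rule vol(1))
  let ?Q = "Q_plus CARD('k) a"
  let ?A = "\<lambda>t. {p\<in>\<Sigma>. \<bar>lor p \<nu>\<bar> \<le> t}"
  have kv: "k_volume TYPE('k) \<Sigma> {p\<in>\<Sigma>. sinh (hdist_point_set p H) \<le> t} = emeasure vol (?A t)" for t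
  proof -
    have eq: "sinh (hdist_point_set p H) = \<bar>lor p \<nu>\<bar>" if "p \<in> \<Sigma>" for p
      unfolding \<nu>(2) by (rule hdist_point_hyperplane(1)[OF \<nu>(1)]) (use that \<Sigma>(1) in blast)
    have "{p\<in>\<Sigma>. sinh (hdist_point_set p H) \<le> t} = ?A t"
      by (intro Collect_cong conj_cong refl) (simp only: eq)
    moreover have "?A t = \<Sigma> \<inter> {p. \<bar>lor p \<nu>\<bar> \<le> t}" by blast
    moreover have "closed (\<Sigma> \<inter> {p. \<bar>lor p \<nu>\<bar> \<le> t})"
      by (intro closed_Int assms(3) closed_Collect_le continuous_intros lor.continuous_on)
    ultimately show ?thesis using vol(2)[of "?A t"] by (simp only: borel_closed)
  qed
  have Qpos: "0 < ?Q s" if "a \<le> s" for s by (rule Q_plus_pos[OF assms(5) _ that]) simp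
  show ?thesis
    unfolding kv
  proof (rule mono_onI)
    fix r s assume rs: "r \<in> {t. ?Q t \<noteq> 0}" "s \<in> {t. ?Q t \<noteq> 0}" "r \<le> s"
    consider "r = s" | "r < a" "r < s" | "a \<le> r" "r < s" using rs(3) by linarith
    then show "enn2ereal (emeasure vol (?A r)) / ereal (?Q r) \<le> enn2ereal (emeasure vol (?A s)) / ereal (?Q s)"
    proof cases
      case 2
      have e: "?A t = {}" if "t < a" for t using away that by force
      have l: "enn2ereal (emeasure vol (?A r)) / ereal (?Q r) = 0" unfolding e[OF 2(1)] by (simp add: zero_ennreal.rep_eq)
      show ?thesis
      proof (cases "s < a")
        case True
        show ?thesis unfolding e[OF 2(1)] e[OF True] by (simp add: zero_ennreal.rep_eq)
      next
        case False
        have "0 \<le> enn2ereal (emeasure vol (?A s)) / ereal (?Q s)"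
          using Qpos[of s] False by (simp add: zero_le_divide_ereal)
        then show ?thesis unfolding l .
      qed
    next
      case 3
      have Q: "0 < ?Q r" "0 < ?Q s" using Qpos[of r] Qpos[of s] 3 by auto
      show ?thesis
      \<comment> \<open>Infinite volume at s makes the right side \<infinity>; for finite volume the
        comparison takes place among real numbers.\<close>
      proof (cases "emeasure vol (?A s) < \<infinity>")
        case True
        have "emeasure vol (?A r) \<le> emeasure vol (?A s)"
        proof (rule emeasure_mono)
          have "?A s = \<Sigma> \<inter> {p. \<bar>lor p \<nu>\<bar> \<le> s}" by blast
          moreover have "closed (\<Sigma> \<inter> {p. \<bar>lor p \<nu>\<bar> \<le> s})"
            by (intro closed_Int assms(3) closed_Collect_le continuous_intros lor.continuous_on)
          ultimately show "?A s \<in> sets vol" by simp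
        qed (use 3 in auto)
        then have "emeasure vol (?A r) < \<infinity>" using True by (rule le_less_trans)
        then have e: "emeasure vol (?A r) = ennreal (measure vol (?A r))" "emeasure vol (?A s) = ennreal (measure vol (?A s))"
          using True by (auto intro!: emeasure_eq_ennreal_measure)
        have "measure vol (?A r) / ?Q r \<le> measure vol (?A s) / ?Q s"
          by (rule volume_comparison[OF \<nu>(1) assms(5) away \<Sigma>(3) 3 True])
        then show ?thesis unfolding e using Q by (simp add: enn2ereal_ennreal)
      next
        case False
        then have "enn2ereal (emeasure vol (?A s)) / ereal (?Q s) = \<infinity>"
          using Q(2) by (simp add: less_top[symmetric] top_ennreal.rep_eq top_ereal_def)
        then show ?thesis by simp
      qed
    qed simp
  qed
qed

end
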